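(* Let $A$ be a finite alphabet and let $F$ be a recurrent subset of $A^*$. Suppose that $Z\subseteq A^+$ is a rational bifix code of finite degree $d(Z)$. Let $X=Z\cap F$ and suppose that $X$ is rational. The following conditions are equivalent: (1) $Z$ is $F$-charged; (2) $d_F(X)=d(Z)$, $G_F(X)\simeq G(Z)$ and $X$ is weakly $F$-charged; (3) $d_F(X)=d(Z)$, $|G_F(X)|=|G(Z)|$ and $X$ is weakly $F$-charged.
   Context: All alphabets are finite. $A^*$ is the free monoid on $A$, $1$ is the empty word, $A^+=A^*\setminus\{1\}$. A language is rational if it is recognized by a finite automaton. Codes. A nonempty $X\subseteq A^+$ is a prefix code if $X\cap XA^+=\emptyset$, a suffix code if $X\cap A^+X=\emptyset$, and a bifix code if it is both. Recurrent sets. $F\subseteq A^*$ is factorial if it contains every factor of each of its elements. A nonempty factorial set $F\neq\{1\}$ is recurrent if for all $u,v\in F$ there is $w\in F$ with $uwv\in F$. Degree. A parse of a word $w$ with respect to $X\subseteq A^*$ is a triple $(v,x,u)$ with $w=vxu$, $v\in A^*\setminus A^*X$, $x\in X^*$, $u\in A^*\setminus XA^*$; $\delta_X(w)$ is the number of parses of $w$. For $F$ factorial, the $F$-degree is $d_F(X)=\sup\{\delta_X(w)\mid w\in F\}$, and the degree is $d(X)=d_{A^*}(X)$. Free profinite monoid. $\widehat{A^*}$ is the free profinite monoid generated by $A$ (the profinite completion of $A^*$), a compact monoid containing $A^*$ as a dense submonoid; $\overline{Y}$ is the topological closure of $Y$ in $\widehat{A^*}$. If $F$ is recurrent, there is a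 unique regular $\mathcal J$-class $J(F)$ of $\widehat{A^*}$ contained in $\overline F$ such that $\overline F$ is the set of factors in $\widehat{A^*}$ of elements of $J(F)$. The maximal subgroups of a monoid are the $\mathcal H$-classes of its idempotents; those in the same regular $\mathcal D$-class are isomorphic, and the Schützenberger group of a regular $\mathcal D$-class is the (isomorphism class of the) group given by its maximal subgroups. (In profinite monoids $\mathcal J=\mathcal D$.) Syntactic monoids. For a rational language $L\subseteq A^*$, $M(L)$ is its (finite) syntactic monoid, $\eta_L\colon A^*\to M(L)$ the syntactic homomorphism, and $\hat\eta_L\colon\widehat{A^*}\to M(L)$ its unique continuous extension. For a rational code $Z$, $J(Z)$ is the minimum ideal of $M(Z^* )$ and $G(Z)$ is the Schützenberger group of $J(Z)$. For a rational code $X$ and a recurrent set $F$, $J_F(X)$ is the regular $\mathcal J$-class of $M(X^* )$ containing $\hat\eta_{X^*}(J(F))$, and $G_F(X)$ is the Schützenberger group of $J_F(X)$. Charged codes. A rational code $Z$ of $A^*$ is $F$-charged if $\hat\eta_{Z^*}$ maps all (equivalently, some) maximal subgroups of $J(F)$ onto maximal subgroups of $J(Z)$. A rational code $X$ contained in $F$ is weakly $F$-charged if $\hat\eta_{X^*}$ maps all (equivalently, some) maximal subgroups of $J(F)$ onto maximal subgroups of $J_F(X)$. *)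

theory Defs
  imports
    "HOL-Algebra.Coset"
    "HOL-Analysis.Abstract_Topological_Spaces"
    "HOL-Library.Sublist"
    "HOL-Library.Extended_Nat"
begin

section \<open>Languages, codes, parses\<close>

definition lang_conc :: "'a list set \<Rightarrow> 'a list set \<Rightarrow> 'a list set" (infixr \<open>@@\<close> 75) where
  "X @@ Y = {x @ y | x y. x \<in> X \<and> y \<in> Y}"

definition lang_star :: "'a list set \<Rightarrow> 'a list set" where
  "lang_star X = concat ` lists X"

abbreviation nonempty_words :: "'a list set" where
  "nonempty_words \<equiv> UNIV - {[]}"

definition rational :: "'a list set \<Rightarrow> bool" where
  "rational L \<longleftrightarrow>
     (\<exists>(Q :: nat set) i T \<delta>. finite Q \<and> i \<in> Q \<and> T \<subseteq> Q \<and> (\<forall>q\<in>Q. \<forall>a. \<delta> q a \<in> Q) \<and>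
        L = {w. foldl \<delta> i w \<in> T})"

definition prefix_code :: "'a list set \<Rightarrow> bool" where
  "prefix_code X \<longleftrightarrow> X \<noteq> {} \<and> X \<subseteq> nonempty_words \<and> X \<inter> (X @@ nonempty_words) = {}"

definition suffix_code :: "'a list set \<Rightarrow> bool" where
  "suffix_code X \<longleftrightarrow> X \<noteq> {} \<and> X \<subseteq> nonempty_words \<and> X \<inter> (nonempty_words @@ X) = {}"

definition bifix_code :: "'a list set \<Rightarrow> bool" where
  "bifix_code X \<longleftrightarrow> prefix_code X \<and> suffix_code X"

definition factorial_set :: "'a list set \<Rightarrow> bool" where
  "factorial_set F \<longleftrightarrow> (\<forall>w\<in>F. \<forall>u. sublist u w \<longrightarrow> u \<in> F)"

definition recurrent_set :: "'a list set \<Rightarrow> bool" where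
  "recurrent_set F \<longleftrightarrow> factorial_set F \<and> F \<noteq> {} \<and> F \<noteq> {[]} \<and>
     (\<forall>u\<in>F. \<forall>v\<in>F. \<exists>w\<in>F. u @ w @ v \<in> F)"

definition parses :: "'a list set \<Rightarrow> 'a list \<Rightarrow> ('a list \<times> 'a list \<times> 'a list) set" where
  "parses X w = {(v, x, u). w = v @ x @ u \<and>
     v \<notin> UNIV @@ X \<and> x \<in> lang_star X \<and> u \<notin> X @@ UNIV}"

definition num_parses :: "'a list set \<Rightarrow> 'a list \<Rightarrow> nat" where
  "num_parses X w = card (parses X w)"

definition degree_in :: "'a list set \<Rightarrow> 'a list set \<Rightarrow> enat" where
  "degree_in F X = (SUP w\<in>F. enat (num_parses X w))"

abbreviation code_degree :: "'a list set \<Rightarrow> enat" where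
  "code_degree X \<equiv> degree_in UNIV X"

section \<open>Green's relations and maximal subgroups of a monoid\<close>

definition R_class :: "('m, 'b) monoid_scheme \<Rightarrow> 'm \<Rightarrow> 'm set" where
  "R_class M x = {y \<in> carrier M. y <#\<^bsub>M\<^esub> carrier M = x <#\<^bsub>M\<^esub> carrier M}"

definition L_class :: "('m, 'b) monoid_scheme \<Rightarrow> 'm \<Rightarrow> 'm set" where
  "L_class M x = {y \<in> carrier M. carrier M #>\<^bsub>M\<^esub> y = carrier M #>\<^bsub>M\<^esub> x}"

definition H_class :: "('m, 'b) monoid_scheme \<Rightarrow> 'm \<Rightarrow> 'm set" where
  "H_class M x = R_class M x \<inter> L_class M x"

definition principal_ideal :: "('m, 'b) monoid_scheme \<Rightarrow> 'm \<Rightarrow> 'm set" where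
  "principal_ideal M x = {a \<otimes>\<^bsub>M\<^esub> x \<otimes>\<^bsub>M\<^esub> b | a b. a \<in> carrier M \<and> b \<in> carrier M}"

definition J_class :: "('m, 'b) monoid_scheme \<Rightarrow> 'm \<Rightarrow> 'm set" where
  "J_class M x = {y \<in> carrier M. principal_ideal M y = principal_ideal M x}"

definition idempotents :: "('m, 'b) monoid_scheme \<Rightarrow> 'm set" where
  "idempotents M = {e \<in> carrier M. e \<otimes>\<^bsub>M\<^esub> e = e}"

definition regular_J_class :: "('m, 'b) monoid_scheme \<Rightarrow> 'm set \<Rightarrow> bool" where
  "regular_J_class M J \<longleftrightarrow> (\<exists>x\<in>carrier M. J = J_class M x) \<and> J \<inter> idempotents M \<noteq> {}"

definition factors :: "('m, 'b) monoid_scheme \<Rightarrow> 'm set \<Rightarrow> 'm set" where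
  "factors M S = {y \<in> carrier M. \<exists>x\<in>S. x \<in> principal_ideal M y}"

definition monoid_ideal :: "('m, 'b) monoid_scheme \<Rightarrow> 'm set \<Rightarrow> bool" where
  "monoid_ideal M I \<longleftrightarrow> I \<noteq> {} \<and> I \<subseteq> carrier M \<and>
     (\<forall>x\<in>I. \<forall>a\<in>carrier M. a \<otimes>\<^bsub>M\<^esub> x \<in> I \<and> x \<otimes>\<^bsub>M\<^esub> a \<in> I)"

definition minimum_ideal :: "('m, 'b) monoid_scheme \<Rightarrow> 'm set" where
  "minimum_ideal M = (LEAST I. monoid_ideal M I)"

definition maximal_subgroups_in :: "('m, 'b) monoid_scheme \<Rightarrow> 'm set \<Rightarrow> 'm set set" where
  "maximal_subgroups_in M D = {H_class M e | e. e \<in> idempotents M \<and> H_class M e \<subseteq> D}"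

text \<open>The Schuetzenberger group of a regular \<open>\<D>\<close>-class is an isomorphism class of groups; it is
  represented here by the maximal subgroup at an arbitrarily chosen idempotent.\<close>

definition schuetzenberger_group :: "('m, 'b) monoid_scheme \<Rightarrow> 'm set \<Rightarrow> ('m, 'b) monoid_scheme" where
  "schuetzenberger_group M D =
     (let e = (SOME e. e \<in> idempotents M \<and> e \<in> D) in M\<lparr>carrier := H_class M e, one := e\<rparr>)"

section \<open>Quotients of the free monoid and syntactic monoids\<close>

definition word_congruence :: "'a list rel \<Rightarrow> bool" where
  "word_congruence \<theta> \<longleftrightarrow> equiv UNIV \<theta> \<and>
     (\<forall>u u' v v'. (u, u') \<in> \<theta> \<longrightarrow> (v, v') \<in> \<theta> \<longrightarrow> (u @ v, u' @ v') \<in> \<theta>)"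

definition quotient_monoid :: "'a list rel \<Rightarrow> 'a list set monoid" where
  "quotient_monoid \<theta> =
     \<lparr>carrier = UNIV // \<theta>, mult = (\<lambda>C D. \<theta> `` (C @@ D)), one = \<theta> `` {[]}\<rparr>"

definition syntactic_congruence :: "'a list set \<Rightarrow> 'a list rel" where
  "syntactic_congruence L = {(u, v). \<forall>x y. x @ u @ y \<in> L \<longleftrightarrow> x @ v @ y \<in> L}"

definition syntactic_monoid :: "'a list set \<Rightarrow> 'a list set monoid" where
  "syntactic_monoid L = quotient_monoid (syntactic_congruence L)"

definition syntactic_hom :: "'a list set \<Rightarrow> 'a list \<Rightarrow> 'a list set" where
  "syntactic_hom L w = syntactic_congruence L `` {w}"

section \<open>The free profinite monoid\<close>

text \<open>The profinite completion of the free monoid is the inverse limit of its finite quotients, with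
  the topology induced by the product of the discrete topologies. An element is a family of classes,
  one for each congruence of finite index, compatible with the canonical projections.\<close>

definition finite_congruences :: "'a list rel set" where
  "finite_congruences = {\<theta>. word_congruence \<theta> \<and> finite (UNIV // \<theta>)}"

definition profinite_carrier :: "('a list rel \<Rightarrow> 'a list set) set" where
  "profinite_carrier = {\<pi> \<in> (\<Pi>\<^sub>E \<theta>\<in>finite_congruences. UNIV // \<theta>).
     \<forall>\<theta>\<in>finite_congruences. \<forall>\<theta>'\<in>finite_congruences. \<theta> \<subseteq> \<theta>' \<longrightarrow> \<pi> \<theta> \<subseteq> \<pi> \<theta>'}"

definition free_profinite_monoid :: "('a list rel \<Rightarrow> 'a list set) monoid" where
  "free_profinite_monoid =
     \<lparr>carrier = profinite_carrier,
      mult = (\<lambda>\<pi> \<rho>. \<lambda>\<theta>\<in>finite_congruences. \<pi> \<theta> \<otimes>\<^bsub>quotient_monoid \<theta>\<^esub> \<rho> \<theta>),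
      one = (\<lambda>\<theta>\<in>finite_congruences. \<one>\<^bsub>quotient_monoid \<theta>\<^esub>)\<rparr>"

definition profinite_topology :: "('a list rel \<Rightarrow> 'a list set) topology" where
  "profinite_topology =
     subtopology (product_topology (\<lambda>\<theta>. discrete_topology (UNIV // \<theta>)) finite_congruences)
       profinite_carrier"

definition word_embedding :: "'a list \<Rightarrow> ('a list rel \<Rightarrow> 'a list set)" where
  "word_embedding w = (\<lambda>\<theta>\<in>finite_congruences. \<theta> `` {w})"

definition profinite_closure :: "'a list set \<Rightarrow> ('a list rel \<Rightarrow> 'a list set) set" where
  "profinite_closure Y = profinite_topology closure_of (word_embedding ` Y)"

text \<open>For rational \<open>L\<close> the syntactic congruence has finite index, and the continuous extension of
  the syntactic homomorphism is the corresponding coordinate; see \<open>syntactic_hat_extension\<close> and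
  \<open>syntactic_hat_unique\<close> below.\<close>

definition syntactic_hat :: "'a list set \<Rightarrow> ('a list rel \<Rightarrow> 'a list set) \<Rightarrow> 'a list set" where
  "syntactic_hat L \<pi> = \<pi> (syntactic_congruence L)"

section \<open>Distinguished classes, their groups, and charged codes\<close>

definition J_of_set :: "'a list set \<Rightarrow> ('a list rel \<Rightarrow> 'a list set) set" where
  "J_of_set F = (THE J. regular_J_class free_profinite_monoid J \<and> J \<subseteq> profinite_closure F \<and>
     profinite_closure F = factors free_profinite_monoid J)"

definition J_of_code :: "'a list set \<Rightarrow> 'a list set set" where
  "J_of_code Z = minimum_ideal (syntactic_monoid (lang_star Z))"

definition G_of_code :: "'a list set \<Rightarrow> 'a list set monoid" where
  "G_of_code Z = schuetzenberger_group (syntactic_monoid (lang_star Z)) (J_of_code Z)"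

definition J_in :: "'a list set \<Rightarrow> 'a list set \<Rightarrow> 'a list set set" where
  "J_in F X = (THE J. regular_J_class (syntactic_monoid (lang_star X)) J \<and>
     syntactic_hat (lang_star X) ` J_of_set F \<subseteq> J)"

definition G_in :: "'a list set \<Rightarrow> 'a list set \<Rightarrow> 'a list set monoid" where
  "G_in F X = schuetzenberger_group (syntactic_monoid (lang_star X)) (J_in F X)"

text \<open>Used for rational codes \<open>Z\<close>.\<close>

definition charged :: "'a list set \<Rightarrow> 'a list set \<Rightarrow> bool" where
  "charged F Z \<longleftrightarrow> (\<forall>H \<in> maximal_subgroups_in free_profinite_monoid (J_of_set F).
     syntactic_hat (lang_star Z) ` H
       \<in> maximal_subgroups_in (syntactic_monoid (lang_star Z)) (J_of_code Z))"

text \<open>Used for rational codes \<open>X\<close> contained in \<open>F\<close>.\<close>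

definition weakly_charged :: "'a list set \<Rightarrow> 'a list set \<Rightarrow> bool" where
  "weakly_charged F X \<longleftrightarrow> (\<forall>H \<in> maximal_subgroups_in free_profinite_monoid (J_of_set F).
     syntactic_hat (lang_star X) ` H
       \<in> maximal_subgroups_in (syntactic_monoid (lang_star X)) (J_in F X))"

section \<open>The constructions have the intended properties\<close>

lemma class_mult:
  assumes "word_congruence \<theta>"
  shows "\<theta> `` ((\<theta> `` {u}) @@ (\<theta> `` {v})) = \<theta> `` {u @ v}"
proof -
  have e: "equiv UNIV \<theta>" using assms by (simp add: word_congruence_def)
  have r: "\<And>x. (x, x) \<in> \<theta>" using e by (simp add: equiv_def refl_on_def)
  have t: "\<And>x y z. (x, y) \<in> \<theta> \<Longrightarrow> (y, z) \<in> \<theta> \<Longrightarrow> (x, z) \<in> \<theta>"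
    using e by (meson equiv_def transD)
  have c: "\<And>u u' v v'. (u, u') \<in> \<theta> \<Longrightarrow> (v, v') \<in> \<theta> \<Longrightarrow> (u @ v, u' @ v') \<in> \<theta>"
    using assms by (simp add: word_congruence_def)
  show ?thesis
  proof (intro equalityI subsetI)
    fix w assume "w \<in> \<theta> `` ((\<theta> `` {u}) @@ (\<theta> `` {v}))"
    then obtain u' v' where "(u, u') \<in> \<theta>" "(v, v') \<in> \<theta>" "(u' @ v', w) \<in> \<theta>"
      by (auto simp: lang_conc_def)
    then show "w \<in> \<theta> `` {u @ v}" using c t by blast
  next
    fix w assume "w \<in> \<theta> `` {u @ v}"
    then show "w \<in> \<theta> `` ((\<theta> `` {u}) @@ (\<theta> `` {v}))"
      using r by (auto simp: lang_conc_def)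
  qed
qed

lemma quotient_monoid_monoid:
  assumes "word_congruence \<theta>"
  shows "monoid (quotient_monoid \<theta>)"
proof (rule monoidI)
  have rep: "\<exists>u. C = \<theta> `` {u}" if "C \<in> carrier (quotient_monoid \<theta>)" for C
    using that by (auto simp: quotient_monoid_def elim: quotientE)
  have m: "(\<theta> `` {u}) \<otimes>\<^bsub>quotient_monoid \<theta>\<^esub> (\<theta> `` {v}) = \<theta> `` {u @ v}" for u v
    by (simp add: quotient_monoid_def class_mult[OF assms])
  have o: "\<one>\<^bsub>quotient_monoid \<theta>\<^esub> = \<theta> `` {[]}" by (simp add: quotient_monoid_def)
  have c: "\<theta> `` {u} \<in> carrier (quotient_monoid \<theta>)" for u
    by (simp add: quotient_monoid_def quotientI)
  show "\<one>\<^bsub>quotient_monoid \<theta>\<^esub> \<in> carrier (quotient_monoid \<theta>)" by (simp only: o c)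
  fix x y z
  assume x: "x \<in> carrier (quotient_monoid \<theta>)"
  obtain u where u: "x = \<theta> `` {u}" using rep[OF x] by blast
  show "\<one>\<^bsub>quotient_monoid \<theta>\<^esub> \<otimes>\<^bsub>quotient_monoid \<theta>\<^esub> x = x"
    and "x \<otimes>\<^bsub>quotient_monoid \<theta>\<^esub> \<one>\<^bsub>quotient_monoid \<theta>\<^esub> = x"
    by (simp_all only: u m o append_Nil append_Nil2)
  assume y: "y \<in> carrier (quotient_monoid \<theta>)"
  obtain v where v: "y = \<theta> `` {v}" using rep[OF y] by blast
  show "x \<otimes>\<^bsub>quotient_monoid \<theta>\<^esub> y \<in> carrier (quotient_monoid \<theta>)" by (simp only: u v m c)
  assume z: "z \<in> carrier (quotient_monoid \<theta>)"
  obtain w where w: "z = \<theta> `` {w}" using rep[OF z] by blast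
  show "x \<otimes>\<^bsub>quotient_monoid \<theta>\<^esub> y \<otimes>\<^bsub>quotient_monoid \<theta>\<^esub> z =
      x \<otimes>\<^bsub>quotient_monoid \<theta>\<^esub> (y \<otimes>\<^bsub>quotient_monoid \<theta>\<^esub> z)"
    by (simp only: u v w m append_assoc)
qed

lemma syntactic_congruence_congruence: "word_congruence (syntactic_congruence L)"
proof -
  have "(u @ v, u' @ v') \<in> syntactic_congruence L"
    if "(u, u') \<in> syntactic_congruence L" "(v, v') \<in> syntactic_congruence L" for u u' v v'
    unfolding syntactic_congruence_def
  proof (clarify)
    fix x y
    have "x @ (u @ v) @ y \<in> L \<longleftrightarrow> x @ u @ (v @ y) \<in> L" by simp
    also have "\<dots> \<longleftrightarrow> x @ u' @ (v @ y) \<in> L"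
      using that(1) unfolding syntactic_congruence_def by blast
    also have "\<dots> \<longleftrightarrow> (x @ u') @ v @ y \<in> L" by simp
    also have "\<dots> \<longleftrightarrow> (x @ u') @ v' @ y \<in> L"
      using that(2) unfolding syntactic_congruence_def by blast
    finally show "x @ (u @ v) @ y \<in> L \<longleftrightarrow> x @ (u' @ v') @ y \<in> L" by simp
  qed
  moreover have "equiv UNIV (syntactic_congruence L)"
    by (auto intro!: equivI simp: syntactic_congruence_def refl_on_def sym_def trans_def)
  ultimately show ?thesis by (simp add: word_congruence_def)
qed

lemma syntactic_congruence_finite:
  assumes "rational L"
  shows "syntactic_congruence L \<in> finite_congruences"
proof -
  obtain Q :: "nat set" and i T \<delta> where Q: "finite Q" "i \<in> Q" "\<And>q a. q \<in> Q \<Longrightarrow> \<delta> q a \<in> Q"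
    and L: "L = {w. foldl \<delta> i w \<in> T}"
    using assms unfolding rational_def by blast
  have cl: "q \<in> Q \<Longrightarrow> foldl \<delta> q w \<in> Q" for q w
    by (induction w arbitrary: q) (auto simp: Q)
  define f where "f w = (\<lambda>q\<in>Q. foldl \<delta> q w)" for w
  define g where "g h = syntactic_congruence L `` {SOME w. f w = h}" for h
  have "f ` UNIV \<subseteq> Q \<rightarrow>\<^sub>E Q" using cl by (auto simp: f_def)
  then have fin: "finite (range f)" using Q(1) by (meson finite_PiE finite_subset)
  have *: "(u, v) \<in> syntactic_congruence L" if "f u = f v" for u v
  proof -
    have "foldl \<delta> q u = foldl \<delta> q v" if "q \<in> Q" for q
      using fun_cong[OF \<open>f u = f v\<close>, of q] that by (simp add: f_def)
    then show ?thesis using cl[OF Q(2)] by (simp add: syntactic_congruence_def L)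
  qed
  have e: "equiv UNIV (syntactic_congruence L)"
    using syntactic_congruence_congruence[of L] by (simp add: word_congruence_def)
  have "UNIV // syntactic_congruence L \<subseteq> g ` range f"
  proof
    fix C assume "C \<in> UNIV // syntactic_congruence L"
    then obtain w where C: "C = syntactic_congruence L `` {w}" by (auto elim: quotientE)
    have "f (SOME w'. f w' = f w) = f w" by (rule someI) simp
    then have "C = g (f w)" unfolding C g_def
      using equiv_class_eq[OF e *] by metis
    then show "C \<in> g ` range f" by blast
  qed
  then show ?thesis using fin syntactic_congruence_congruence
    by (auto simp: finite_congruences_def intro: finite_subset)
qed

lemma finite_congruences_congruence: "\<theta> \<in> finite_congruences \<Longrightarrow> word_congruence \<theta>"
  by (simp add: finite_congruences_def)

lemma profinite_class: "\<pi> \<in> profinite_carrier \<Longrightarrow> \<theta> \<in> finite_congruences \<Longrightarrow> \<pi> \<theta> \<in> UNIV // \<theta>"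
  by (auto simp: profinite_carrier_def PiE_iff)

lemma word_embedding_in: "word_embedding w \<in> profinite_carrier"
  by (auto simp: word_embedding_def profinite_carrier_def intro: quotientI)

lemma free_profinite_mult_closed:
  assumes "\<pi> \<in> profinite_carrier" "\<rho> \<in> profinite_carrier"
  shows "\<pi> \<otimes>\<^bsub>free_profinite_monoid\<^esub> \<rho> \<in> profinite_carrier"
proof -
  have "\<pi> \<theta> \<otimes>\<^bsub>quotient_monoid \<theta>\<^esub> \<rho> \<theta> \<in> UNIV // \<theta>" if "\<theta> \<in> finite_congruences" for \<theta>
    using monoid.m_closed[OF quotient_monoid_monoid[OF finite_congruences_congruence[OF that]]]
      profinite_class[OF assms(1) that] profinite_class[OF assms(2) that]
    by (simp add: quotient_monoid_def)
  moreover have "\<pi> \<theta> \<otimes>\<^bsub>quotient_monoid \<theta>\<^esub> \<rho> \<theta> \<subseteq> \<pi> \<theta>' \<otimes>\<^bsub>quotient_monoid \<theta>'\<^esub> \<rho> \<theta>'"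
    if "\<theta> \<in> finite_congruences" "\<theta>' \<in> finite_congruences" "\<theta> \<subseteq> \<theta>'" for \<theta> \<theta>'
  proof -
    have "\<pi> \<theta> \<subseteq> \<pi> \<theta>'" "\<rho> \<theta> \<subseteq> \<rho> \<theta>'"
      using assms that by (auto simp: profinite_carrier_def)
    then show ?thesis using that(3) by (auto simp: quotient_monoid_def lang_conc_def Image_def) blast
  qed
  ultimately show ?thesis
    by (auto simp: profinite_carrier_def free_profinite_monoid_def PiE_iff)
qed

lemma free_profinite_monoid_monoid: "monoid free_profinite_monoid"
proof (rule monoidI)
  show "\<one>\<^bsub>free_profinite_monoid\<^esub> \<in> carrier free_profinite_monoid"
    using word_embedding_in[of "[]"]
    by (simp add: free_profinite_monoid_def word_embedding_def quotient_monoid_def)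
next
  fix x y :: "'a list rel \<Rightarrow> 'a list set"
  assume "x \<in> carrier free_profinite_monoid" "y \<in> carrier free_profinite_monoid"
  then show "x \<otimes>\<^bsub>free_profinite_monoid\<^esub> y \<in> carrier free_profinite_monoid"
    using free_profinite_mult_closed by (auto simp: free_profinite_monoid_def)
next
  fix x y z :: "'a list rel \<Rightarrow> 'a list set"
  assume "x \<in> carrier free_profinite_monoid" "y \<in> carrier free_profinite_monoid"
    "z \<in> carrier free_profinite_monoid"
  then have c: "x \<theta> \<in> carrier (quotient_monoid \<theta>)" "y \<theta> \<in> carrier (quotient_monoid \<theta>)"
    "z \<theta> \<in> carrier (quotient_monoid \<theta>)" if "\<theta> \<in> finite_congruences" for \<theta>
    using profinite_class that by (auto simp: free_profinite_monoid_def quotient_monoid_def)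
  show "x \<otimes>\<^bsub>free_profinite_monoid\<^esub> y \<otimes>\<^bsub>free_profinite_monoid\<^esub> z =
     x \<otimes>\<^bsub>free_profinite_monoid\<^esub> (y \<otimes>\<^bsub>free_profinite_monoid\<^esub> z)"
    unfolding free_profinite_monoid_def monoid.simps
    by (rule restrict_ext)
      (simp add: c monoid.m_assoc[OF quotient_monoid_monoid[OF finite_congruences_congruence]])
next
  fix x :: "'a list rel \<Rightarrow> 'a list set"
  assume x: "x \<in> carrier free_profinite_monoid"
  then have c: "x \<theta> \<in> carrier (quotient_monoid \<theta>)" if "\<theta> \<in> finite_congruences" for \<theta>
    using profinite_class that by (auto simp: free_profinite_monoid_def quotient_monoid_def)
  have x': "x \<in> extensional finite_congruences"
    using x by (auto simp: free_profinite_monoid_def profinite_carrier_def PiE_iff)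
  show "\<one>\<^bsub>free_profinite_monoid\<^esub> \<otimes>\<^bsub>free_profinite_monoid\<^esub> x = x"
    using c x' monoid.l_one[OF quotient_monoid_monoid[OF finite_congruences_congruence]]
    by (intro extensionalityI[of _ finite_congruences]) (auto simp: free_profinite_monoid_def)
  show "x \<otimes>\<^bsub>free_profinite_monoid\<^esub> \<one>\<^bsub>free_profinite_monoid\<^esub> = x"
    using c x' monoid.r_one[OF quotient_monoid_monoid[OF finite_congruences_congruence]]
    by (intro extensionalityI[of _ finite_congruences]) (auto simp: free_profinite_monoid_def)
qed

lemma word_embedding_append:
  "word_embedding (u @ v) = word_embedding u \<otimes>\<^bsub>free_profinite_monoid\<^esub> word_embedding v"
  unfolding word_embedding_def free_profinite_monoid_def quotient_monoid_def monoid.simps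
  by (rule restrict_ext) (simp add: class_mult finite_congruences_congruence)

lemma topspace_profinite: "topspace profinite_topology = profinite_carrier"
  by (auto simp: profinite_topology_def profinite_carrier_def)

lemma finite_congruences_Int:
  assumes "\<theta> \<in> finite_congruences" "\<theta>' \<in> finite_congruences"
  shows "\<theta> \<inter> \<theta>' \<in> finite_congruences"
proof -
  have e: "equiv UNIV \<theta>" "equiv UNIV \<theta>'"
    using assms by (auto simp: finite_congruences_def word_congruence_def)
  have "UNIV // (\<theta> \<inter> \<theta>') \<subseteq> (\<lambda>(C, D). C \<inter> D) ` ((UNIV // \<theta>) \<times> (UNIV // \<theta>'))"
  proof
    fix C assume "C \<in> UNIV // (\<theta> \<inter> \<theta>')"
    then obtain w where "C = \<theta> `` {w} \<inter> \<theta>' `` {w}" by (auto elim!: quotientE)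
    moreover have "\<theta> `` {w} \<in> UNIV // \<theta>" "\<theta>' `` {w} \<in> UNIV // \<theta>'" by (auto intro: quotientI)
    ultimately show "C \<in> (\<lambda>(C, D). C \<inter> D) ` ((UNIV // \<theta>) \<times> (UNIV // \<theta>'))"
      by (metis (no_types, lifting) SigmaI case_prod_conv image_eqI)
  qed
  then have "finite (UNIV // (\<theta> \<inter> \<theta>'))"
    using assms by (auto simp: finite_congruences_def intro: finite_subset)
  moreover have "equiv UNIV (\<theta> \<inter> \<theta>')"
  proof (rule equivI)
    show "refl_on UNIV (\<theta> \<inter> \<theta>')" using e by (auto simp: equiv_def refl_on_def)
    show "sym (\<theta> \<inter> \<theta>')" using e by (auto simp: equiv_def intro: sym_Int)
    show "trans (\<theta> \<inter> \<theta>')" using e by (auto simp: equiv_def intro: trans_Int)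
  qed auto
  ultimately show ?thesis
    using assms by (simp add: finite_congruences_def word_congruence_def)
qed

lemma finite_congruences_UNIV: "UNIV \<in> finite_congruences"
proof -
  have "UNIV // (UNIV :: 'a list rel) \<subseteq> {UNIV}" by (auto elim!: quotientE)
  then show ?thesis
    by (auto simp: finite_congruences_def word_congruence_def equiv_def refl_on_def sym_def trans_def
        intro: finite_subset)
qed

lemma finite_congruences_Inter:
  "finite K \<Longrightarrow> K \<subseteq> finite_congruences \<Longrightarrow> \<Inter>K \<in> finite_congruences"
  by (induction rule: finite_induct) (auto simp: finite_congruences_UNIV finite_congruences_Int)

lemma word_embedding_dense: "profinite_closure UNIV = carrier free_profinite_monoid"
proof -
  have "\<exists>w. word_embedding w \<in> T" if \<pi>: "\<pi> \<in> profinite_carrier" "\<pi> \<in> T" 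
    and T: "openin profinite_topology T" for \<pi> T
  proof -
    obtain S where S: "openin (product_topology (\<lambda>\<theta>. discrete_topology (UNIV // \<theta>)) finite_congruences) S"
      and TS: "T = S \<inter> profinite_carrier"
      using T by (auto simp: profinite_topology_def openin_subtopology)
    obtain U where U: "finite {\<theta> \<in> finite_congruences. U \<theta> \<noteq> UNIV // \<theta>}"
      "\<pi> \<in> Pi\<^sub>E finite_congruences U" "Pi\<^sub>E finite_congruences U \<subseteq> S"
      using S \<pi>(2) TS unfolding openin_product_topology_alt by fastforce
    define \<theta>0 where "\<theta>0 = \<Inter>{\<theta> \<in> finite_congruences. U \<theta> \<noteq> UNIV // \<theta>}"
    have \<theta>0: "\<theta>0 \<in> finite_congruences"
      unfolding \<theta>0_def using U(1) by (intro finite_congruences_Inter) auto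
    obtain w where w: "\<pi> \<theta>0 = \<theta>0 `` {w}"
      using profinite_class[OF \<pi>(1) \<theta>0] by (auto elim: quotientE)
    have "\<theta> `` {w} \<in> U \<theta>" if \<theta>: "\<theta> \<in> finite_congruences" for \<theta>
    proof (cases "U \<theta> = UNIV // \<theta>")
      case True
      then show ?thesis by (simp add: quotientI)
    next
      case False
      then have "\<theta>0 \<subseteq> \<theta>" using \<theta> by (auto simp: \<theta>0_def)
      then have "\<pi> \<theta>0 \<subseteq> \<pi> \<theta>" using \<pi>(1) \<theta>0 \<theta> by (auto simp: profinite_carrier_def)
      moreover have "equiv UNIV \<theta>0" and e: "equiv UNIV \<theta>"
        using \<theta>0 \<theta> by (simp_all add: finite_congruences_def word_congruence_def)
      then have "w \<in> \<pi> \<theta>0" unfolding w by (intro equiv_class_self[of UNIV] UNIV_I)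
      ultimately have "w \<in> \<pi> \<theta>" by blast
      moreover obtain v where v: "\<pi> \<theta> = \<theta> `` {v}"
        using profinite_class[OF \<pi>(1) \<theta>] by (auto elim: quotientE)
      ultimately have "(v, w) \<in> \<theta>" by simp
      then have "\<pi> \<theta> = \<theta> `` {w}" unfolding v by (rule equiv_class_eq[OF e])
      then show ?thesis using U(2) \<theta> by (auto simp: PiE_iff)
    qed
    then have "word_embedding w \<in> S" using U(3) by (auto simp: word_embedding_def)
    then show ?thesis using TS word_embedding_in by blast
  qed
  then have "\<pi> \<in> profinite_closure UNIV" if "\<pi> \<in> profinite_carrier" for \<pi>
    using that unfolding profinite_closure_def in_closure_of topspace_profinite by blast
  moreover have "profinite_closure UNIV \<subseteq> profinite_carrier"
    unfolding profinite_closure_def topspace_profinite[symmetric] by (rule closure_of_subset_topspace)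
  ultimately show ?thesis
    unfolding free_profinite_monoid_def partial_object.simps by blast
qed

text \<open>Existence and uniqueness of the continuous extension of the syntactic homomorphism.\<close>

lemma syntactic_hat_extension:
  assumes "rational L"
  shows "syntactic_hat L \<in> hom free_profinite_monoid (syntactic_monoid L)"
    and "continuous_map profinite_topology (discrete_topology (carrier (syntactic_monoid L)))
           (syntactic_hat L)"
    and "syntactic_hat L (word_embedding w) = syntactic_hom L w"
proof -
  note fin = syntactic_congruence_finite[OF assms]
  show "syntactic_hat L \<in> hom free_profinite_monoid (syntactic_monoid L)"
    using profinite_class[OF _ fin] fin
    by (auto simp: hom_def syntactic_hat_def free_profinite_monoid_def syntactic_monoid_def
        quotient_monoid_def)
  show "continuous_map profinite_topology (discrete_topology (carrier (syntactic_monoid L)))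
           (syntactic_hat L)"
    using continuous_map_product_projection[OF fin, of "\<lambda>\<theta>. discrete_topology (UNIV // \<theta>)"]
    by (auto simp: profinite_topology_def syntactic_hat_def[abs_def] syntactic_monoid_def
        quotient_monoid_def intro: continuous_map_from_subtopology)
  show "syntactic_hat L (word_embedding w) = syntactic_hom L w"
    using fin by (simp add: syntactic_hat_def word_embedding_def syntactic_hom_def)
qed

lemma syntactic_hat_unique:
  assumes "rational L"
    and "continuous_map profinite_topology (discrete_topology (carrier (syntactic_monoid L))) h"
    and hw: "\<And>w. h (word_embedding w) = syntactic_hom L w"
    and x: "x \<in> carrier free_profinite_monoid"
  shows "h x = syntactic_hat L x"
proof (rule forall_in_closure_of_eq[where f = h and g = "syntactic_hat L" and x = x])
  show "x \<in> profinite_topology closure_of (range word_embedding)"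
    using x unfolding profinite_closure_def[symmetric] word_embedding_dense .
  show "Hausdorff_space (discrete_topology (carrier (syntactic_monoid L)))" by simp
  show "continuous_map profinite_topology (discrete_topology (carrier (syntactic_monoid L))) h"
    by fact
  show "continuous_map profinite_topology (discrete_topology (carrier (syntactic_monoid L)))
           (syntactic_hat L)"
    by (rule syntactic_hat_extension(2)[OF assms(1)])
  fix y :: "'a list rel \<Rightarrow> 'a list set"
  assume "y \<in> range word_embedding"
  then show "h y = syntactic_hat L y"
    using hw syntactic_hat_extension(3)[OF assms(1)] by auto
qed

end

theory Submission
  imports Defs
begin

text \<open>Call a word \<open>w\<close> full if it has \<open>d(Z)\<close> parses; \<open>d\<^sub>F(X) = d(Z)\<close> says that \<open>F\<close> contains a full word.
  If \<open>w\<close> is full, every word \<open>y\<close> permutes the parses of \<open>w\<close> by matching the parses of the two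
  outer occurrences of \<open>w\<close> in \<open>w y w\<close>, and for bifix codes this permutation determines the class of
  \<open>w y w\<close> in \<open>M(Z\<^sup>*)\<close>. The same holds for \<open>X\<close> with partial injections, which are contained in the
  permutations for \<open>Z\<close> and are equal to them on words acting invertibly. Given an idempotent \<open>e\<close> of
  \<open>J(F)\<close> and a full \<open>w \<in> F\<close> close to \<open>e\<close>, the classes \<open>\<epsilon>\<^sub>X\<close> and \<open>\<epsilon>\<^sub>Z\<close> of \<open>w\<close> are the images of \<open>e\<close>, and
  comparing permutations gives an injective homomorphism from the maximal subgroup at \<open>\<epsilon>\<^sub>X\<close> to the
  one at \<open>\<epsilon>\<^sub>Z\<close> which commutes with the two maps from \<open>H\<^sub>e\<close>. It turns surjectivity of one map into
  surjectivity of the other as soon as the two finite groups have the same order.\<close>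

section \<open>Parses with respect to bifix codes\<close>

text \<open>The obstacle is that a word full for Z need not be full for X: words outside F may have
  more parses for X, and an action may be undefined at some parses. What survives for X is that
  \<open>w\<close> is never strictly inside a code word; this gives composition of actions, but not
  bijectivity. Recurrence supplies the missing point: some \<open>w v w\<close> lies in F, there the
  two actions of \<open>v\<close> agree, and this one permutation forces the idempotent
  \<open>w\<close> to act as the identity for X too.

  Condition (1) does not provide a full word in F. It has to be extracted from the surjection onto a
  maximal subgroup of the minimum ideal: that group is transitive on the parses of a full word of
  A^*, and its elements can be read as prefixes of one word of F.

  J(F) is introduced by a definite description, so its existence and uniqueness must be derived from
  compactness before a statement about it has content.\<close>

lemma star_Nil: "[] \<in> lang_star Y"
  unfolding lang_star_def by (rule image_eqI[of _ _ "[]"]) auto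

lemma star_base: "y \<in> Y \<Longrightarrow> y \<in> lang_star Y"
  unfolding lang_star_def by (rule image_eqI[of _ _ "[y]"]) auto

lemma star_append: "x \<in> lang_star Y \<Longrightarrow> y \<in> lang_star Y \<Longrightarrow> x @ y \<in> lang_star Y"
  unfolding lang_star_def
proof (elim imageE)
  fix xs ys assume "x = concat xs" "y = concat ys" "xs \<in> lists Y" "ys \<in> lists Y"
  then have "x @ y = concat (xs @ ys)" "xs @ ys \<in> lists Y" by auto
  then show "x @ y \<in> concat ` lists Y" by blast
qed

lemma star_mono: "X \<subseteq> Y \<Longrightarrow> lang_star X \<subseteq> lang_star Y"
  unfolding lang_star_def by (intro image_mono lists_mono)

section \<open>Unitarity of the submonoid generated by a bifix code\<close>

definition prefix_free :: "'a list set \<Rightarrow> bool" where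
  "prefix_free Y \<longleftrightarrow> (\<forall>x t. x \<in> Y \<longrightarrow> x @ t \<in> Y \<longrightarrow> t = [])"

definition suffix_free :: "'a list set \<Rightarrow> bool" where
  "suffix_free Y \<longleftrightarrow> (\<forall>x t. x \<in> Y \<longrightarrow> t @ x \<in> Y \<longrightarrow> t = [])"

text \<open>In contrast to \<^const>\<open>bifix_code\<close> the empty set is allowed, so that the property passes to
  subsets.\<close>

definition bifix_free :: "'a list set \<Rightarrow> bool" where
  "bifix_free Y \<longleftrightarrow> [] \<notin> Y \<and> prefix_free Y \<and> suffix_free Y"

lemma bifix_code_free: "bifix_code Z \<Longrightarrow> bifix_free Z"
  unfolding bifix_code_def prefix_code_def suffix_code_def bifix_free_def prefix_free_def
    suffix_free_def lang_conc_def
  by blast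

lemma bifix_free_subset: "bifix_free Z \<Longrightarrow> X \<subseteq> Z \<Longrightarrow> bifix_free X"
  unfolding bifix_free_def prefix_free_def suffix_free_def by blast

lemma prefix_free_eq:
  assumes "prefix_free Y" "a \<in> Y" "b \<in> Y" "a @ u = b @ v"
  shows "a = b"
proof -
  obtain t where "a = b @ t \<or> a @ t = b" using assms(4) unfolding append_eq_append_conv2 by blast
  then show ?thesis using assms(1-3) unfolding prefix_free_def by (elim disjE) auto
qed

lemma suffix_free_eq:
  assumes "suffix_free Y" "a \<in> Y" "b \<in> Y" "u @ a = v @ b"
  shows "a = b"
proof -
  obtain t where "t @ a = b \<or> a = t @ b" using assms(4) unfolding append_eq_append_conv2 by blast
  then show ?thesis using assms(1-3) unfolding suffix_free_def by (elim disjE) auto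
qed

text \<open>The factorizations of \<open>x\<close> and \<open>x t\<close> begin with comparable code
  words, which are equal because Y is prefix-free; cancelling block by block leaves
  \<open>t\<close>. \<open>left_unitary\<close> is the mirror image.\<close>

lemma right_unitary:
  assumes "bifix_free Y" "x \<in> lang_star Y" "x @ t \<in> lang_star Y"
  shows "t \<in> lang_star Y"
proof -
  obtain xs where xs: "xs \<in> lists Y" "x = concat xs" using assms(2) by (auto simp: lang_star_def)
  have "t \<in> lang_star Y" if "xs \<in> lists Y" "concat xs @ t \<in> lang_star Y" for xs
    using that
  proof (induction xs)
    case Nil
    then show ?case by simp
  next
    case (Cons a xs)
    from Cons.prems obtain ys where ys: "ys \<in> lists Y" "a @ concat xs @ t = concat ys"
      by (auto simp: lang_star_def)
    have a: "a \<in> Y" "a \<noteq> []" using Cons assms(1) by (auto simp: bifix_free_def)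
    obtain b ys' where b: "ys = b # ys'" using ys a by (cases ys) auto
    have "b \<in> Y" using ys b by auto
    have e: "a @ (concat xs @ t) = b @ concat ys'" using ys b by simp
    have "a = b" using prefix_free_eq[OF _ a(1) \<open>b \<in> Y\<close> e] assms(1) by (simp add: bifix_free_def)
    then have "concat xs @ t = concat ys'" using e by simp
    then have "concat xs @ t \<in> lang_star Y" using ys b by (auto simp: lang_star_def)
    then show ?case using Cons.IH by blast
  qed
  then show ?thesis using assms(3) xs by blast
qed

lemma left_unitary:
  assumes "bifix_free Y" "x \<in> lang_star Y" "t @ x \<in> lang_star Y"
  shows "t \<in> lang_star Y"
proof -
  obtain xs where xs: "xs \<in> lists Y" "x = concat xs" using assms(2) by (auto simp: lang_star_def)
  have "t \<in> lang_star Y" if "xs \<in> lists Y" "t @ concat xs \<in> lang_star Y" for xs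
    using that
  proof (induction xs rule: rev_induct)
    case Nil
    then show ?case by simp
  next
    case (snoc a xs)
    from snoc.prems obtain ys where ys: "ys \<in> lists Y" "t @ concat xs @ a = concat ys"
      by (auto simp: lang_star_def)
    have a: "a \<in> Y" "a \<noteq> []" using snoc.prems assms(1) by (auto simp: bifix_free_def)
    obtain b ys' where b: "ys = ys' @ [b]" using ys a by (cases ys rule: rev_cases) auto
    have "b \<in> Y" using ys b by auto
    have e: "(t @ concat xs) @ a = concat ys' @ b" using ys b by simp
    have "a = b" using suffix_free_eq[OF _ a(1) \<open>b \<in> Y\<close> e] assms(1) by (simp add: bifix_free_def)
    then have "t @ concat xs = concat ys'" using e by simp
    then have "t @ concat xs \<in> lang_star Y" using ys b by (auto simp: lang_star_def)
    then show ?case using snoc.IH snoc.prems(1) by simp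
  qed
  then show ?thesis using assms(3) xs by blast
qed

text \<open>A parse is determined by its first component, see \<open>num_parses_eq\<close>. With
  this naming, parses of \<open>w\<close> become parses of every right extension of \<open>w\<close>
  by mere inclusion.\<close>

definition starts :: "'a list set \<Rightarrow> 'a list \<Rightarrow> 'a list set" where
  "starts Y w = {v. prefix v w \<and> v \<notin> UNIV @@ Y}"

lemma starts_finite: "finite (starts Y w)"
  by (rule finite_subset[of _ "set (prefixes w)"]) (auto simp: starts_def)

lemma starts_mono: "starts Y u \<subseteq> starts Y (u @ v)"
  by (auto simp: starts_def)

lemma Nil_in_starts: "bifix_free Y \<Longrightarrow> [] \<in> starts Y w"
  by (auto simp: starts_def lang_conc_def bifix_free_def)

lemma last_block:
  assumes "x \<in> lang_star Y" "x \<noteq> []" "[] \<notin> Y"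
  obtains x' y where "x = x' @ y" "x' \<in> lang_star Y" "y \<in> Y"
proof -
  obtain xs where xs: "xs \<in> lists Y" "x = concat xs" using assms by (auto simp: lang_star_def)
  then obtain ys y where "xs = ys @ [y]" using assms by (cases xs rule: rev_cases) auto
  then show ?thesis using xs that[of "concat ys" y] by (auto simp: lang_star_def)
qed

lemma first_block:
  assumes "x \<in> lang_star Y" "x \<noteq> []" "[] \<notin> Y"
  obtains x' y where "x = y @ x'" "x' \<in> lang_star Y" "y \<in> Y"
proof -
  obtain xs where xs: "xs \<in> lists Y" "x = concat xs" using assms by (auto simp: lang_star_def)
  then obtain ys y where "xs = y # ys" using assms by (cases xs) auto
  then show ?thesis using xs that[of y "concat ys"] by (auto simp: lang_star_def)
qed

lemma start_decomp:
  assumes "[] \<notin> Y"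
  shows "\<exists>g x. v = g @ x \<and> x \<in> lang_star Y \<and> g \<notin> UNIV @@ Y"
proof (induction "length v" arbitrary: v rule: less_induct)
  case less
  show ?case
  proof (cases "v \<in> UNIV @@ Y")
    case True
    then obtain v' y where v: "v = v' @ y" "y \<in> Y" by (auto simp: lang_conc_def)
    then have "length v' < length v" using assms by auto
    then obtain g x where "v' = g @ x" "x \<in> lang_star Y" "g \<notin> UNIV @@ Y" using less by blast
    then show ?thesis using v(1) star_append[OF _ star_base[OF v(2)], of x] by (metis append_assoc)
  next
    case False
    then show ?thesis by (intro exI[of _ v] exI[of _ "[]"]) (auto simp: star_Nil)
  qed
qed

lemma end_decomp:
  assumes "[] \<notin> Y"
  shows "\<exists>g x. v = x @ g \<and> x \<in> lang_star Y \<and> g \<notin> Y @@ UNIV"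
proof (induction "length v" arbitrary: v rule: less_induct)
  case less
  show ?case
  proof (cases "v \<in> Y @@ UNIV")
    case True
    then obtain v' y where v: "v = y @ v'" "y \<in> Y" by (auto simp: lang_conc_def)
    then have "length v' < length v" using assms by auto
    then obtain g x where "v' = x @ g" "x \<in> lang_star Y" "g \<notin> Y @@ UNIV" using less by blast
    then show ?thesis using v(1) star_append[OF star_base[OF v(2)], of x] by (metis append_assoc)
  next
    case False
    then show ?thesis by (intro exI[of _ v] exI[of _ "[]"]) (auto simp: star_Nil)
  qed
qed

lemma not_start:
  assumes "x \<in> lang_star Y" "x \<noteq> []" "[] \<notin> Y"
  shows "g @ x \<in> UNIV @@ Y"
proof -
  obtain x' y where "x = x' @ y" "x' \<in> lang_star Y" "y \<in> Y" using last_block[OF assms] .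
  then have "g @ x = (g @ x') @ y" "y \<in> Y" by auto
  then show ?thesis unfolding lang_conc_def by blast
qed

lemma not_end:
  assumes "x \<in> lang_star Y" "x \<noteq> []" "[] \<notin> Y"
  shows "x @ g \<in> Y @@ UNIV"
proof -
  obtain x' y where "x = y @ x'" "x' \<in> lang_star Y" "y \<in> Y" using first_block[OF assms] .
  then have "x @ g = y @ (x' @ g)" "y \<in> Y" by auto
  then show ?thesis unfolding lang_conc_def by blast
qed

text \<open>The first component determines the other two: if \<open>x\<close> could be prolonged
  within the star by a nonempty \<open>t\<close>, the remainder \<open>u\<close> would begin with a
  code word. Every start occurs, by stripping code words from the front of what follows it.\<close>

lemma num_parses_eq:
  assumes "bifix_free Y"
  shows "num_parses Y w = card (starts Y w)"
proof -
  have ne: "[] \<notin> Y" using assms by (simp add: bifix_free_def)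
  have "inj_on fst (parses Y w)"
  proof (rule inj_onI)
    fix p p' assume p: "p \<in> parses Y w" "p' \<in> parses Y w" "fst p = fst p'"
    obtain v x u where 1: "p = (v, x, u)" by (cases p)
    obtain v' x' u' where 2: "p' = (v', x', u')" by (cases p')
    have *: "t = []" if "x1 \<in> lang_star Y" "x1 @ t \<in> lang_star Y" "t @ u1 \<notin> Y @@ UNIV" for x1 t u1
      using right_unitary[OF assms that(1,2)] not_end[of t Y u1] ne that by blast
    have "x @ u = x' @ u'" "v = v'" using p 1 2 by (auto simp: parses_def)
    then obtain t where t: "x = x' @ t \<and> t @ u = u' \<or> x @ t = x' \<and> u = t @ u'"
      by (auto simp: append_eq_append_conv2)
    moreover have "x \<in> lang_star Y" "x' \<in> lang_star Y" "u \<notin> Y @@ UNIV" "u' \<notin> Y @@ UNIV"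
      using p 1 2 by (auto simp: parses_def)
    ultimately have "t = []" using *[of x t u'] *[of x' t u] by auto
    then have "x = x' \<and> u = u'" using t by auto
    then show "p = p'" using 1 2 \<open>v = v'\<close> by simp
  qed
  moreover have "fst ` parses Y w = starts Y w"
  proof (intro equalityI subsetI)
    fix v assume "v \<in> fst ` parses Y w"
    then show "v \<in> starts Y w" by (auto simp: parses_def starts_def)
  next
    fix v assume v: "v \<in> starts Y w"
    then obtain r where r: "w = v @ r" by (auto simp: starts_def prefix_def)
    obtain g x where "r = x @ g" "x \<in> lang_star Y" "g \<notin> Y @@ UNIV" using end_decomp[OF ne] by blast
    then have "(v, x, g) \<in> parses Y w" using v r by (auto simp: parses_def starts_def)
    then show "v \<in> fst ` parses Y w" by force
  qed
  ultimately show ?thesis unfolding num_parses_def by (metis card_image)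
qed

lemma starts_unique:
  assumes "bifix_free Y" "r \<in> starts Y w" "r' \<in> starts Y w'"
    and "v @ r \<in> lang_star Y" "v @ r' \<in> lang_star Y" "prefix r r'"
  shows "r = r'"
proof -
  obtain t where t: "r' = r @ t" using assms(6) by (auto simp: prefix_def)
  then have "t \<in> lang_star Y" using right_unitary[OF assms(1,4), of t] assms(5) by simp
  moreover have "[] \<notin> Y" "r @ t \<notin> UNIV @@ Y" using assms(1,3) t by (auto simp: bifix_free_def starts_def)
  ultimately have "t = []" using not_start by blast
  then show ?thesis using t by simp
qed

text \<open>Stripping code words from the end of \<open>u r\<close> moves a start \<open>r\<close>
  of \<open>w\<close> back to a start of \<open>u w\<close>. Two starts with the same image differ
  by an element of the star, in which a start cannot end unless it is empty. Hence the number of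
  parses does not drop under extension on the left.\<close>

lemma starts_push:
  assumes "bifix_free Y"
  obtains f where "inj_on f (starts Y w)" "f ` starts Y w \<subseteq> starts Y (u @ w)"
    "\<And>r. r \<in> starts Y w \<Longrightarrow> \<exists>x. u @ r = f r @ x \<and> x \<in> lang_star Y"
proof -
  have ne: "[] \<notin> Y" using assms by (simp add: bifix_free_def)
  have "\<forall>r. \<exists>g. \<exists>x. u @ r = g @ x \<and> x \<in> lang_star Y \<and> g \<notin> UNIV @@ Y"
    using start_decomp[OF ne] by blast
  then obtain f where f: "\<And>r. \<exists>x. u @ r = f r @ x \<and> x \<in> lang_star Y \<and> f r \<notin> UNIV @@ Y"
    by metis
  have *: "r = r'" if r: "r \<in> starts Y w" "r' \<in> starts Y w" "f r = f r'" "prefix r r'" for r r'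
  proof -
    obtain x where x: "u @ r = f r @ x" "x \<in> lang_star Y" using f by blast
    obtain x' where x': "u @ r' = f r @ x'" "x' \<in> lang_star Y" using f r(3) by metis
    obtain t where t: "r' = r @ t" using r(4) by (auto simp: prefix_def)
    then have "u @ r' = f r @ x @ t" using x by (metis append_assoc)
    then have "x' = x @ t" using x' by simp
    then have "t \<in> lang_star Y" using right_unitary[OF assms x(2)] x' by simp
    moreover have "r @ t \<notin> UNIV @@ Y" using r(2) t by (auto simp: starts_def)
    ultimately have "t = []" using not_start ne by blast
    then show ?thesis using t by simp
  qed
  have "inj_on f (starts Y w)"
  proof (rule inj_onI)
    fix r r' assume r: "r \<in> starts Y w" "r' \<in> starts Y w" "f r = f r'"
    then have "prefix r r' \<or> prefix r' r" unfolding starts_def using prefix_same_cases by blast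
    then show "r = r'" using *[OF r] *[OF r(2,1) r(3)[symmetric]] by auto
  qed
  moreover have "f r \<in> starts Y (u @ w)" if "r \<in> starts Y w" for r
  proof -
    obtain x q where "u @ r = f r @ x" "w = r @ q" "f r \<notin> UNIV @@ Y"
      using f[of r] \<open>r \<in> starts Y w\<close> by (auto simp: starts_def prefix_def)
    then have "u @ w = f r @ (x @ q)" by (metis append_assoc)
    then show ?thesis using \<open>f r \<notin> UNIV @@ Y\<close> by (auto simp: starts_def)
  qed
  ultimately show ?thesis using f that[of f] by (metis image_subsetI)
qed

section \<open>Words with the maximal number of parses\<close>

definition full :: "'a list set \<Rightarrow> 'a list \<Rightarrow> bool" where
  "full Y w \<longleftrightarrow> (\<forall>v. card (starts Y v) \<le> card (starts Y w))"

lemma full_append: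
  assumes "bifix_free Y" "full Y w"
  shows "starts Y (w @ v) = starts Y w"
  using assms(2) card_seteq[OF starts_finite starts_mono, of Y w v] by (simp add: full_def)

text \<open>The number of parses drops under extension on neither side. This allows a full word to
  be enlarged until it approximates an idempotent.\<close>

lemma full_factor:
  assumes "bifix_free Y" "full Y w"
  shows "full Y (u @ w @ v)"
proof -
  obtain f where f: "inj_on f (starts Y (w @ v))" "f ` starts Y (w @ v) \<subseteq> starts Y (u @ w @ v)"
    using starts_push[OF assms(1)] by metis
  have "card (starts Y (w @ v)) \<le> card (starts Y (u @ w @ v))"
    using card_inj_on_le[OF f starts_finite] .
  then have "card (starts Y w) \<le> card (starts Y (u @ w @ v))"
    using full_append[OF assms] by simp
  then show ?thesis using assms(2) le_trans unfolding full_def by blast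
qed

text \<open>A parse of \<open>u w v \<in> Y\<close> that cuts \<open>w\<close> differs from the trivial one.\<close>

lemma full_not_internal:
  assumes "bifix_free Y" "full Y w" "u \<noteq> []" "v \<noteq> []"
  shows "u @ w @ v \<notin> Y"
proof
  assume z: "u @ w @ v \<in> Y"
  have ne: "[] \<notin> Y" using assms by (simp add: bifix_free_def)
  obtain f where f: "inj_on f (starts Y w)" "f ` starts Y w \<subseteq> starts Y (u @ w)"
    "\<And>r. r \<in> starts Y w \<Longrightarrow> \<exists>x. u @ r = f r @ x \<and> x \<in> lang_star Y"
    using starts_push[OF assms(1)] by metis
  have "card (starts Y (u @ w)) \<le> card (f ` starts Y w)"
    using assms(2) card_image[OF f(1)] by (simp add: full_def)
  \<comment> \<open>By maximality \<open>f\<close> is onto, so the trivial start \<open>[]\<close>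
    of \<open>u w\<close> is reached from some start \<open>r\<close> of \<open>w\<close>. Thus
    \<open>u r\<close> is a product of code words, the first of which is a proper prefix of
    \<open>u w v\<close>.\<close>
  then have "f ` starts Y w = starts Y (u @ w)"
    by (rule card_seteq[OF starts_finite f(2)])
  then obtain r where r: "r \<in> starts Y w" "f r = []"
    using Nil_in_starts[OF assms(1), of "u @ w"] by (metis imageE)
  then have "u @ r \<in> lang_star Y" using f(3) by fastforce
  then obtain x' y where y: "u @ r = y @ x'" "y \<in> Y"
    using first_block[OF _ _ ne] assms(3) by (metis append_is_Nil_conv)
  obtain q where "w = r @ q" using r(1) by (auto simp: starts_def prefix_def)
  then have e: "u @ w @ v = y @ (x' @ q @ v)" using y(1) by (metis append_assoc)
  have "prefix_free Y" using assms(1) by (simp add: bifix_free_def)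
  then have "x' @ q @ v = []" using z y(2) unfolding e prefix_free_def by blast
  then show False using assms(4) by simp
qed

text \<open>Since no code word contains \<open>w\<close> strictly inside, some cut of the
  factorization falls into \<open>w\<close> or onto one of its ends.\<close>

lemma star_cut:
  assumes "\<And>u v. u \<noteq> [] \<Longrightarrow> v \<noteq> [] \<Longrightarrow> u @ w @ v \<notin> Y" "\<alpha> @ w @ \<beta> \<in> lang_star Y"
  shows "\<exists>p q. w = p @ q \<and> \<alpha> @ p \<in> lang_star Y \<and> q @ \<beta> \<in> lang_star Y"
proof -
  have "\<exists>p q. w = p @ q \<and> \<alpha> @ p \<in> lang_star Y \<and> q @ \<beta> \<in> lang_star Y"
    if "xs \<in> lists Y" "concat xs = \<alpha> @ w @ \<beta>" for xs
    using that
  proof (induction xs arbitrary: \<alpha>)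
    case Nil
    then show ?case by (auto simp: star_Nil)
  next
    case (Cons x xs)
    have x: "x \<in> Y" "concat xs \<in> lang_star Y" using Cons by (auto simp: lang_star_def)
    have e: "x @ concat xs = \<alpha> @ (w @ \<beta>)" using Cons.prems by simp
    show ?case
    \<comment> \<open>Separated because the hypothesis excludes only occurrences of \<open>w\<close>
      with nonempty words on both sides; here the cut is at the left end of
      \<open>w\<close>.\<close>
    proof (cases "\<alpha> = []")
      case True
      then have "w @ \<beta> \<in> lang_star Y" using e star_append[OF star_base[OF x(1)] x(2)] by simp
      then show ?thesis using True star_Nil by (intro exI[of _ "[]"] exI[of _ w]) auto
    next
      case False
      obtain t where "x = \<alpha> @ t \<and> t @ concat xs = w @ \<beta> \<or> x @ t = \<alpha> \<and> concat xs = t @ w @ \<beta>"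
        using e by (auto simp: append_eq_append_conv2)
      then consider (in_x) "x = \<alpha> @ t" "t @ concat xs = w @ \<beta>"
        | (past) "x @ t = \<alpha>" "concat xs = t @ w @ \<beta>" by blast
      then show ?thesis
      proof cases
        case past
        then obtain p q where "w = p @ q" "t @ p \<in> lang_star Y" "q @ \<beta> \<in> lang_star Y"
          using Cons.IH[of t] Cons.prems by auto
        moreover have "\<alpha> @ p \<in> lang_star Y"
          using star_append[OF star_base[OF x(1)] \<open>t @ p \<in> lang_star Y\<close>] past(1) by auto
        ultimately show ?thesis by blast
      next
        case in_x
        then obtain s where "t = w @ s \<and> s @ concat xs = \<beta> \<or> t @ s = w \<and> concat xs = s @ \<beta>"
          by (auto simp: append_eq_append_conv2)
        then show ?thesis
        proof
          assume 1: "t = w @ s \<and> s @ concat xs = \<beta>"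
          then have "s = []" using assms(1)[of \<alpha> s] False x in_x by auto
          then show ?thesis using 1 in_x x star_base
            by (intro exI[of _ w] exI[of _ "[]"]) auto
        next
          assume "t @ s = w \<and> concat xs = s @ \<beta>"
          then show ?thesis using in_x x star_base
            by (intro exI[of _ t] exI[of _ s]) auto
        qed
      qed
    qed
  qed
  then show ?thesis using assms(2) unfolding lang_star_def by (metis imageE)
qed

lemma star_cut_starts:
  assumes Y: "bifix_free Y" and w: "\<And>u v. u \<noteq> [] \<Longrightarrow> v \<noteq> [] \<Longrightarrow> u @ w @ v \<notin> Y"
    and "\<alpha> @ w @ \<beta> \<in> lang_star Y"
  shows "\<exists>r\<in>starts Y w. \<exists>s. w = r @ s \<and> \<alpha> @ r \<in> lang_star Y \<and> s @ \<beta> \<in> lang_star Y"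
proof -
  obtain p q where pq: "w = p @ q" "\<alpha> @ p \<in> lang_star Y" "q @ \<beta> \<in> lang_star Y"
    using star_cut[OF w assms(3)] by blast
  \<comment> \<open>The cut after \<open>p\<close> is moved left to a start by dropping code words
    from the end of \<open>p\<close>; \<open>left_unitary\<close> keeps the left part in the
    star.\<close>
  obtain r x where r: "p = r @ x" "x \<in> lang_star Y" "r \<notin> UNIV @@ Y"
    using start_decomp[of Y p] Y by (auto simp: bifix_free_def)
  have "\<alpha> @ r \<in> lang_star Y" using left_unitary[OF Y r(2), of "\<alpha> @ r"] pq r by simp
  moreover have "(x @ q) @ \<beta> \<in> lang_star Y" using star_append[OF r(2) pq(3)] by simp
  moreover have "r \<in> starts Y w" using pq r by (auto simp: starts_def)
  ultimately show ?thesis using pq(1) r(1) by (metis append_assoc)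
qed

section \<open>The action of words on the parses of a full word\<close>

abbreviation star_cong :: "'a list set \<Rightarrow> 'a list \<Rightarrow> 'a list \<Rightarrow> bool" where
  "star_cong Y u v \<equiv> (u, v) \<in> syntactic_congruence (lang_star Y)"

lemma star_congD: "star_cong Y u v \<Longrightarrow> x @ u @ y \<in> lang_star Y \<longleftrightarrow> x @ v @ y \<in> lang_star Y"
  unfolding syntactic_congruence_def by blast

lemma star_cong_refl: "star_cong Y u u"
  unfolding syntactic_congruence_def by blast

lemma star_cong_sym: "star_cong Y u v \<Longrightarrow> star_cong Y v u"
  unfolding syntactic_congruence_def by blast

lemma star_cong_trans: "star_cong Y u v \<Longrightarrow> star_cong Y v w \<Longrightarrow> star_cong Y u w"
  unfolding syntactic_congruence_def by blast

lemma star_cong_append: "star_cong Y u u' \<Longrightarrow> star_cong Y v v' \<Longrightarrow> star_cong Y (u @ v) (u' @ v')"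
  using syntactic_congruence_congruence[of "lang_star Y"] unfolding word_congruence_def by blast

definition rest :: "'a list \<Rightarrow> 'a list \<Rightarrow> 'a list" where
  "rest w r = drop (length r) w"

lemma rest_append [simp]: "rest (r @ s) r = s"
  by (simp add: rest_def)

lemma starts_rest: "r \<in> starts Y w \<Longrightarrow> r @ rest w r = w"
  by (auto simp: starts_def prefix_def)

text \<open>The action of \<open>y\<close> on the parses of \<open>w\<close>, a parse being named by its first component: the pair
  \<open>(r, r')\<close> records that the parse \<open>r\<close> of the left \<open>w\<close> and the parse \<open>r'\<close> of the right \<open>w\<close> come from a
  single parse of \<open>w y w\<close>.\<close>

definition rho :: "'a list set \<Rightarrow> 'a list \<Rightarrow> 'a list \<Rightarrow> ('a list \<times> 'a list) set" where
  "rho Y w y = {(r, r'). r \<in> starts Y w \<and> r' \<in> starts Y w \<and> rest w r @ y @ r' \<in> lang_star Y}"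

lemma rho_cong:
  assumes "star_cong Y y y'"
  shows "rho Y w y = rho Y w y'"
  unfolding rho_def using star_congD[OF assms] by blast

text \<open>The consequence of fullness that passes to subsets of the code; for X it replaces
  fullness, which may fail.\<close>

definition noninternal :: "'a list set \<Rightarrow> 'a list \<Rightarrow> bool" where
  "noninternal Y w \<longleftrightarrow> (\<forall>u v. u \<noteq> [] \<longrightarrow> v \<noteq> [] \<longrightarrow> u @ w @ v \<notin> Y)"

lemma full_noninternal: "bifix_free Y \<Longrightarrow> full Y w \<Longrightarrow> noninternal Y w"
  using full_not_internal unfolding noninternal_def by blast

lemma noninternal_cut:
  assumes "bifix_free Y" "noninternal Y w"
  shows "\<alpha> @ w @ \<beta> \<in> lang_star Y \<longleftrightarrow>
    (\<exists>r\<in>starts Y w. \<alpha> @ r \<in> lang_star Y \<and> rest w r @ \<beta> \<in> lang_star Y)" (is "?l = ?r")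
proof
  assume ?l
  then obtain r s where "r \<in> starts Y w" "w = r @ s" "\<alpha> @ r \<in> lang_star Y" "s @ \<beta> \<in> lang_star Y"
    using star_cut_starts[OF assms(1) _ \<open>?l\<close>] assms(2) unfolding noninternal_def by blast
  then show ?r by (metis rest_append)
next
  assume ?r
  then obtain r where r: "r \<in> starts Y w" "\<alpha> @ r \<in> lang_star Y" "rest w r @ \<beta> \<in> lang_star Y"
    by blast
  have "(\<alpha> @ r) @ (rest w r @ \<beta>) = \<alpha> @ w @ \<beta>" using starts_rest[OF r(1)] by (metis append_assoc)
  then show ?l using star_append[OF r(2,3)] by (simp only:)
qed

text \<open>A word of the star through the middle \<open>w\<close> is cut there at a start
  \<open>t\<close>, the intermediate point of the composition.\<close>

lemma rho_append:
  assumes "bifix_free Y" "noninternal Y w"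
  shows "rho Y w (y @ w @ y') = rho Y w y O rho Y w y'"
proof -
  have "rest w r @ (y @ w @ y') @ r' \<in> lang_star Y \<longleftrightarrow>
    (\<exists>t\<in>starts Y w. rest w r @ y @ t \<in> lang_star Y \<and> rest w t @ y' @ r' \<in> lang_star Y)" for r r'
    using noninternal_cut[OF assms, of "rest w r @ y" "y' @ r'"] by simp
  then show ?thesis unfolding rho_def by auto
qed

text \<open>Membership in the star of a word containing \<open>w y w\<close> only asks for starts of
  the two occurrences of \<open>w\<close> that fit the outer context and are joined by a pair of
  \<open>rho\<close>.\<close>

lemma rho_determines:
  assumes "bifix_free Y" "noninternal Y w" "rho Y w y = rho Y w y'"
  shows "star_cong Y (w @ y @ w) (w @ y' @ w)"
proof -
  have "\<alpha> @ (w @ y @ w) @ \<beta> \<in> lang_star Y \<longleftrightarrow>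
    (\<exists>(r, r')\<in>rho Y w y. \<alpha> @ r \<in> lang_star Y \<and> rest w r' @ \<beta> \<in> lang_star Y)" for \<alpha> \<beta> y
  proof -
    have "rest w r @ y @ w @ \<beta> \<in> lang_star Y \<longleftrightarrow>
      (\<exists>r'\<in>starts Y w. rest w r @ y @ r' \<in> lang_star Y \<and> rest w r' @ \<beta> \<in> lang_star Y)" for r
      using noninternal_cut[OF assms(1,2), of "rest w r @ y" \<beta>] by simp
    then show ?thesis
      using noninternal_cut[OF assms(1,2), of \<alpha> "y @ w @ \<beta>"] unfolding rho_def by auto
  qed
  then show ?thesis using assms(3) unfolding syntactic_congruence_def by simp
qed

lemma full_rho:
  assumes "bifix_free Y" "full Y w"
  shows full_rho_total: "\<And>r. r \<in> starts Y w \<Longrightarrow> \<exists>r'. (r, r') \<in> rho Y w y"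
    and full_rho_surj: "\<And>r'. r' \<in> starts Y w \<Longrightarrow> \<exists>r. (r, r') \<in> rho Y w y"
proof -
  have sub: "starts Y ((w @ y) @ w) = starts Y w" using full_append[OF assms, of "y @ w"] by simp
  obtain f where f: "inj_on f (starts Y w)" "f ` starts Y w \<subseteq> starts Y ((w @ y) @ w)"
    "\<And>r. r \<in> starts Y w \<Longrightarrow> \<exists>x. (w @ y) @ r = f r @ x \<and> x \<in> lang_star Y"
    using starts_push[OF assms(1)] by metis
  \<comment> \<open>An injection of a finite set into itself. It moves a start of the right
    \<open>w\<close> back to one of the left \<open>w\<close>, hence the order in the pair
    \<open>(f r, r)\<close>.\<close>
  have onto: "f ` starts Y w = starts Y w"
    using f(1,2) unfolding sub by (intro endo_inj_surj starts_finite)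
  have *: "(f r, r) \<in> rho Y w y" if r: "r \<in> starts Y w" for r
  proof -
    have fr: "f r \<in> starts Y w" using onto r by blast
    obtain x where x: "(w @ y) @ r = f r @ x" "x \<in> lang_star Y" using f(3)[OF r] by blast
    have "(w @ y) @ r = f r @ (rest w (f r) @ y @ r)" using starts_rest[OF fr] by (metis append_assoc)
    then have "x = rest w (f r) @ y @ r" using x(1) by (metis same_append_eq)
    then show ?thesis using x(2) fr r unfolding rho_def by auto
  qed
  show "\<exists>r'. (r, r') \<in> rho Y w y" if "r \<in> starts Y w" for r
    using that * onto by (metis imageE)
  show "\<exists>r. (r, r') \<in> rho Y w y" if "r' \<in> starts Y w" for r'
    using that * by blast
qed

lemma rho_functional:
  assumes "bifix_free Y" "(r, r1) \<in> rho Y w y" "(r, r2) \<in> rho Y w y"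
  shows "r1 = r2"
proof -
  have 1: "r1 \<in> starts Y w" "r2 \<in> starts Y w"
    "(rest w r @ y) @ r1 \<in> lang_star Y" "(rest w r @ y) @ r2 \<in> lang_star Y"
    using assms by (auto simp: rho_def)
  then have "prefix r1 r2 \<or> prefix r2 r1" unfolding starts_def using prefix_same_cases by blast
  then show ?thesis
    using starts_unique[OF assms(1) 1] starts_unique[OF assms(1) 1(2,1,4,3)] by blast
qed

text \<open>If one start extended the other by \<open>t\<close>, then \<open>t\<close> would lie in
  the star by \<open>left_unitary\<close>, and the longer start would end in a code word unless
  \<open>t\<close> is empty.\<close>

lemma rest_unique:
  assumes "bifix_free Y" "r1 \<in> starts Y w" "r2 \<in> starts Y w"
    and "rest w r1 @ v \<in> lang_star Y" "rest w r2 @ v \<in> lang_star Y"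
  shows "r1 = r2"
proof -
  have *: "r = r'" if p: "prefix r r'" "r \<in> starts Y w" "r' \<in> starts Y w"
    "rest w r @ v \<in> lang_star Y" "rest w r' @ v \<in> lang_star Y" for r r'
  proof -
    obtain t where t: "r' = r @ t" using p(1) by (auto simp: prefix_def)
    have "r @ rest w r = r @ (t @ rest w r')"
      using starts_rest[OF p(2)] starts_rest[OF p(3)] t by simp
    then have "t @ (rest w r' @ v) \<in> lang_star Y" using p(4) by simp
    then have "t \<in> lang_star Y" using left_unitary[OF assms(1) p(5)] by simp
    moreover have "[] \<notin> Y" "r @ t \<notin> UNIV @@ Y"
      using assms(1) p(3) t by (auto simp: bifix_free_def starts_def)
    ultimately have "t = []" using not_start by blast
    then show ?thesis using t by simp
  qed
  have "prefix r1 r2 \<or> prefix r2 r1"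
    using assms(2,3) unfolding starts_def using prefix_same_cases by blast
  then show ?thesis using *[OF _ assms(2-5)] *[OF _ assms(3,2,5,4)] by blast
qed

lemma rho_injective:
  assumes "bifix_free Y" "(r1, r) \<in> rho Y w y" "(r2, r) \<in> rho Y w y"
  shows "r1 = r2"
  using rest_unique[OF assms(1), of r1 w r2 "y @ r"] assms by (auto simp: rho_def)

text \<open>A bijective \<open>R\<close> cancels on both sides of \<open>R I R = R R\<close>,
  leaving \<open>I\<close> as the identity. The word \<open>y\<close> is left free because for X
  bijectivity is known at one particular word.\<close>

lemma rho_idem:
  assumes "bifix_free Y"
    and tot: "\<And>r. r \<in> starts Y w \<Longrightarrow> \<exists>r'. (r, r') \<in> rho Y w y"
    and sur: "\<And>r'. r' \<in> starts Y w \<Longrightarrow> \<exists>r. (r, r') \<in> rho Y w y"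
    and eq: "rho Y w y O rho Y w [] O rho Y w y = rho Y w y O rho Y w y"
  shows "rho Y w [] = Id_on (starts Y w)"
proof -
  have *: "(r, r) \<in> rho Y w []" if r: "r \<in> starts Y w" for r
  proof -
    obtain p where p: "(p, r) \<in> rho Y w y" using sur[OF r] by blast
    obtain q where q: "(r, q) \<in> rho Y w y" using tot[OF r] by blast
    have "(p, q) \<in> rho Y w y O rho Y w [] O rho Y w y" unfolding eq using p q by blast
    then obtain r1 r2 where "(p, r1) \<in> rho Y w y" "(r1, r2) \<in> rho Y w []" "(r2, q) \<in> rho Y w y"
      by blast
    moreover from this have "r1 = r" "r2 = r"
      using rho_functional[OF assms(1) p] rho_injective[OF assms(1) q] by blast+
    ultimately show ?thesis by simp
  qed
  moreover have "a = b \<and> a \<in> starts Y w" if "(a, b) \<in> rho Y w []" for a b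
  proof -
    have "a \<in> starts Y w" using that by (simp add: rho_def)
    then show ?thesis using rho_functional[OF assms(1) that *] by simp
  qed
  ultimately show ?thesis by auto
qed

text \<open>With \<open>R\<close> the action of \<open>[]\<close>, the word \<open>w w\<close> acts
  as the third power of \<open>R\<close> and \<open>w\<close> as its square; idempotence equates the
  two.\<close>

lemma full_rho_Nil:
  assumes "bifix_free Y" "full Y w" "star_cong Y (w @ w) w"
  shows "rho Y w [] = Id_on (starts Y w)"
proof (rule rho_idem[OF assms(1), where y = "[]"])
  show "rho Y w [] O rho Y w [] O rho Y w [] = rho Y w [] O rho Y w []"
    using rho_append[OF assms(1) full_noninternal[OF assms(1,2)], of "[]" "[]"]
      rho_append[OF assms(1) full_noninternal[OF assms(1,2)], of "[]" "w"]
      rho_cong[OF assms(3), of w]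
    by simp
qed (use full_rho[OF assms(1,2)] in auto)

section \<open>Restriction of parses and actions to a factorial set\<close>

lemma factorial_setD: "factorial_set F \<Longrightarrow> x @ y @ z \<in> F \<Longrightarrow> y \<in> F"
  unfolding factorial_set_def by (meson sublist_appendI)

lemma factorial_star:
  assumes "factorial_set F" "x \<in> F"
  shows "x \<in> lang_star (Z \<inter> F) \<longleftrightarrow> x \<in> lang_star Z"
proof
  show "x \<in> lang_star (Z \<inter> F) \<Longrightarrow> x \<in> lang_star Z" using star_mono[of "Z \<inter> F" Z] by blast
  assume "x \<in> lang_star Z"
  then obtain xs where xs: "x = concat xs" "xs \<in> lists Z" by (auto simp: lang_star_def)
  have "y \<in> F" if y: "y \<in> set xs" for y
  proof -
    obtain us vs where "xs = us @ y # vs" using split_list[OF y] by blast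
    then have "x = concat us @ y @ concat vs" using xs by simp
    then show ?thesis using factorial_setD[OF assms(1)] assms(2) by blast
  qed
  then have "xs \<in> lists (Z \<inter> F)" using xs(2) by auto
  then show "x \<in> lang_star (Z \<inter> F)" using xs(1) by (auto simp: lang_star_def)
qed

lemma factorial_starts:
  assumes "factorial_set F" "w \<in> F"
  shows "starts (Z \<inter> F) w = starts Z w"
proof -
  have "v \<in> UNIV @@ (Z \<inter> F) \<longleftrightarrow> v \<in> UNIV @@ Z" if v: "prefix v w" for v
  proof
    assume "v \<in> UNIV @@ Z"
    then obtain x y where xy: "v = x @ y" "y \<in> Z" by (auto simp: lang_conc_def)
    obtain t where "w = x @ y @ t" using v xy by (auto simp: prefix_def)
    then show "v \<in> UNIV @@ (Z \<inter> F)"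
      using factorial_setD[OF assms(1), of x y t] assms(2) xy unfolding lang_conc_def by blast
  qed (auto simp: lang_conc_def)
  then show ?thesis unfolding starts_def by blast
qed

text \<open>Every word tested by \<open>rho\<close> is a factor of \<open>w v w\<close>, hence lies
  in F, where the two stars agree.\<close>

lemma factorial_rho:
  assumes "factorial_set F" "w @ v @ w \<in> F"
  shows "rho (Z \<inter> F) w v = rho Z w v"
proof -
  have w: "w \<in> F" using factorial_setD[OF assms(1), of "[]" w] assms(2) by simp
  have "rest w r @ v @ r' \<in> F" if "r \<in> starts Z w" "r' \<in> starts Z w" for r r'
  proof -
    have "w @ v @ w = r @ (rest w r @ v @ r') @ rest w r'"
      using starts_rest[OF that(1)] starts_rest[OF that(2)] by (metis append_assoc)
    then show ?thesis using factorial_setD[OF assms(1)] assms(2) by metis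
  qed
  then show ?thesis
    unfolding rho_def factorial_starts[OF assms(1) w] using factorial_star[OF assms(1)] by blast
qed

section \<open>The actions for X and Z at an idempotent word of F\<close>

locale full_idempotent_word =
  fixes Z F X :: "'a list set" and w v :: "'a list"
  assumes bifix: "bifix_free Z" and fact: "factorial_set F" and X: "X = Z \<inter> F"
    and full: "full Z w" and recur: "w @ v @ w \<in> F"
    and idemZ: "star_cong Z (w @ w) w" and idemX: "star_cong X (w @ w) w"
begin

lemma bifix_X: "bifix_free X"
  using bifix_free_subset[OF bifix] X by blast

lemma w_in: "w \<in> F"
  using factorial_setD[OF fact, of "[]" w] recur by simp

lemma noninternal_Z: "noninternal Z w"
  by (rule full_noninternal[OF bifix full])

lemma noninternal_X: "noninternal X w"
  using noninternal_Z unfolding noninternal_def X by blast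

lemma starts_X: "starts X w = starts Z w"
  unfolding X by (rule factorial_starts[OF fact w_in])

lemma rho_sub: "rho X w y \<subseteq> rho Z w y"
  unfolding rho_def starts_X using star_mono[of X Z] X by blast

lemma rho_Z_Nil: "rho Z w [] = Id_on (starts Z w)"
  by (rule full_rho_Nil[OF bifix full idemZ])

text \<open>Since \<open>w v w\<close> lies in F, the actions of \<open>v\<close> for X and Z agree,
  so \<open>rho X w v\<close> is a permutation although \<open>w\<close> need not be full for X.
  Inserting the idempotent between two copies of \<open>v\<close> gives the equation to which
  \<open>rho_idem\<close> applies.\<close>

lemma rho_X_Nil: "rho X w [] = Id_on (starts Z w)"
proof -
  have e: "rho X w v = rho Z w v" unfolding X by (rule factorial_rho[OF fact recur])
  have "star_cong X (v @ (w @ w) @ v) (v @ w @ v)"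
    by (intro star_cong_append star_cong_refl idemX)
  then have "rho X w (v @ w @ w @ v) = rho X w (v @ w @ v)" using rho_cong by fastforce
  then have "rho X w v O rho X w [] O rho X w v = rho X w v O rho X w v"
    using rho_append[OF bifix_X noninternal_X, of v v]
      rho_append[OF bifix_X noninternal_X, of v "w @ v"]
      rho_append[OF bifix_X noninternal_X, of "[]" v] by simp
  then have "rho X w [] = Id_on (starts X w)"
    using full_rho[OF bifix full, of _ v] unfolding starts_X[symmetric] e[symmetric]
    by (intro rho_idem[OF bifix_X]) auto
  then show ?thesis unfolding starts_X .
qed

lemma rho_sandwich:
  "rho Z w (w @ y @ w) = rho Z w y" "rho X w (w @ y @ w) = rho X w y"
proof -
  have "rho Y w (w @ y @ w) = rho Y w y"
    if "bifix_free Y" "noninternal Y w" "rho Y w [] = Id_on (starts Z w)" "starts Y w = starts Z w" for Y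
  proof -
    have "rho Y w (w @ y @ w) = rho Y w [] O rho Y w y O rho Y w []"
      using rho_append[OF that(1,2), of "[]" "y @ w"] rho_append[OF that(1,2), of y "[]"] by simp
    also have "\<dots> = rho Y w y" unfolding that(3) using that(4) by (auto simp: rho_def)
    finally show ?thesis .
  qed
  then show "rho Z w (w @ y @ w) = rho Z w y" "rho X w (w @ y @ w) = rho X w y"
    using bifix noninternal_Z rho_Z_Nil bifix_X noninternal_X rho_X_Nil starts_X by blast+
qed

text \<open>A right inverse of \<open>y\<close> modulo X makes its partial injection total; being
  contained in the functional relation for Z, it equals that relation.\<close>

lemma unit_rho:
  assumes "star_cong X (y @ w) y" "star_cong X (y @ y') w"
  shows "rho X w y = rho Z w y"
proof -
  have "star_cong X (y @ w @ y') (y @ y')"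
    using star_cong_append[OF assms(1) star_cong_refl[where Y=X and u=y']] by simp
  then have "rho X w (y @ w @ y') = rho X w w" using rho_cong[OF star_cong_trans[OF _ assms(2)]] by blast
  also have "\<dots> = rho X w [] O rho X w []"
    using rho_append[OF bifix_X noninternal_X, of "[]" "[]"] by simp
  finally have id: "rho X w y O rho X w y' = Id_on (starts Z w)"
    unfolding rho_append[OF bifix_X noninternal_X] rho_X_Nil by auto
  have "(r, r') \<in> rho X w y" if "(r, r') \<in> rho Z w y" for r r'
  proof -
    have "(r, r) \<in> rho X w y O rho X w y'" unfolding id using that by (auto simp: rho_def)
    then obtain t where "(r, t) \<in> rho X w y" by blast
    moreover have "t = r'" using rho_functional[OF bifix _ that] rho_sub \<open>(r, t) \<in> rho X w y\<close> by blast
    ultimately show ?thesis by simp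
  qed
  then show ?thesis using rho_sub by auto
qed

text \<open>Both congruences amount to equality of the actions of \<open>y\<close> and
  \<open>y'\<close>, which are common to X and Z by \<open>unit_rho\<close>. The outer factors
  \<open>w\<close> are there because nothing places \<open>y\<close> itself in the local monoid for
  Z.\<close>

lemma unit_transfer:
  assumes y: "star_cong X (y @ w) y" "star_cong X (w @ y) y" "star_cong X (y @ z) w"
    and y': "star_cong X (y' @ w) y'" "star_cong X (w @ y') y'" "star_cong X (y' @ z') w"
  shows "star_cong X y y' \<longleftrightarrow> star_cong Z (w @ y @ w) (w @ y' @ w)"
proof
  assume "star_cong X y y'"
  then have "rho Z w y = rho Z w y'"
    using rho_cong unit_rho[OF y(1,3)] unit_rho[OF y'(1,3)] by metis
  then show "star_cong Z (w @ y @ w) (w @ y' @ w)" by (rule rho_determines[OF bifix noninternal_Z])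
next
  assume "star_cong Z (w @ y @ w) (w @ y' @ w)"
  then have "rho Z w y = rho Z w y'" using rho_cong[where Y=Z and w=w] rho_sandwich(1) by metis
  then have "rho X w y = rho X w y'" using unit_rho[OF y(1,3)] unit_rho[OF y'(1,3)] by simp
  then have "star_cong X (w @ y @ w) (w @ y' @ w)" by (rule rho_determines[OF bifix_X noninternal_X])
  moreover have *: "star_cong X (w @ y @ w) y" if "star_cong X (y @ w) y" "star_cong X (w @ y) y" for y
    using star_cong_trans[OF star_cong_append[OF star_cong_refl that(1)] that(2)] .
  ultimately show "star_cong X y y'"
    using star_cong_trans[OF star_cong_trans[OF star_cong_sym[OF *[OF y(1,2)]]] *[OF y'(1,2)]] by blast
qed

end

text \<open>The word \<open>w y w\<close> permutes the finitely many parses of \<open>w\<close>, so some power of it is congruent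
  to \<open>w\<close>.\<close>

lemma full_group:
  assumes Y: "bifix_free Y" and w: "full Y w" "star_cong Y (w @ w) w"
  shows "\<exists>z. star_cong Y (w @ y @ w @ z @ w) w \<and> star_cong Y (w @ z @ w @ y @ w) w"
proof -
  note ni = full_noninternal[OF Y w(1)]
  note nil = full_rho_Nil[OF Y w]
  \<comment> \<open>\<open>P n\<close> is \<open>y (w y)^n\<close>; it acts as the power of exponent
    \<open>n + 1\<close> of the action of \<open>y\<close>.\<close>
  define P where "P n = ((\<lambda>u. u @ w @ y) ^^ n) y" for n
  have P0: "P 0 = y" and PS: "P (Suc n) = P n @ w @ y" for n by (simp_all add: P_def)
  have pow: "rho Y w (P n) = rho Y w y ^^ Suc n" for n
    by (induction n) (simp_all add: P0 PS rho_append[OF Y ni])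
  have comm: "rho Y w y O (rho Y w y ^^ n) = (rho Y w y ^^ n) O rho Y w y" for n
    by (rule relpow_commute)
  have "finite (range (\<lambda>n. rho Y w (P n)))"
    by (rule finite_subset[of _ "Pow (starts Y w \<times> starts Y w)"])
      (auto simp: rho_def starts_finite)
  then have "\<not> inj (\<lambda>n. rho Y w (P n))" using finite_imageD infinite_UNIV_nat by blast
  then obtain i j where ij: "i < j" "rho Y w (P i) = rho Y w (P j)"
    unfolding inj_def by (metis linorder_neqE_nat)
  define k where "k = j - i"
  have k: "k > 0" using ij by (simp add: k_def)
  let ?R = "rho Y w y"
  have "Suc j = k + Suc i" using ij(1) by (simp add: k_def)
  then have "?R ^^ Suc j = ?R ^^ k O ?R ^^ Suc i" by (simp only: relpow_add)
  then have eq: "?R ^^ k O ?R ^^ Suc i = ?R ^^ Suc i" using ij(2) pow by simp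
  have id: "?R ^^ k = Id_on (starts Y w)"
  proof -
    have rk: "?R ^^ k = rho Y w (P (k - 1))" using pow[of "k - 1"] k by simp
    have tot: "\<exists>r'. (r, r') \<in> rho Y w u" if "r \<in> starts Y w" for r u
      using full_rho_total[OF Y w(1) that] .
    \<comment> \<open>Injectivity of the action of \<open>P i\<close> cancels it from
      \<open>eq\<close>.\<close>
    have sub: "r = r'" if rr: "(r, r') \<in> ?R ^^ k" for r r'
    proof -
      have "r' \<in> starts Y w" using rr rk by (auto simp: rho_def)
      then obtain q where q: "(r', q) \<in> rho Y w (P i)" using tot by blast
      then have "(r, q) \<in> ?R ^^ k O ?R ^^ Suc i" using rr pow by auto
      then have "(r, q) \<in> rho Y w (P i)" using eq pow by simp
      then show ?thesis using rho_injective[OF Y _ q] by blast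
    qed
    have "(r, r) \<in> ?R ^^ k" if "r \<in> starts Y w" for r
      using tot[OF that, of "P (k - 1)"] sub unfolding rk by blast
    moreover have "r \<in> starts Y w" if "(r, r') \<in> ?R ^^ k" for r r'
      using that unfolding rk by (simp add: rho_def)
    ultimately show ?thesis using sub by (intro subset_antisym subrelI) (metis Id_on_iff)+
  qed
  \<comment> \<open>Doubling makes the exponent \<open>k + k - 1\<close> of the inverse positive.
    For \<open>k = 1\<close> the power of exponent \<open>k - 1\<close> would be the identity on all
    words, which is not the action of any \<open>P n\<close>.\<close>
  have id2: "?R ^^ (k + k) = Id_on (starts Y w)" unfolding relpow_add id by auto
  define z where "z = P (k + k - 2)"
  have R: "rho Y w z = ?R ^^ (k + k - 1)" and kk: "k + k = Suc (k + k - 1)"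
    using pow[of "k + k - 2"] k by (simp_all add: z_def Suc_diff_Suc numeral_2_eq_2)
  have "rho Y w (z @ w @ y) = ?R ^^ (k + k)"
    unfolding rho_append[OF Y ni] R by (subst kk) simp
  moreover have "rho Y w (y @ w @ z) = ?R ^^ (k + k)"
    unfolding rho_append[OF Y ni] R by (subst kk) (simp add: comm)
  ultimately have "star_cong Y (w @ (y @ w @ z) @ w) (w @ [] @ w)"
    "star_cong Y (w @ (z @ w @ y) @ w) (w @ [] @ w)"
    using nil id2 by (intro rho_determines[OF Y ni]; simp)+
  then have "star_cong Y (w @ y @ w @ z @ w) (w @ w)" "star_cong Y (w @ z @ w @ y @ w) (w @ w)"
    by simp_all
  then show ?thesis using star_cong_trans[OF _ w(2)] by blast
qed

text \<open>The word \<open>w r\<close> carries the parse \<open>r\<close> of \<open>w\<close> to the trivial parse \<open>[]\<close>.\<close>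

lemma full_transitive:
  assumes Y: "bifix_free Y" and w: "full Y w" "star_cong Y (w @ w) w" and r: "r \<in> starts Y w"
  shows "rest w r @ w @ r @ w \<in> lang_star Y"
proof -
  have d: "rest w q @ q \<in> lang_star Y" if "q \<in> starts Y w" for q
  proof -
    have "(q, q) \<in> rho Y w []" unfolding full_rho_Nil[OF Y w] using that by blast
    then show ?thesis by (simp add: rho_def)
  qed
  \<comment> \<open>The case of the trivial start, whose rest is \<open>w\<close>. Below, the inner
    \<open>r\<close> and \<open>rest w r\<close> are regrouped into the middle
    \<open>w\<close>.\<close>
  have "w \<in> lang_star Y" using d[OF Nil_in_starts[OF Y]] by (simp add: rest_def)
  then have "(rest w r @ r) @ (rest w r @ r) @ w \<in> lang_star Y"
    by (intro star_append[OF d[OF r]])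
  moreover have "(rest w r @ r) @ (rest w r @ r) @ w = rest w r @ (r @ rest w r) @ r @ w" by simp
  ultimately show ?thesis using starts_rest[OF r] by metis
qed

section \<open>Maximal subgroups and ideals of monoids\<close>

context monoid
begin

text \<open>Identifies the H-class of \<open>e\<close> with the group of units of the local monoid
  of \<open>e\<close>, the form in which it is used from here on.\<close>

lemma H_class_idem_iff:
  assumes "e \<in> idempotents G"
  shows "h \<in> H_class G e \<longleftrightarrow> h \<in> carrier G \<and> e \<otimes> h = h \<and> h \<otimes> e = h \<and>
    (\<exists>k\<in>carrier G. h \<otimes> k = e \<and> k \<otimes> h = e)" (is "?l \<longleftrightarrow> ?r")
proof
  have e: "e \<in> carrier G" "e \<otimes> e = e" using assms by (auto simp: idempotents_def)
  assume ?l
  then have h: "h \<in> carrier G" and R: "h <# carrier G = e <# carrier G"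
    and L: "carrier G #> h = carrier G #> e"
    by (auto simp: H_class_def R_class_def L_class_def)
  have "h \<in> h <# carrier G" "e \<in> e <# carrier G" "h \<in> carrier G #> h" "e \<in> carrier G #> e"
    using h e(1) unfolding l_coset_def r_coset_def
    by (auto intro: r_one[symmetric] l_one[symmetric] bexI[of _ \<one>])
  then obtain a b m n where a: "a \<in> carrier G" "h = e \<otimes> a" and b: "b \<in> carrier G" "h = b \<otimes> e"
    and m: "m \<in> carrier G" "e = h \<otimes> m" and n: "n \<in> carrier G" "e = n \<otimes> h"
    unfolding R L using R L unfolding l_coset_def r_coset_def by blast
  have eh: "e \<otimes> h = h" using a e m_assoc by metis
  have he: "h \<otimes> e = h" using b e m_assoc by metis
  \<comment> \<open>A left and a right inverse in the local monoid coincide.\<close>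
  have "n \<otimes> e = e \<otimes> m" using m n h m_assoc by metis
  then have "h \<otimes> (e \<otimes> m) = e" "(e \<otimes> m) \<otimes> h = e"
    using he eh m n h e m_assoc by metis+
  then show ?r using h eh he m(1) e(1) by blast
next
  have e: "e \<in> carrier G" "e \<otimes> e = e" using assms by (auto simp: idempotents_def)
  assume ?r
  then obtain k where h: "h \<in> carrier G" "e \<otimes> h = h" "h \<otimes> e = h" and
    k: "k \<in> carrier G" "h \<otimes> k = e" "k \<otimes> h = e" by blast
  have "h <# carrier G = e <# carrier G"
  proof (intro equalityI subsetI)
    fix x assume "x \<in> h <# carrier G"
    then obtain a where "a \<in> carrier G" "x = h \<otimes> a" by (auto simp: l_coset_def)
    then have "x = e \<otimes> (h \<otimes> a)" "h \<otimes> a \<in> carrier G" using h e m_assoc by (metis, simp)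
    then show "x \<in> e <# carrier G" by (auto simp: l_coset_def)
  next
    fix x assume "x \<in> e <# carrier G"
    then obtain a where "a \<in> carrier G" "x = e \<otimes> a" by (auto simp: l_coset_def)
    then have "x = h \<otimes> (k \<otimes> a)" "k \<otimes> a \<in> carrier G" using h e k m_assoc by (metis, simp)
    then show "x \<in> h <# carrier G" by (auto simp: l_coset_def)
  qed
  moreover have "carrier G #> h = carrier G #> e"
  proof (intro equalityI subsetI)
    fix x assume "x \<in> carrier G #> h"
    then obtain a where "a \<in> carrier G" "x = a \<otimes> h" by (auto simp: r_coset_def)
    then have "x = (a \<otimes> h) \<otimes> e" "a \<otimes> h \<in> carrier G" using h e m_assoc by (metis, simp)
    then show "x \<in> carrier G #> e" by (auto simp: r_coset_def)
  next
    fix x assume "x \<in> carrier G #> e"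
    then obtain a where "a \<in> carrier G" "x = a \<otimes> e" by (auto simp: r_coset_def)
    then have "x = (a \<otimes> k) \<otimes> h" "a \<otimes> k \<in> carrier G" using h e k m_assoc by (metis, simp)
    then show "x \<in> carrier G #> h" by (auto simp: r_coset_def)
  qed
  ultimately show ?l using h(1) by (auto simp: H_class_def R_class_def L_class_def)
qed

lemma idem_in_H_class: "e \<in> idempotents G \<Longrightarrow> e \<in> H_class G e"
  using H_class_idem_iff[of e e] by (auto simp: idempotents_def)

lemma H_class_idem_unique:
  assumes "e \<in> idempotents G" "f \<in> idempotents G" "f \<in> H_class G e"
  shows "f = e"
proof -
  obtain k where "k \<in> carrier G" "f \<otimes> k = e" "e \<otimes> f = f" "f \<in> carrier G"
    using assms(3) H_class_idem_iff[OF assms(1)] by blast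
  moreover have "f \<otimes> f = f" using assms(2) by (auto simp: idempotents_def)
  moreover have "f \<otimes> e = f" using assms(3) H_class_idem_iff[OF assms(1)] by blast
  ultimately show ?thesis using m_assoc by metis
qed

lemma H_class_inverse:
  assumes "e \<in> idempotents G" "h \<in> H_class G e"
  shows "\<exists>k\<in>H_class G e. h \<otimes> k = e \<and> k \<otimes> h = e"
proof -
  have e: "e \<in> carrier G" "e \<otimes> e = e" using assms by (auto simp: idempotents_def)
  obtain k where h: "h \<in> carrier G" "e \<otimes> h = h" "h \<otimes> e = h" and
    k: "k \<in> carrier G" "h \<otimes> k = e" "k \<otimes> h = e"
    using assms H_class_idem_iff[OF assms(1)] by blast
  \<comment> \<open>The inverse \<open>k\<close> may lie outside the local monoid; compressing it by
    \<open>e\<close> on both sides puts it inside.\<close>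
  define l where "l = e \<otimes> k \<otimes> e"
  have l: "l \<in> carrier G" "e \<otimes> l = l" "l \<otimes> e = l"
    using e k(1) unfolding l_def by (simp_all add: m_assoc) (metis m_assoc m_closed)
  have "h \<otimes> l = e"
  proof -
    have "h \<otimes> l = (h \<otimes> e) \<otimes> (k \<otimes> e)" using e k(1) h(1) unfolding l_def by (simp add: m_assoc)
    also have "\<dots> = (h \<otimes> k) \<otimes> e" using e k(1) h(1) unfolding h(3) by (simp add: m_assoc)
    finally show ?thesis using k e by simp
  qed
  moreover have "l \<otimes> h = e"
  proof -
    have "l \<otimes> h = e \<otimes> k \<otimes> (e \<otimes> h)" using e k(1) h(1) unfolding l_def by (simp add: m_assoc)
    also have "\<dots> = e \<otimes> (k \<otimes> h)" using e k(1) h(1) unfolding h(2) by (simp add: m_assoc)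
    finally show ?thesis using k e by simp
  qed
  ultimately show ?thesis using l h H_class_idem_iff[OF assms(1), of l] by blast
qed

lemma H_class_mult:
  assumes "e \<in> idempotents G" "h \<in> H_class G e" "k \<in> H_class G e"
  shows "h \<otimes> k \<in> H_class G e"
proof -
  have e: "e \<in> carrier G" "e \<otimes> e = e" using assms by (auto simp: idempotents_def)
  obtain h' where h: "h \<in> carrier G" "e \<otimes> h = h" "h \<otimes> e = h" and
    h': "h' \<in> carrier G" "h \<otimes> h' = e" "h' \<otimes> h = e" "e \<otimes> h' = h'" "h' \<otimes> e = h'"
    using assms H_class_idem_iff[OF assms(1)] H_class_inverse[OF assms(1,2)] by metis
  obtain k' where k: "k \<in> carrier G" "e \<otimes> k = k" "k \<otimes> e = k" and
    k': "k' \<in> carrier G" "k \<otimes> k' = e" "k' \<otimes> k = e" "e \<otimes> k' = k'" "k' \<otimes> e = k'"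
    using assms H_class_idem_iff[OF assms(1)] H_class_inverse[OF assms(1,3)] by metis
  have "(h \<otimes> k) \<otimes> (k' \<otimes> h') = h \<otimes> (k \<otimes> k') \<otimes> h'" using h(1) h'(1) k(1) k'(1) by (simp add: m_assoc)
  then have 1: "(h \<otimes> k) \<otimes> (k' \<otimes> h') = e" using k' h h' by simp
  have "(k' \<otimes> h') \<otimes> (h \<otimes> k) = k' \<otimes> (h' \<otimes> h) \<otimes> k" using h(1) h'(1) k(1) k'(1) by (simp add: m_assoc)
  then have 2: "(k' \<otimes> h') \<otimes> (h \<otimes> k) = e" using k' k h' by simp
  have "e \<otimes> (h \<otimes> k) = h \<otimes> k" "(h \<otimes> k) \<otimes> e = h \<otimes> k"
    using e h k m_assoc by metis+
  then show ?thesis using 1 2 h(1) k(1) h'(1) k'(1) H_class_idem_iff[OF assms(1)] by blast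
qed

section \<open>Principal ideals and J-classes\<close>

lemma in_principal_ideal: "x \<in> carrier G \<Longrightarrow> x \<in> principal_ideal G x"
  unfolding principal_ideal_def by (auto intro!: exI[of _ \<one>])

lemma principal_ideal_subset:
  assumes "y \<in> carrier G" "x \<in> principal_ideal G y"
  shows "principal_ideal G x \<subseteq> principal_ideal G y"
proof
  fix z assume "z \<in> principal_ideal G x"
  then obtain a b where z: "a \<in> carrier G" "b \<in> carrier G" "z = a \<otimes> x \<otimes> b"
    by (auto simp: principal_ideal_def)
  obtain c d where x: "c \<in> carrier G" "d \<in> carrier G" "x = c \<otimes> y \<otimes> d"
    using assms by (auto simp: principal_ideal_def)
  have "z = (a \<otimes> c) \<otimes> y \<otimes> (d \<otimes> b)" using z x assms(1) by (simp add: m_assoc)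
  then show "z \<in> principal_ideal G y" using z x by (auto simp: principal_ideal_def)
qed

lemma principal_ideal_carrier: "x \<in> carrier G \<Longrightarrow> principal_ideal G x \<subseteq> carrier G"
  by (auto simp: principal_ideal_def)

lemma J_class_iff:
  assumes "x \<in> carrier G"
  shows "y \<in> J_class G x \<longleftrightarrow> y \<in> principal_ideal G x \<and> x \<in> principal_ideal G y \<and> y \<in> carrier G"
  using principal_ideal_subset[OF assms, of y] principal_ideal_subset[of y x]
    in_principal_ideal[of y] in_principal_ideal[OF assms]
  unfolding J_class_def by blast

lemma J_class_eq: "y \<in> J_class G x \<Longrightarrow> J_class G y = J_class G x"
  by (auto simp: J_class_def)

lemma H_class_subset_J_class:
  assumes "e \<in> idempotents G"
  shows "H_class G e \<subseteq> J_class G e"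
proof
  have e: "e \<in> carrier G" using assms by (auto simp: idempotents_def)
  fix h assume "h \<in> H_class G e"
  then obtain k where h: "h \<in> carrier G" "e \<otimes> h = h" and
    k: "k \<in> carrier G" "h \<otimes> k = e"
    using H_class_idem_iff[OF assms] by blast
  have "h = \<one> \<otimes> e \<otimes> h" "e = \<one> \<otimes> h \<otimes> k" using e h k by simp_all
  then show "h \<in> J_class G e" unfolding J_class_iff[OF e]
    unfolding principal_ideal_def using h k by blast
qed

lemma maximal_subgroups_in_J_class:
  assumes "x \<in> carrier G"
  shows "maximal_subgroups_in G (J_class G x) = {H_class G e | e. e \<in> idempotents G \<and> e \<in> J_class G x}"
  using idem_in_H_class H_class_subset_J_class J_class_eq
  unfolding maximal_subgroups_in_def by blast

text \<open>Left multiplication by \<open>y\<close> is injective on the finite local monoid of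
  \<open>e\<close>, hence onto, and the preimage of \<open>e\<close> must be
  \<open>x\<close>.\<close>

lemma finite_local_unit:
  assumes fin: "finite (carrier G)" and e: "e \<in> idempotents G"
    and x: "x \<in> carrier G" "e \<otimes> x = x" "x \<otimes> e = x"
    and y: "y \<in> carrier G" "e \<otimes> y = y" "y \<otimes> e = y" and xy: "x \<otimes> y = e"
  shows "y \<otimes> x = e"
proof -
  have ec: "e \<in> carrier G" "e \<otimes> e = e" using e by (auto simp: idempotents_def)
  define N where "N = {z \<in> carrier G. e \<otimes> z = z \<and> z \<otimes> e = z}"
  have xyz: "x \<otimes> (y \<otimes> z) = z" if "z \<in> N" for z
    using m_assoc[OF x(1) y(1), of z] that xy by (simp add: N_def)
  have "inj_on (\<lambda>z. y \<otimes> z) N"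
  proof (rule inj_onI)
    fix a b assume "a \<in> N" "b \<in> N" "y \<otimes> a = y \<otimes> b"
    then show "a = b" using xyz by metis
  qed
  moreover have "(\<lambda>z. y \<otimes> z) ` N \<subseteq> N"
  proof
    fix u assume "u \<in> (\<lambda>z. y \<otimes> z) ` N"
    then obtain z where z: "u = y \<otimes> z" "z \<in> carrier G" "z \<otimes> e = z" by (auto simp: N_def)
    then have "e \<otimes> u = u" "u \<otimes> e = u"
      using m_assoc[OF ec(1) y(1), of z] m_assoc[OF y(1) _ ec(1), of z] y by simp_all
    then show "u \<in> N" using z y(1) by (simp add: N_def)
  qed
  moreover have "finite N" using fin by (simp add: N_def)
  ultimately have "(\<lambda>z. y \<otimes> z) ` N = N" by (intro endo_inj_surj)
  moreover have "e \<in> N" using ec by (simp add: N_def)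
  ultimately obtain z where z: "z \<in> N" "y \<otimes> z = e" by (metis imageE)
  then have "x = z" using xyz[OF z(1)] x by simp
  then show ?thesis using z by simp
qed

text \<open>If \<open>e = a f b\<close>, then \<open>p = e a f\<close> and \<open>q = f b e\<close> satisfy \<open>p q = e\<close>, and finiteness forces
  \<open>q p = f\<close>; conjugation by \<open>p\<close> and \<open>q\<close> exchanges the two maximal subgroups.\<close>

lemma finite_J_idem_conj:
  assumes fin: "finite (carrier G)" and e: "e \<in> idempotents G" and f: "f \<in> idempotents G"
    and ef: "e \<in> principal_ideal G f" and fe: "f \<in> principal_ideal G e"
  obtains p q where "p \<in> carrier G" "q \<in> carrier G" "p \<otimes> q = e" "q \<otimes> p = f"
    "e \<otimes> p = p" "p \<otimes> f = p" "f \<otimes> q = q" "q \<otimes> e = q"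
proof -
  have ec: "e \<in> carrier G" "e \<otimes> e = e" and fc: "f \<in> carrier G" "f \<otimes> f = f"
    using e f by (auto simp: idempotents_def)
  obtain a b where ab: "a \<in> carrier G" "b \<in> carrier G" "e = a \<otimes> f \<otimes> b"
    using ef by (auto simp: principal_ideal_def)
  obtain c d where cd: "c \<in> carrier G" "d \<in> carrier G" "f = c \<otimes> e \<otimes> d"
    using fe by (auto simp: principal_ideal_def)
  define p where "p = e \<otimes> a \<otimes> f"
  define q where "q = f \<otimes> b \<otimes> e"
  have pc: "p \<in> carrier G" and qc: "q \<in> carrier G" using ec(1) fc(1) ab(1,2) by (simp_all add: p_def q_def)
  have ep: "e \<otimes> p = p"
  proof -
    have "e \<otimes> p = (e \<otimes> e) \<otimes> a \<otimes> f" using ec(1) fc(1) ab(1) unfolding p_def by (simp add: m_assoc)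
    then show ?thesis using ec(2) p_def by simp
  qed
  have pf: "p \<otimes> f = p" using ec(1) fc ab(1) unfolding p_def by (simp add: m_assoc)
  have fq: "f \<otimes> q = q"
  proof -
    have "f \<otimes> q = (f \<otimes> f) \<otimes> b \<otimes> e" using ec(1) fc(1) ab(2) unfolding q_def by (simp add: m_assoc)
    then show ?thesis using fc(2) q_def by simp
  qed
  have qe: "q \<otimes> e = q" using ec fc(1) ab(2) unfolding q_def by (simp add: m_assoc)
  have pq: "p \<otimes> q = e"
  proof -
    have "p \<otimes> q = e \<otimes> (a \<otimes> (f \<otimes> f) \<otimes> b) \<otimes> e"
      using ec(1) fc(1) ab(1,2) unfolding p_def q_def by (simp add: m_assoc)
    also have "\<dots> = e \<otimes> e \<otimes> e" using fc(2) ab(3) by simp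
    finally show ?thesis using ec by simp
  qed
  \<comment> \<open>With \<open>e = p q\<close>, the identity \<open>f = c e d\<close> becomes
    \<open>x y = f\<close> inside the local monoid of \<open>f\<close>, where
    \<open>finite_local_unit\<close> allows the factors to be exchanged.\<close>
  define x where "x = f \<otimes> c \<otimes> p"
  define y where "y = q \<otimes> d \<otimes> f"
  have xc: "x \<in> carrier G" and yc: "y \<in> carrier G" using pc qc fc(1) cd(1,2) by (simp_all add: x_def y_def)
  have fx: "f \<otimes> x = x"
  proof -
    have "f \<otimes> x = (f \<otimes> f) \<otimes> c \<otimes> p" using pc fc(1) cd(1) unfolding x_def by (simp add: m_assoc)
    then show ?thesis using fc(2) x_def by simp
  qed
  have xf: "x \<otimes> f = x" using pc fc(1) cd(1) pf unfolding x_def by (simp add: m_assoc)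
  have fy: "f \<otimes> y = y"
  proof -
    have "f \<otimes> y = (f \<otimes> q) \<otimes> d \<otimes> f" using qc fc(1) cd(2) unfolding y_def by (simp add: m_assoc)
    then show ?thesis using fq y_def by simp
  qed
  have yf: "y \<otimes> f = y" using qc fc cd(2) unfolding y_def by (simp add: m_assoc)
  have "x \<otimes> y = f \<otimes> (c \<otimes> (p \<otimes> q) \<otimes> d) \<otimes> f"
    using pc qc fc(1) cd(1,2) unfolding x_def y_def by (simp add: m_assoc)
  also have "\<dots> = f" using pq cd(3) fc by simp
  finally have xy: "x \<otimes> y = f" .
  have yx: "y \<otimes> x = f" by (rule finite_local_unit[OF fin f xc fx xf yc fy yf xy])
  \<comment> \<open>The element \<open>q p\<close> fixes \<open>y\<close> from the left, and
    \<open>y\<close> is invertible in the local monoid of \<open>f\<close>; hence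
    \<open>q p = f\<close>.\<close>
  have "q \<otimes> p \<otimes> y = q \<otimes> (p \<otimes> q) \<otimes> d \<otimes> f"
    using pc qc fc(1) cd(2) unfolding y_def by (simp add: m_assoc)
  also have "\<dots> = y" using pq qe y_def by simp
  finally have qpy: "q \<otimes> p \<otimes> y = y" .
  have "q \<otimes> p = q \<otimes> p \<otimes> (y \<otimes> x)" using yx pf pc qc fc(1) by (simp add: m_assoc)
  also have "\<dots> = (q \<otimes> p \<otimes> y) \<otimes> x" using pc qc yc xc by (simp add: m_assoc)
  finally have "q \<otimes> p = f" using qpy yx by simp
  then show ?thesis using that pc qc pq ep pf fq qe by blast
qed

lemma finite_J_idem_iso:
  assumes fin: "finite (carrier G)" and e: "e \<in> idempotents G" and f: "f \<in> idempotents G"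
    and ef: "e \<in> principal_ideal G f" and fe: "f \<in> principal_ideal G e"
  shows "G\<lparr>carrier := H_class G e, one := e\<rparr> \<cong> G\<lparr>carrier := H_class G f, one := f\<rparr>"
proof -
  have **: "q \<otimes> h \<otimes> p \<in> H_class G f" "p \<otimes> (q \<otimes> h \<otimes> p) \<otimes> q = h"
    if e: "e \<in> idempotents G" and f: "f \<in> idempotents G"
    and pc: "p \<in> carrier G" and qc: "q \<in> carrier G" and pq: "p \<otimes> q = e" and qp: "q \<otimes> p = f"
    and pf: "p \<otimes> f = p" and fq: "f \<otimes> q = q"
    and h: "h \<in> H_class G e" for e f p q h
  proof -
    have ec: "e \<in> carrier G" and fc: "f \<in> carrier G" using e f by (auto simp: idempotents_def)
    obtain k where hc: "h \<in> carrier G" "e \<otimes> h = h" "h \<otimes> e = h" and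
      k: "k \<in> carrier G" "h \<otimes> k = e" "k \<otimes> h = e" "e \<otimes> k = k" "k \<otimes> e = k"
      using H_class_inverse[OF e h] h H_class_idem_iff[OF e] by metis
    have inv: "(q \<otimes> a \<otimes> p) \<otimes> (q \<otimes> b \<otimes> p) = f"
      if "a \<in> carrier G" "b \<in> carrier G" "a \<otimes> e = a" "a \<otimes> b = e" for a b
    proof -
      have "(q \<otimes> a \<otimes> p) \<otimes> (q \<otimes> b \<otimes> p) = q \<otimes> (a \<otimes> (p \<otimes> q) \<otimes> b) \<otimes> p"
        using that(1,2) pc qc by (simp add: m_assoc)
      also have "\<dots> = q \<otimes> (p \<otimes> q) \<otimes> p" using that pq by simp
      also have "\<dots> = f \<otimes> (q \<otimes> p)" using pc qc fc qp by (metis m_assoc m_closed)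
      also have "\<dots> = f" using qp f by (simp add: idempotents_def)
      finally show ?thesis .
    qed
    have "f \<otimes> (q \<otimes> h \<otimes> p) = (f \<otimes> q) \<otimes> h \<otimes> p" using pc qc fc hc(1) by (simp add: m_assoc)
    then have l: "f \<otimes> (q \<otimes> h \<otimes> p) = q \<otimes> h \<otimes> p" using fq by simp
    have r: "(q \<otimes> h \<otimes> p) \<otimes> f = q \<otimes> h \<otimes> p" using pc qc fc hc(1) pf by (simp add: m_assoc)
    have "q \<otimes> h \<otimes> p \<in> carrier G" "q \<otimes> k \<otimes> p \<in> carrier G" using pc qc hc(1) k(1) by simp_all
    then show "q \<otimes> h \<otimes> p \<in> H_class G f"
      using l r inv[of h k] inv[of k h] hc k unfolding H_class_idem_iff[OF f] by blast
    have "p \<otimes> (q \<otimes> h \<otimes> p) \<otimes> q = (p \<otimes> q) \<otimes> h \<otimes> (p \<otimes> q)" using pc qc hc(1) by (simp add: m_assoc)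
    then show "p \<otimes> (q \<otimes> h \<otimes> p) \<otimes> q = h" using pq hc by simp
  qed
  obtain p q where pq: "p \<in> carrier G" "q \<in> carrier G" "p \<otimes> q = e" "q \<otimes> p = f"
    "e \<otimes> p = p" "p \<otimes> f = p" "f \<otimes> q = q" "q \<otimes> e = q"
    using finite_J_idem_conj[OF assms] by blast
  note A = **[OF e f pq(1-4,6,7)]
  note B = **[OF f e pq(2,1,4,3,8,5)]
  have "bij_betw (\<lambda>h. q \<otimes> h \<otimes> p) (H_class G e) (H_class G f)"
    by (rule bij_betw_byWitness[where f' = "\<lambda>h. p \<otimes> h \<otimes> q"]) (use A B in blast)+
  moreover have "q \<otimes> (h \<otimes> k) \<otimes> p = (q \<otimes> h \<otimes> p) \<otimes> (q \<otimes> k \<otimes> p)"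
    if "h \<in> H_class G e" "k \<in> H_class G e" for h k
  proof -
    have hk: "h \<in> carrier G" "h \<otimes> e = h" "k \<in> carrier G" using that H_class_idem_iff[OF e] by blast+
    then have "(q \<otimes> h \<otimes> p) \<otimes> (q \<otimes> k \<otimes> p) = q \<otimes> (h \<otimes> (p \<otimes> q) \<otimes> k) \<otimes> p"
      using pq(1,2) by (simp add: m_assoc)
    then show ?thesis using pq(3) hk by simp
  qed
  ultimately have "(\<lambda>h. q \<otimes> h \<otimes> p) \<in> iso (G\<lparr>carrier := H_class G e, one := e\<rparr>)
      (G\<lparr>carrier := H_class G f, one := f\<rparr>)"
    using A(1) by (auto simp: iso_def hom_def)
  then show ?thesis unfolding is_iso_def by blast
qed

text \<open>An ideal of smallest cardinality is least: a product of an element of one ideal with an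
  element of another lies in both, so the intersection of two ideals is an ideal.\<close>

lemma minimum_ideal_least:
  assumes fin: "finite (carrier G)"
  shows "monoid_ideal G (minimum_ideal G)"
    and "monoid_ideal G I \<Longrightarrow> minimum_ideal G \<subseteq> I"
proof -
  have "monoid_ideal G (carrier G)" by (auto simp: monoid_ideal_def)
  then obtain I0 where I0: "monoid_ideal G I0" "\<And>I. monoid_ideal G I \<Longrightarrow> card I0 \<le> card I"
    using ex_has_least_nat[of "monoid_ideal G" _ card] by blast
  have least: "I0 \<subseteq> I" if I: "monoid_ideal G I" for I
  proof -
    obtain x y where "x \<in> I0" "y \<in> I" using I I0(1) by (auto simp: monoid_ideal_def)
    then have "x \<otimes> y \<in> I0 \<inter> I" using I I0(1) unfolding monoid_ideal_def by blast
    then have "monoid_ideal G (I0 \<inter> I)" using I I0(1) unfolding monoid_ideal_def by blast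
    then have "card I0 \<le> card (I0 \<inter> I)" by (rule I0(2))
    moreover have "finite I0" using I0(1) fin unfolding monoid_ideal_def by (meson finite_subset)
    ultimately have "I0 \<inter> I = I0" by (intro card_seteq) auto
    then show ?thesis by blast
  qed
  have "minimum_ideal G = I0" unfolding minimum_ideal_def
    by (rule Least_equality) (use I0 least in auto)
  then show "monoid_ideal G (minimum_ideal G)" "monoid_ideal G I \<Longrightarrow> minimum_ideal G \<subseteq> I"
    using I0 least by auto
qed

lemma principal_ideal_ideal:
  assumes "x \<in> carrier G"
  shows "monoid_ideal G (principal_ideal G x)"
proof -
  have "c \<otimes> (a \<otimes> x \<otimes> b) = (c \<otimes> a) \<otimes> x \<otimes> b" "(a \<otimes> x \<otimes> b) \<otimes> c = a \<otimes> x \<otimes> (b \<otimes> c)"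
    if "a \<in> carrier G" "b \<in> carrier G" "c \<in> carrier G" for a b c
    using that assms by (simp_all add: m_assoc)
  then show ?thesis
    using in_principal_ideal[OF assms] principal_ideal_carrier[OF assms]
    unfolding monoid_ideal_def principal_ideal_def by (auto; metis m_closed)
qed

lemma minimum_ideal_J:
  assumes "finite (carrier G)" "x \<in> minimum_ideal G" "y \<in> carrier G"
  shows "x \<in> principal_ideal G y"
  using minimum_ideal_least(2)[OF assms(1) principal_ideal_ideal[OF assms(3)]] assms(2) by blast

text \<open>For \<open>x\<close> in the minimum ideal, \<open>e x e\<close> is there too and is
  invertible in the local monoid of \<open>e\<close>; so \<open>e\<close> is there, and with it
  every \<open>h = e h\<close>.\<close>

lemma local_group_minimum:
  assumes fin: "finite (carrier G)" and e: "e \<in> idempotents G"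
    and grp: "\<And>x. x \<in> carrier G \<Longrightarrow> e \<otimes> x \<otimes> e \<in> H_class G e"
  shows "H_class G e \<subseteq> minimum_ideal G"
proof -
  have ec: "e \<in> carrier G" "e \<otimes> e = e" using e by (auto simp: idempotents_def)
  note I = minimum_ideal_least(1)[OF fin]
  then obtain x where x: "x \<in> minimum_ideal G" "x \<in> carrier G" by (auto simp: monoid_ideal_def)
  then have 1: "e \<otimes> x \<otimes> e \<in> minimum_ideal G" using I ec(1) by (simp add: monoid_ideal_def)
  obtain k where "k \<in> carrier G" "e \<otimes> x \<otimes> e \<otimes> k = e"
    using grp[OF x(2)] H_class_idem_iff[OF e] by blast
  then have "e \<in> minimum_ideal G" using 1 I unfolding monoid_ideal_def by metis
  moreover have "h = e \<otimes> h" "h \<in> carrier G" if "h \<in> H_class G e" for h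
    using that H_class_idem_iff[OF e] by metis+
  ultimately show ?thesis using I unfolding monoid_ideal_def by (metis subsetI)
qed

end

section \<open>Images of Green classes under homomorphisms, and the group of a class\<close>

lemma hom_H_class:
  assumes "monoid P" "monoid M" "h \<in> hom P M" "e \<in> idempotents P"
  shows "h e \<in> idempotents M" "h ` H_class P e \<subseteq> H_class M (h e)"
proof -
  show e': "h e \<in> idempotents M"
    using assms(3,4) unfolding idempotents_def hom_def by (auto simp: Pi_iff) (metis)
  show "h ` H_class P e \<subseteq> H_class M (h e)"
  proof
    fix y assume "y \<in> h ` H_class P e"
    then obtain x k where x: "y = h x" "x \<in> carrier P" "e \<otimes>\<^bsub>P\<^esub> x = x" "x \<otimes>\<^bsub>P\<^esub> e = x"
      "k \<in> carrier P" "x \<otimes>\<^bsub>P\<^esub> k = e" "k \<otimes>\<^bsub>P\<^esub> x = e"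
      using monoid.H_class_idem_iff[OF assms(1,4)] by blast
    have ec: "e \<in> carrier P" using assms(4) by (simp add: idempotents_def)
    have m: "\<And>a b. a \<in> carrier P \<Longrightarrow> b \<in> carrier P \<Longrightarrow> h (a \<otimes>\<^bsub>P\<^esub> b) = h a \<otimes>\<^bsub>M\<^esub> h b"
      and c: "\<And>a. a \<in> carrier P \<Longrightarrow> h a \<in> carrier M" using assms(3) by (auto simp: hom_def)
    show "y \<in> H_class M (h e)"
      unfolding monoid.H_class_idem_iff[OF assms(2) e'] x(1)
      using m[OF ec x(2)] m[OF x(2) ec] m[OF x(2,5)] m[OF x(5,2)] x c by metis
  qed
qed

lemma hom_J_class:
  assumes "monoid P" "monoid M" "h \<in> hom P M" "x \<in> carrier P"
  shows "h ` J_class P x \<subseteq> J_class M (h x)"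
proof -
  have m: "\<And>a b. a \<in> carrier P \<Longrightarrow> b \<in> carrier P \<Longrightarrow> h (a \<otimes>\<^bsub>P\<^esub> b) = h a \<otimes>\<^bsub>M\<^esub> h b"
    and c: "\<And>a. a \<in> carrier P \<Longrightarrow> h a \<in> carrier M" using assms(3) by (auto simp: hom_def)
  have *: "h u \<in> principal_ideal M (h v)" if uv: "u \<in> principal_ideal P v" "v \<in> carrier P" for u v
  proof -
    obtain a b where ab: "a \<in> carrier P" "b \<in> carrier P" "u = a \<otimes>\<^bsub>P\<^esub> v \<otimes>\<^bsub>P\<^esub> b"
      using uv by (auto simp: principal_ideal_def)
    have "a \<otimes>\<^bsub>P\<^esub> v \<in> carrier P" using ab uv monoid.m_closed[OF assms(1)] by blast
    then have "h u = h a \<otimes>\<^bsub>M\<^esub> h v \<otimes>\<^bsub>M\<^esub> h b" using ab uv m by simp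
    then show ?thesis using ab c unfolding principal_ideal_def by blast
  qed
  show ?thesis
    unfolding subset_iff image_iff
    using monoid.J_class_iff[OF assms(1,4)] monoid.J_class_iff[OF assms(2) c[OF assms(4)]] * c assms(4)
    by blast
qed

text \<open>Makes the result independent of the chosen idempotent. The hypothesis on D, that its
  elements divide one another, covers both a J-class and the minimum ideal.\<close>

lemma schuetzenberger_group_iso:
  assumes M: "monoid M" "finite (carrier M)" and e: "e \<in> idempotents M" "e \<in> D"
    and D: "\<And>f g. f \<in> D \<Longrightarrow> g \<in> D \<Longrightarrow> f \<in> principal_ideal M g"
  shows "M\<lparr>carrier := H_class M e, one := e\<rparr> \<cong> schuetzenberger_group M D"
    and "schuetzenberger_group M D \<cong> M\<lparr>carrier := H_class M e, one := e\<rparr>"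
    and "order (schuetzenberger_group M D) = card (H_class M e)"
proof -
  define f where "f = (SOME e. e \<in> idempotents M \<and> e \<in> D)"
  have f: "f \<in> idempotents M \<and> f \<in> D" unfolding f_def by (rule someI[of _ e]) (use e in blast)
  have s: "schuetzenberger_group M D = M\<lparr>carrier := H_class M f, one := f\<rparr>"
    by (simp add: schuetzenberger_group_def f_def Let_def)
  have f1: "f \<in> idempotents M" "f \<in> D" using f by blast+
  show 1: "M\<lparr>carrier := H_class M e, one := e\<rparr> \<cong> schuetzenberger_group M D" unfolding s
    by (rule monoid.finite_J_idem_iso[OF M e(1) f1(1) D[OF e(2) f1(2)] D[OF f1(2) e(2)]])
  show "schuetzenberger_group M D \<cong> M\<lparr>carrier := H_class M e, one := e\<rparr>" unfolding s
    by (rule monoid.finite_J_idem_iso[OF M f1(1) e(1) D[OF f1(2) e(2)] D[OF e(2) f1(2)]])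
  show "order (schuetzenberger_group M D) = card (H_class M e)"
    using 1 bij_betw_same_card unfolding is_iso_def iso_def order_def by fastforce
qed

section \<open>Finite congruences\<close>

lemma finite_range_factor:
  assumes "finite (range g)" "\<And>u v. g u = g v \<Longrightarrow> h u = h v"
  shows "finite (range h)"
proof -
  have "h u = h (inv_into UNIV g (g u))" for u by (rule assms(2)) (simp add: f_inv_into_f)
  then have "range h \<subseteq> (\<lambda>s. h (inv_into UNIV g s)) ` range g" by blast
  then show ?thesis using assms(1) finite_surj by blast
qed

text \<open>\<open>f\<close> is the state map of a finite automaton: \<open>step\<close> makes its
  transitions well defined, \<open>rec\<close> its acceptance. Words inducing the same transition
  map \<open>g\<close> are syntactically congruent.\<close>

lemma right_congruence_finite:
  assumes fin: "finite (range f)"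
    and step: "\<And>u v a. f u = f v \<Longrightarrow> f (u @ [a]) = f (v @ [a])"
    and rec: "\<And>u v. f u = f v \<Longrightarrow> u \<in> L \<Longrightarrow> v \<in> L"
  shows "syntactic_congruence L \<in> finite_congruences"
proof -
  have ext: "f (u @ w) = f (v @ w)" if "f u = f v" for u v w
    using that
  proof (induction w arbitrary: u v)
    case (Cons a w)
    then show ?case using Cons.IH[OF step[OF Cons.prems], of a] by simp
  qed simp
  define g where "g u = (\<lambda>s\<in>range f. f (inv_into UNIV f s @ u))" for u
  have "range g \<subseteq> range f \<rightarrow>\<^sub>E range f" by (auto simp: g_def)
  then have "finite (range g)" using fin by (meson finite_PiE finite_subset)
  moreover have "syntactic_congruence L `` {u} = syntactic_congruence L `` {v}" if "g u = g v" for u v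
  proof -
    have "f (x @ u) = f (x @ v)" for x
    proof -
      have "f (inv_into UNIV f (f x)) = f x" by (simp add: f_inv_into_f)
      then have "f (x @ w) = f (inv_into UNIV f (f x) @ w)" for w using ext by metis
      then show ?thesis using fun_cong[OF that, of "f x"] by (simp add: g_def)
    qed
    then have "f (x @ u @ y) = f (x @ v @ y)" for x y using ext by (metis append_assoc)
    then have "x @ u @ y \<in> L \<longleftrightarrow> x @ v @ y \<in> L" for x y
      using rec[of "x @ u @ y" "x @ v @ y"] rec[of "x @ v @ y" "x @ u @ y"] by auto
    then show ?thesis by (auto simp: syntactic_congruence_def)
  qed
  ultimately have "finite (range (\<lambda>u. syntactic_congruence L `` {u}))"
    by (rule finite_range_factor)
  moreover have "UNIV // syntactic_congruence L = range (\<lambda>u. syntactic_congruence L `` {u})"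
    by (auto simp: quotient_def)
  ultimately show ?thesis
    using syntactic_congruence_congruence by (auto simp: finite_congruences_def)
qed

lemma class_eq_iff:
  assumes "\<theta> \<in> finite_congruences"
  shows "\<theta> `` {u} = \<theta> `` {v} \<longleftrightarrow> (u, v) \<in> \<theta>"
  using assms eq_equiv_class_iff[of UNIV \<theta> u v] by (auto simp: finite_congruences_def word_congruence_def)

lemma finite_congruence_refl: "\<theta> \<in> finite_congruences \<Longrightarrow> (u, u) \<in> \<theta>"
  using class_eq_iff by blast

lemma finite_congruence_append:
  "\<theta> \<in> finite_congruences \<Longrightarrow> (u, u') \<in> \<theta> \<Longrightarrow> (v, v') \<in> \<theta> \<Longrightarrow> (u @ v, u' @ v') \<in> \<theta>"
  unfolding finite_congruences_def word_congruence_def by blast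

lemma syntactic_congruenceD: "(u, v) \<in> syntactic_congruence L \<Longrightarrow> u \<in> L \<longleftrightarrow> v \<in> L"
  unfolding syntactic_congruence_def
  by (metis (mono_tags, lifting) append_Nil append_Nil2 case_prodD mem_Collect_eq)

lemma finite_congruence_range:
  "\<theta> \<in> finite_congruences \<Longrightarrow> finite (range (\<lambda>u. \<theta> `` {u}))"
  by (rule finite_subset[of _ "UNIV // \<theta>"]) (auto simp: finite_congruences_def quotientI)

lemma saturated_finite:
  assumes "\<theta> \<in> finite_congruences" "\<And>u v. (u, v) \<in> \<theta> \<Longrightarrow> u \<in> L \<Longrightarrow> v \<in> L"
  shows "syntactic_congruence L \<in> finite_congruences"
proof (rule right_congruence_finite[of "\<lambda>u. \<theta> `` {u}"])
  fix u v a assume "\<theta> `` {u} = \<theta> `` {v}"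
  then show "\<theta> `` {u @ [a]} = \<theta> `` {v @ [a]}"
    unfolding class_eq_iff[OF assms(1)]
    using finite_congruence_append[OF assms(1) _ finite_congruence_refl[OF assms(1)]] by blast
qed (use assms finite_congruence_range class_eq_iff[OF assms(1)] in blast)+

text \<open>A subset construction. The state records the class of the word read modulo K and, in
  \<open>S u\<close>, the classes modulo L of all suffixes remaining after a prefix in K.\<close>

lemma concat_finite:
  assumes K: "syntactic_congruence K \<in> finite_congruences"
    and L: "syntactic_congruence L \<in> finite_congruences"
  shows "syntactic_congruence (K @@ L) \<in> finite_congruences"
proof -
  let ?k = "\<lambda>u. syntactic_congruence K `` {u}" and ?l = "\<lambda>u. syntactic_congruence L `` {u}"
  define S where "S u = {?l s | s p. u = p @ s \<and> p \<in> K}" for u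
  have le: "?l (s @ [a]) = ?l (s' @ [a])" if "?l s = ?l s'" for s s' a
    using that unfolding class_eq_iff[OF L]
    using finite_congruence_append[OF L _ finite_congruence_refl[OF L]] by blast
  have ke: "?k (s @ [a]) = ?k (s' @ [a])" if "?k s = ?k s'" for s s' a
    using that unfolding class_eq_iff[OF K]
    using finite_congruence_append[OF K _ finite_congruence_refl[OF K]] by blast
  have inK: "s \<in> K \<longleftrightarrow> s' \<in> K" if "?k s = ?k s'" for s s'
    using that unfolding class_eq_iff[OF K] by (rule syntactic_congruenceD)
  have inL: "s \<in> L \<longleftrightarrow> s' \<in> L" if "?l s = ?l s'" for s s'
    using that unfolding class_eq_iff[OF L] by (rule syntactic_congruenceD)
  have sub: "S (u @ [a]) \<subseteq> S (v @ [a])" if e: "?k u = ?k v" "S u = S v" for u v a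
  proof
    fix c assume "c \<in> S (u @ [a])"
    then obtain p s where c: "c = ?l s" "u @ [a] = p @ s" "p \<in> K" by (auto simp: S_def)
    show "c \<in> S (v @ [a])"
    proof (cases s rule: rev_cases)
      case Nil
      then have "u @ [a] \<in> K" using c by simp
      then have "v @ [a] \<in> K" using inK[OF ke[OF e(1), of a]] by blast
      then show ?thesis using c(1) Nil by (force simp: S_def)
    next
      case (snoc s' b)
      then have "?l s' \<in> S v" unfolding e(2)[symmetric] using c by (auto simp: S_def)
      then obtain p' t where t: "?l s' = ?l t" "v = p' @ t" "p' \<in> K" by (auto simp: S_def)
      have "c = ?l (t @ [a])" using le[OF t(1)] c snoc by auto
      moreover have "v @ [a] = p' @ (t @ [a])" using t(2) by simp
      ultimately show ?thesis using t(3) unfolding S_def by blast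
    qed
  qed
  have recog: "u \<in> K @@ L \<longleftrightarrow> (\<exists>s\<in>L. ?l s \<in> S u)" for u
    using inL unfolding S_def lang_conc_def by blast
  show ?thesis
  proof (rule right_congruence_finite[of "\<lambda>u. (?k u, S u)"])
    have "range (\<lambda>u. (?k u, S u)) \<subseteq> range ?k \<times> Pow (range ?l)" by (auto simp: S_def)
    then show "finite (range (\<lambda>u. (?k u, S u)))"
      using finite_congruence_range[OF K] finite_congruence_range[OF L]
      by (meson finite_Pow_iff finite_SigmaI finite_subset)
    show "(?k (u @ [a]), S (u @ [a])) = (?k (v @ [a]), S (v @ [a]))" if "(?k u, S u) = (?k v, S v)" for u v a
    proof -
      have "?k u = ?k v" "S u = S v" using that by auto
      then show ?thesis using ke[of u v a] sub[of u v a] sub[of v u a] by auto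
    qed
    show "v \<in> K @@ L" if "(?k u, S u) = (?k v, S v)" "u \<in> K @@ L" for u v
      using that unfolding recog by auto
  qed
qed

text \<open>As for products, with \<open>S u\<close> collecting the classes modulo K of the suffixes
  remaining after a prefix in the star. The flag \<open>u = []\<close> records the one element of
  the star that has no last factor.\<close>

lemma star_finite:
  assumes K: "syntactic_congruence K \<in> finite_congruences" and ne: "[] \<notin> K"
  shows "syntactic_congruence (lang_star K) \<in> finite_congruences"
proof -
  let ?k = "\<lambda>u. syntactic_congruence K `` {u}"
  define S where "S u = {?k s | s p. u = p @ s \<and> p \<in> lang_star K}" for u
  have ke: "?k (s @ [a]) = ?k (s' @ [a])" if "?k s = ?k s'" for s s' a
    using that unfolding class_eq_iff[OF K]
    using finite_congruence_append[OF K _ finite_congruence_refl[OF K]] by blast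
  have inK: "s \<in> K \<longleftrightarrow> s' \<in> K" if "?k s = ?k s'" for s s'
    using that unfolding class_eq_iff[OF K] by (rule syntactic_congruenceD)
  have recog: "u \<in> lang_star K \<longleftrightarrow> u = [] \<or> (\<exists>s\<in>K. ?k s \<in> S u)" for u
  proof
    assume u: "u \<in> lang_star K"
    show "u = [] \<or> (\<exists>s\<in>K. ?k s \<in> S u)"
    proof (cases "u = []")
      case False
      then obtain p s where "u = p @ s" "p \<in> lang_star K" "s \<in> K" using last_block[OF u _ ne] by blast
      then show ?thesis by (auto simp: S_def)
    qed simp
  next
    assume "u = [] \<or> (\<exists>s\<in>K. ?k s \<in> S u)"
    then show "u \<in> lang_star K"
    proof
      assume "\<exists>s\<in>K. ?k s \<in> S u"
      then obtain p s where "u = p @ s" "p \<in> lang_star K" "s \<in> K" using inK unfolding S_def by blast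
      then show ?thesis using star_append star_base by blast
    qed (simp add: star_Nil)
  qed
  have sub: "S (u @ [a]) \<subseteq> S (v @ [a])" if e: "S u = S v" for u v a
  proof
    fix c assume "c \<in> S (u @ [a])"
    then obtain p s where c: "c = ?k s" "u @ [a] = p @ s" "p \<in> lang_star K" by (auto simp: S_def)
    show "c \<in> S (v @ [a])"
    proof (cases s rule: rev_cases)
      case Nil
      then have "u @ [a] \<in> lang_star K" using c by simp
      \<comment> \<open>Without its last letter, the last factor of \<open>u a\<close> is a suffix
        of \<open>u\<close> already recorded in \<open>S u\<close>, and can be exchanged for a
        suffix of \<open>v\<close>.\<close>
      then obtain q y where y: "u @ [a] = q @ y" "q \<in> lang_star K" "y \<in> K"
        using last_block[OF _ _ ne] by blast
      obtain y' where y': "y = y' @ [a]" "u = q @ y'" using y ne by (cases y rule: rev_cases) auto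
      then have "?k y' \<in> S v" unfolding e[symmetric] using y by (auto simp: S_def)
      then obtain p' t where t: "?k y' = ?k t" "v = p' @ t" "p' \<in> lang_star K" by (auto simp: S_def)
      have "t @ [a] \<in> K" using inK[OF ke[OF t(1)]] y y' by blast
      then have "v @ [a] \<in> lang_star K" using t star_append star_base by fastforce
      then show ?thesis using c(1) Nil by (force simp: S_def)
    next
      case (snoc s' b)
      then have "?k s' \<in> S v" unfolding e[symmetric] using c by (auto simp: S_def)
      then obtain p' t where t: "?k s' = ?k t" "v = p' @ t" "p' \<in> lang_star K" by (auto simp: S_def)
      have "c = ?k (t @ [a])" using ke[OF t(1)] c snoc by auto
      moreover have "v @ [a] = p' @ (t @ [a])" using t(2) by simp
      ultimately show ?thesis using t(3) unfolding S_def by blast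
    qed
  qed
  show ?thesis
  proof (rule right_congruence_finite[of "\<lambda>u. (u = [], S u)"])
    have "range (\<lambda>u. (u = [], S u)) \<subseteq> UNIV \<times> Pow (range ?k)" by (auto simp: S_def)
    then show "finite (range (\<lambda>u. (u = [], S u)))"
      using finite_congruence_range[OF K] by (meson finite finite_Pow_iff finite_SigmaI finite_subset)
    show "(u @ [a] = [], S (u @ [a])) = (v @ [a] = [], S (v @ [a]))" if "(u = [], S u) = (v = [], S v)" for u v a
    proof -
      have "S u = S v" using that by auto
      then show ?thesis using sub[of u v a] sub[of v u a] by auto
    qed
    show "v \<in> lang_star K" if "(u = [], S u) = (v = [], S v)" "u \<in> lang_star K" for u v
      using that unfolding recog by auto
  qed
qed

lemma UNIV_finite: "syntactic_congruence UNIV \<in> finite_congruences"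
  by (rule right_congruence_finite[of "\<lambda>_. ()"]) auto

text \<open>The first \<open>length w + 1\<close> letters separate \<open>w\<close> from all other
  words, the extra letter detecting proper extensions; such truncations are finitely many because
  the alphabet is finite.\<close>

lemma singleton_finite: "syntactic_congruence {w :: 'a::finite list} \<in> finite_congruences"
proof (rule right_congruence_finite[of "take (Suc (length w))"])
  have "range (take (Suc (length w))) \<subseteq> {u :: 'a list. set u \<subseteq> UNIV \<and> length u \<le> Suc (length w)}" by auto
  then show "finite (range (take (Suc (length w)) :: 'a list \<Rightarrow> 'a list))"
    by (rule finite_subset) (rule finite_lists_length_le, simp)
  show "v \<in> {w}" if "take (Suc (length w)) u = take (Suc (length w)) v" "u \<in> {w}" for u v
  proof -
    have "take (Suc (length w)) v = w" using that by simp
    then have "length (take (Suc (length w)) v) = length w" by simp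
    then have "length v = length w" by (simp add: min_def split: if_splits)
    then show ?thesis using \<open>take (Suc (length w)) v = w\<close> by simp
  qed
  show "take (Suc (length w)) (u @ [a]) = take (Suc (length w)) (v @ [a])"
    if t: "take (Suc (length w)) u = take (Suc (length w)) v" for u v and a :: 'a
  proof -
    have *: "take n (x @ [a]) = take n (take n x @ [a])" for n and x :: "'a list"
      by (cases "n \<le> length x") auto
    show ?thesis using *[of "Suc (length w)" u] *[of "Suc (length w)" v] t by simp
  qed
qed

section \<open>The free profinite monoid and the class J(F)\<close>

abbreviation "pmon \<equiv> free_profinite_monoid"

lemma carrier_pmon [simp]: "carrier pmon = profinite_carrier"
  by (simp add: free_profinite_monoid_def)

lemmas pmon_closed [simp] = free_profinite_mult_closed

lemmas pmon_pow_closed [simp] =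
  monoid.nat_pow_closed[OF free_profinite_monoid_monoid, unfolded carrier_pmon]

lemmas pmon_assoc = monoid.m_assoc[OF free_profinite_monoid_monoid, unfolded carrier_pmon]

lemma profinite_rep:
  assumes "x \<in> profinite_carrier" "\<theta> \<in> finite_congruences"
  obtains u where "x \<theta> = \<theta> `` {u}"
  using profinite_class[OF assms] by (auto elim: quotientE)

text \<open>Lets several conditions be read off a single word: \<open>x\<close> is represented at an
  intersection of congruences, then at each of them.\<close>

lemma profinite_coarsen:
  assumes "x \<in> profinite_carrier" "\<theta> \<in> finite_congruences" "\<theta>' \<in> finite_congruences" "\<theta> \<subseteq> \<theta>'"
    and "x \<theta> = \<theta> `` {u}"
  shows "x \<theta>' = \<theta>' `` {u}"
proof -
  have "x \<theta> \<subseteq> x \<theta>'" using assms(1-4) unfolding profinite_carrier_def by blast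
  then have "u \<in> x \<theta>'" using assms(5) finite_congruence_refl[OF assms(2)] by blast
  moreover obtain v where "x \<theta>' = \<theta>' `` {v}" using profinite_rep[OF assms(1,3)] .
  ultimately show ?thesis using class_eq_iff[OF assms(3), of v u] by simp
qed

lemma profinite_mult:
  assumes "\<theta> \<in> finite_congruences" "x \<theta> = \<theta> `` {u}" "y \<theta> = \<theta> `` {v}"
  shows "(x \<otimes>\<^bsub>pmon\<^esub> y) \<theta> = \<theta> `` {u @ v}"
  using assms class_mult[OF finite_congruences_congruence[OF assms(1)]]
  by (simp add: free_profinite_monoid_def quotient_monoid_def)

lemma profinite_mult3:
  assumes "\<theta> \<in> finite_congruences" "x \<theta> = \<theta> `` {u}" "y \<theta> = \<theta> `` {v}" "z \<theta> = \<theta> `` {w}"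
  shows "(x \<otimes>\<^bsub>pmon\<^esub> y \<otimes>\<^bsub>pmon\<^esub> z) \<theta> = \<theta> `` {u @ v @ w}"
  using profinite_mult[of \<theta> "x \<otimes>\<^bsub>pmon\<^esub> y" "u @ v" z w] profinite_mult[of \<theta> x u y v] assms by simp

lemma word_embedding_apply: "\<theta> \<in> finite_congruences \<Longrightarrow> word_embedding u \<theta> = \<theta> `` {u}"
  by (simp add: word_embedding_def)

lemma profinite_eqI:
  assumes "x \<in> profinite_carrier" "y \<in> profinite_carrier"
    and "\<And>\<theta>. \<theta> \<in> finite_congruences \<Longrightarrow> x \<theta> = y \<theta>"
  shows "x = y"
  using assms by (intro extensionalityI[of _ finite_congruences]) (auto simp: profinite_carrier_def PiE_iff)

section \<open>Closures, compactness and factors through finite quotients\<close>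

lemma continuous_projection:
  assumes "\<theta> \<in> finite_congruences"
  shows "continuous_map profinite_topology (discrete_topology (UNIV // \<theta>)) (\<lambda>x. x \<theta>)"
  using continuous_map_product_projection[OF assms, of "\<lambda>\<theta>. discrete_topology (UNIV // \<theta>)"]
  by (auto simp: profinite_topology_def intro: continuous_map_from_subtopology)

text \<open>A basic neighbourhood constrains finitely many coordinates, and the intersection of
  their congruences is again a finite congruence; so one coordinate at a time suffices.\<close>

lemma profinite_closure_iff:
  "x \<in> profinite_closure Y \<longleftrightarrow>
    x \<in> profinite_carrier \<and> (\<forall>\<theta>\<in>finite_congruences. \<exists>y\<in>Y. x \<theta> = \<theta> `` {y})"
proof (intro iffI conjI ballI)
  assume x: "x \<in> profinite_closure Y"
  then show xc: "x \<in> profinite_carrier"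
    unfolding profinite_closure_def in_closure_of topspace_profinite by blast
  fix \<theta> :: "'a list rel" assume t: "\<theta> \<in> finite_congruences"
  have "openin profinite_topology {y \<in> topspace profinite_topology. y \<theta> \<in> {x \<theta>}}"
    using profinite_class[OF xc t] by (intro openin_continuous_map_preimage[OF continuous_projection[OF t]]) simp
  then obtain y where "y \<in> Y" "word_embedding y \<theta> = x \<theta>"
    using x xc unfolding profinite_closure_def in_closure_of topspace_profinite
    by (smt (verit, best) imageE mem_Collect_eq singletonD singletonI)
  then show "\<exists>y\<in>Y. x \<theta> = \<theta> `` {y}" using word_embedding_apply[OF t] by metis
next
  assume x: "x \<in> profinite_carrier \<and> (\<forall>\<theta>\<in>finite_congruences. \<exists>y\<in>Y. x \<theta> = \<theta> `` {y})"
  have "\<exists>y. y \<in> word_embedding ` Y \<and> y \<in> T" if xT: "x \<in> T \<and> openin profinite_topology T" for T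
  proof -
    have T: "openin profinite_topology T" "x \<in> T" using xT by auto
    obtain S where S: "openin (product_topology (\<lambda>\<theta>. discrete_topology (UNIV // \<theta>)) finite_congruences) S"
      and TS: "T = S \<inter> profinite_carrier"
      using T(1) by (auto simp: profinite_topology_def openin_subtopology)
    obtain U where U: "finite {\<theta> \<in> finite_congruences. U \<theta> \<noteq> UNIV // \<theta>}"
      "x \<in> Pi\<^sub>E finite_congruences U" "Pi\<^sub>E finite_congruences U \<subseteq> S"
      using S T(2) TS unfolding openin_product_topology_alt by fastforce
    define \<theta>0 where "\<theta>0 = \<Inter>{\<theta> \<in> finite_congruences. U \<theta> \<noteq> UNIV // \<theta>}"
    have \<theta>0: "\<theta>0 \<in> finite_congruences"
      unfolding \<theta>0_def using U(1) by (intro finite_congruences_Inter) auto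
    obtain w where w: "w \<in> Y" "x \<theta>0 = \<theta>0 `` {w}" using x \<theta>0 by blast
    have "\<theta> `` {w} \<in> U \<theta>" if \<theta>: "\<theta> \<in> finite_congruences" for \<theta>
    proof (cases "U \<theta> = UNIV // \<theta>")
      case True
      then show ?thesis by (simp add: quotientI)
    next
      case False
      then have "\<theta>0 \<subseteq> \<theta>" using \<theta> by (auto simp: \<theta>0_def)
      then have "x \<theta> = \<theta> `` {w}" using profinite_coarsen[of x \<theta>0 \<theta> w] \<theta>0 \<theta> w(2) x by blast
      then show ?thesis using U(2) \<theta> by (auto simp: PiE_iff)
    qed
    then have "word_embedding w \<in> S" using U(3) by (auto simp: word_embedding_def)
    then show ?thesis using TS word_embedding_in w(1) by blast
  qed
  then show "x \<in> profinite_closure Y"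
    using x unfolding profinite_closure_def in_closure_of topspace_profinite by simp
qed

text \<open>Each compatibility condition involves two coordinates with discrete values and so is
  closed; the monoid is the intersection of these conditions in a product of finite discrete
  spaces.\<close>

lemma compact_profinite: "compact_space profinite_topology"
proof -
  let ?T = "product_topology (\<lambda>\<theta>. discrete_topology (UNIV // \<theta>)) (finite_congruences :: 'a list rel set)"
  have "compact_space ?T"
    unfolding compact_space_product_topology
    by (auto simp: compact_space_discrete_topology finite_congruences_def)
  moreover have "closedin ?T profinite_carrier"
  proof -
    define D where "D p = {x \<in> topspace ?T. (x (fst p), x (snd p)) \<in>
      {(c, d). c \<in> UNIV // fst p \<and> d \<in> UNIV // snd p \<and> c \<subseteq> d}}" for p :: "'a list rel \<times> 'a list rel"
    define I where "I = {p :: 'a list rel \<times> 'a list rel.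
      fst p \<in> finite_congruences \<and> snd p \<in> finite_congruences \<and> fst p \<subseteq> snd p}"
    have "closedin ?T (D p)" if p: "p \<in> I" for p
    proof -
      have "continuous_map ?T (prod_topology (discrete_topology (UNIV // fst p)) (discrete_topology (UNIV // snd p)))
          (\<lambda>x. (x (fst p), x (snd p)))"
        using p by (intro continuous_map_pairedI continuous_map_product_projection) (auto simp: I_def)
      then show ?thesis unfolding D_def
        by (rule closedin_continuous_map_preimage)
          (auto simp: prod_topology_discrete_topology[symmetric])
    qed
    then have "closedin ?T (\<Inter>p\<in>I. D p)"
      by (intro closedin_Inter) (auto simp: I_def intro!: exI[of _ UNIV] finite_congruences_UNIV)
    moreover have "(\<Inter>p\<in>I. D p) = profinite_carrier"
    proof (intro equalityI subsetI)
      fix x assume x: "x \<in> (\<Inter>p\<in>I. D p)"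
      then have "x \<in> D (UNIV, UNIV)" using finite_congruences_UNIV by (auto simp: I_def)
      moreover have "x \<theta> \<subseteq> x \<theta>'" if "\<theta> \<in> finite_congruences" "\<theta>' \<in> finite_congruences" "\<theta> \<subseteq> \<theta>'" for \<theta> \<theta>'
      proof -
        have "x \<in> D (\<theta>, \<theta>')" using x that by (auto simp: I_def)
        then show ?thesis by (auto simp: D_def)
      qed
      ultimately show "x \<in> profinite_carrier" by (auto simp: D_def profinite_carrier_def)
    next
      fix x assume x: "x \<in> (profinite_carrier :: ('a list rel \<Rightarrow> 'a list set) set)"
      then show "x \<in> (\<Inter>p\<in>I. D p)"
        using profinite_class[OF x] by (auto simp: I_def D_def profinite_carrier_def)
    qed
    ultimately show ?thesis by simp
  qed
  ultimately show ?thesis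
    unfolding profinite_topology_def by (intro compact_space_subtopology closedin_compact_space)
qed

text \<open>By compactness, conditions solvable in every finite quotient are solvable in the profinite
  monoid; two unknowns are allowed in order to find both cofactors of a factor.\<close>

lemma profinite_thread:
  assumes ne: "\<And>\<theta>. \<theta> \<in> finite_congruences \<Longrightarrow> \<exists>u v. R \<theta> (\<theta> `` {u}) (\<theta> `` {v})"
    and mono: "\<And>\<theta> \<theta>' u v. \<theta> \<in> finite_congruences \<Longrightarrow> \<theta>' \<in> finite_congruences \<Longrightarrow> \<theta> \<subseteq> \<theta>' \<Longrightarrow>
      R \<theta> (\<theta> `` {u}) (\<theta> `` {v}) \<Longrightarrow> R \<theta>' (\<theta>' `` {u}) (\<theta>' `` {v})"
  shows "\<exists>x\<in>profinite_carrier. \<exists>y\<in>profinite_carrier. \<forall>\<theta>\<in>finite_congruences. R \<theta> (x \<theta>) (y \<theta>)"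
proof -
  let ?PP = "prod_topology profinite_topology profinite_topology"
  have comp: "compact_space ?PP" 
    by (intro iffD2[OF compact_space_prod_topology] disjI2 conjI compact_profinite)
  define D where "D \<theta> = {z \<in> topspace ?PP. (fst z \<theta>, snd z \<theta>) \<in>
      {(c, d). c \<in> UNIV // \<theta> \<and> d \<in> UNIV // \<theta> \<and> R \<theta> c d}}" for \<theta>
  have closed: "closedin ?PP (D \<theta>)" if t: "\<theta> \<in> finite_congruences" for \<theta>
  proof -
    have "continuous_map ?PP (prod_topology (discrete_topology (UNIV // \<theta>)) (discrete_topology (UNIV // \<theta>)))
          (\<lambda>z. (fst z \<theta>, snd z \<theta>))"
      using continuous_map_compose[OF continuous_map_fst continuous_projection[OF t], of profinite_topology]
        continuous_map_compose[OF continuous_map_snd continuous_projection[OF t], of profinite_topology]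
      by (intro continuous_map_pairedI) (simp_all add: comp_def)
    then show ?thesis unfolding D_def
      by (rule closedin_continuous_map_preimage)
        (auto simp: prod_topology_discrete_topology[symmetric])
  qed
  \<comment> \<open>A solution at the intersection of finitely many congruences solves the condition
    at each of them, by \<open>mono\<close>.\<close>
  have "\<Inter>\<F> \<noteq> {}" if F: "finite \<F>" "\<F> \<subseteq> D ` finite_congruences" for \<F>
  proof -
    obtain I where I: "I \<subseteq> finite_congruences" "finite I" "\<F> = D ` I"
      using finite_subset_image[OF F] by blast
    have t0: "\<Inter>I \<in> finite_congruences" using finite_congruences_Inter[OF I(2,1)] .
    obtain u v where "R (\<Inter>I) (\<Inter>I `` {u}) (\<Inter>I `` {v})" using ne[OF t0] by blast
    then have "R \<theta> (\<theta> `` {u}) (\<theta> `` {v})" if "\<theta> \<in> I" for \<theta>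
      using mono[OF t0 _ _ , of \<theta> u v] that I(1) by blast
    then have "(word_embedding u, word_embedding v) \<in> D \<theta>" if "\<theta> \<in> I" for \<theta>
      using that I(1) word_embedding_apply[of \<theta>] word_embedding_in
      by (auto simp: D_def topspace_profinite subset_iff intro: quotientI)
    then show ?thesis unfolding I(3) by blast
  qed
  then have "\<Inter>(D ` finite_congruences) \<noteq> {}"
    using comp closed unfolding compact_space_fip by (metis (no_types, lifting) imageE)
  then obtain z where "\<And>\<theta>. \<theta> \<in> finite_congruences \<Longrightarrow> z \<in> D \<theta>" by blast
  moreover from this have "fst z \<in> profinite_carrier" "snd z \<in> profinite_carrier"
    using finite_congruences_UNIV unfolding D_def by (force simp: topspace_profinite)+
  ultimately show ?thesis unfolding D_def by blast
qed

text \<open>Divisibility may be tested quotient by quotient, with unrelated cofactors in each;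
  \<open>profinite_thread\<close> makes the cofactors coherent.\<close>

lemma profinite_factorI:
  assumes y: "y \<in> profinite_carrier" and z: "z \<in> profinite_carrier"
    and f: "\<And>\<theta>. \<theta> \<in> finite_congruences \<Longrightarrow> \<exists>u w v. y \<theta> = \<theta> `` {w} \<and> z \<theta> = \<theta> `` {u @ w @ v}"
  shows "z \<in> principal_ideal pmon y"
proof -
  define R where "R \<theta> c d \<longleftrightarrow> (\<exists>u w v. c = \<theta> `` {u} \<and> d = \<theta> `` {v} \<and> y \<theta> = \<theta> `` {w} \<and> z \<theta> = \<theta> `` {u @ w @ v})"
    for \<theta> c d
  obtain a b where ab: "a \<in> profinite_carrier" "b \<in> profinite_carrier"
    "\<And>\<theta>. \<theta> \<in> finite_congruences \<Longrightarrow> R \<theta> (a \<theta>) (b \<theta>)"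
  proof -
    have "\<exists>x\<in>profinite_carrier. \<exists>y\<in>profinite_carrier. \<forall>\<theta>\<in>finite_congruences. R \<theta> (x \<theta>) (y \<theta>)"
    proof (rule profinite_thread)
      show "\<exists>u v. R \<theta> (\<theta> `` {u}) (\<theta> `` {v})" if "\<theta> \<in> finite_congruences" for \<theta>
        using f[OF that] unfolding R_def by blast
      fix \<theta> \<theta>' u v
      assume t: "\<theta> \<in> finite_congruences" "\<theta>' \<in> finite_congruences" "\<theta> \<subseteq> \<theta>'"
        and "R \<theta> (\<theta> `` {u}) (\<theta> `` {v})"
      then obtain u' w v' where *: "(u, u') \<in> \<theta>" "(v, v') \<in> \<theta>" "y \<theta> = \<theta> `` {w}" "z \<theta> = \<theta> `` {u' @ w @ v'}"
        unfolding R_def class_eq_iff[OF t(1)] by blast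
      then have "\<theta>' `` {u} = \<theta>' `` {u'}" "\<theta>' `` {v} = \<theta>' `` {v'}"
        unfolding class_eq_iff[OF t(2)] using t(3) by blast+
      then show "R \<theta>' (\<theta>' `` {u}) (\<theta>' `` {v})"
        unfolding R_def using profinite_coarsen[of y, OF y t *(3)] profinite_coarsen[of z, OF z t *(4)] by blast
    qed
    then show ?thesis using that by blast
  qed
  have "(a \<otimes>\<^bsub>pmon\<^esub> y \<otimes>\<^bsub>pmon\<^esub> b) \<theta> = z \<theta>" if t: "\<theta> \<in> finite_congruences" for \<theta>
  proof -
    obtain u w v where "a \<theta> = \<theta> `` {u}" "b \<theta> = \<theta> `` {v}" "y \<theta> = \<theta> `` {w}" "z \<theta> = \<theta> `` {u @ w @ v}"
      using ab(3)[OF t] unfolding R_def by blast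
    then show ?thesis using profinite_mult3[of \<theta> a u y w b v] t by simp
  qed
  then have "a \<otimes>\<^bsub>pmon\<^esub> y \<otimes>\<^bsub>pmon\<^esub> b = z"
    using free_profinite_mult_closed[OF free_profinite_mult_closed[OF ab(1) y] ab(2)] z
    by (intro profinite_eqI)
  then show ?thesis using ab unfolding principal_ideal_def by auto
qed

lemma profinite_factorD:
  assumes "y \<in> profinite_carrier" "z \<in> principal_ideal pmon y" "\<theta> \<in> finite_congruences"
  shows "\<exists>u w v. y \<theta> = \<theta> `` {w} \<and> z \<theta> = \<theta> `` {u @ w @ v}"
proof -
  obtain a b where ab: "a \<in> profinite_carrier" "b \<in> profinite_carrier" "z = a \<otimes>\<^bsub>pmon\<^esub> y \<otimes>\<^bsub>pmon\<^esub> b"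
    using assms(2) unfolding principal_ideal_def by auto
  obtain u where u: "a \<theta> = \<theta> `` {u}" using profinite_rep[OF ab(1) assms(3)] .
  obtain w where w: "y \<theta> = \<theta> `` {w}" using profinite_rep[OF assms(1,3)] .
  obtain v where v: "b \<theta> = \<theta> `` {v}" using profinite_rep[OF ab(2) assms(3)] .
  show ?thesis using profinite_mult3[of \<theta> a u y w b v] assms(3) u w v ab(3) by blast
qed

text \<open>If \<open>K\<close> is a class of a finite congruence, then \<open>A\<^sup>* K A\<^sup>*\<close> is rational; hence being a factor
  is an open condition.\<close>

lemma closure_factorial:
  assumes F: "factorial_set F" and x: "x \<in> profinite_closure F"
    and y: "y \<in> profinite_carrier" and xy: "x \<in> principal_ideal pmon y"
  shows "y \<in> profinite_closure F"
  unfolding profinite_closure_iff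
proof (intro conjI ballI y)
  fix \<theta> :: "'a list rel" assume t: "\<theta> \<in> finite_congruences"
  have K: "syntactic_congruence (y \<theta>) \<in> finite_congruences"
  proof (rule saturated_finite[OF t])
    fix u v assume "(u, v) \<in> \<theta>" "u \<in> y \<theta>"
    moreover obtain w where "y \<theta> = \<theta> `` {w}" using profinite_rep[OF y t] .
    ultimately show "v \<in> y \<theta>" using class_eq_iff[OF t] by auto
  qed
  define L where "L = UNIV @@ y \<theta> @@ UNIV"
  have L: "syntactic_congruence L \<in> finite_congruences"
    unfolding L_def by (intro concat_finite K UNIV_finite)
  \<comment> \<open>At this refinement a word of F close to \<open>x\<close> must, like
    \<open>u w v\<close>, have a factor in the class of \<open>y\<close>, and that factor belongs to
    F.\<close>
  define \<theta>0 where "\<theta>0 = \<theta> \<inter> syntactic_congruence L"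
  have t0: "\<theta>0 \<in> finite_congruences" unfolding \<theta>0_def by (rule finite_congruences_Int[OF t L])
  obtain u w v where uwv: "y \<theta>0 = \<theta>0 `` {w}" "x \<theta>0 = \<theta>0 `` {u @ w @ v}"
    using profinite_factorD[OF y xy t0] by blast
  obtain f where f: "f \<in> F" "x \<theta>0 = \<theta>0 `` {f}" using x t0 unfolding profinite_closure_iff by blast
  have yw: "y \<theta> = \<theta> `` {w}" using profinite_coarsen[of y \<theta>0 \<theta> w] y t0 t uwv(1) by (simp add: \<theta>0_def)
  have "w \<in> y \<theta>" unfolding yw using finite_congruence_refl[OF t] by blast
  then have "u @ w @ v \<in> L" unfolding L_def lang_conc_def by blast
  moreover have "(u @ w @ v, f) \<in> \<theta>0" using uwv f class_eq_iff[OF t0] by metis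
  ultimately have "f \<in> L" using syntactic_congruenceD unfolding \<theta>0_def by blast
  then obtain p k q where "f = p @ k @ q" "k \<in> y \<theta>" by (auto simp: L_def lang_conc_def)
  then have "k \<in> F" "y \<theta> = \<theta> `` {k}"
    using factorial_setD[OF F] f(1) class_eq_iff[OF t, of w k] unfolding yw by auto
  then show "\<exists>k\<in>F. y \<theta> = \<theta> `` {k}" by blast
qed

section \<open>Existence and uniqueness of J(F)\<close>

lemma recurrent_common:
  assumes F: "recurrent_set F" and "finite U" "U \<subseteq> F"
  shows "\<exists>f\<in>F. \<forall>u\<in>U. \<exists>a b. f = a @ u @ b"
  using assms(2,3)
proof (induction U rule: finite_induct)
  case empty
  then show ?case using F by (auto simp: recurrent_set_def)
next
  case (insert x U)
  then obtain f where f: "f \<in> F" "\<forall>u\<in>U. \<exists>a b. f = a @ u @ b" by auto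
  obtain w where w: "f @ w @ x \<in> F" using F f(1) insert.prems unfolding recurrent_set_def by blast
  have "\<exists>a b. f @ w @ x = a @ u @ b" if u: "u \<in> insert x U" for u
  proof (cases "u = x")
    case True
    then have "f @ w @ x = (f @ w) @ u @ []" by simp
    then show ?thesis by blast
  next
    case False
    then obtain a b where "f = a @ u @ b" using f u by auto
    then have "f @ w @ x = a @ u @ (b @ w @ x)" by simp
    then show ?thesis by blast
  qed
  then show ?case using w by blast
qed

text \<open>F meets finitely many classes of each finite congruence, so recurrence gives one word of
  F having all of them as factors; compactness assembles these words into an element that every
  element of the closure divides.\<close>

lemma closure_universal:
  assumes F: "recurrent_set F"
  obtains x where "x \<in> profinite_closure F" "\<And>y. y \<in> profinite_closure F \<Longrightarrow> x \<in> principal_ideal pmon y"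
proof -
  \<comment> \<open>The second argument is a dummy, since \<open>profinite_thread\<close> has two
    unknowns and only one is wanted.\<close>
  define R where "R \<theta> c (d :: 'a list set) \<longleftrightarrow> (\<exists>f\<in>F. c = \<theta> `` {f} \<and> (\<forall>u\<in>F. \<exists>a b. (a @ u @ b, f) \<in> \<theta>))"
    for \<theta> c d
  have "\<exists>x\<in>profinite_carrier. \<exists>y\<in>profinite_carrier. \<forall>\<theta>\<in>finite_congruences. R \<theta> (x \<theta>) (y \<theta>)"
  proof (rule profinite_thread)
    fix \<theta> :: "'a list rel" assume t: "\<theta> \<in> finite_congruences"
    have "finite ((\<lambda>u. \<theta> `` {u}) ` F)" using finite_congruence_range[OF t] by (rule rev_finite_subset) blast
    from finite_subset_image[OF this order_refl]
    obtain U where U: "U \<subseteq> F" "finite U" "(\<lambda>u. \<theta> `` {u}) ` F = (\<lambda>u. \<theta> `` {u}) ` U"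
      by (elim exE conjE)
    obtain f where f: "f \<in> F" "\<forall>u\<in>U. \<exists>a b. f = a @ u @ b" using recurrent_common[OF F U(2,1)] by blast
    have "\<exists>a b. (a @ u @ b, f) \<in> \<theta>" if "u \<in> F" for u
    proof -
      have "\<theta> `` {u} \<in> (\<lambda>u. \<theta> `` {u}) ` U" using that U(3) by blast
      then obtain u' where u': "u' \<in> U" "(u, u') \<in> \<theta>" using class_eq_iff[OF t] by auto
      then obtain a b where "f = a @ u' @ b" using f by blast
      then have "(a @ u @ b, f) \<in> \<theta>"
        using finite_congruence_append[OF t finite_congruence_refl[OF t, of a]
            finite_congruence_append[OF t u'(2) finite_congruence_refl[OF t, of b]]] by simp
      then show ?thesis by blast
    qed
    then show "\<exists>u v. R \<theta> (\<theta> `` {u}) (\<theta> `` {v})" using f(1) unfolding R_def by blast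
  next
    fix \<theta> \<theta>' :: "'a list rel" and u v
    assume t: "\<theta> \<in> finite_congruences" "\<theta>' \<in> finite_congruences" "\<theta> \<subseteq> \<theta>'"
      and "R \<theta> (\<theta> `` {u}) (\<theta> `` {v})"
    then show "R \<theta>' (\<theta>' `` {u}) (\<theta>' `` {v})"
      unfolding R_def class_eq_iff[OF t(1)] class_eq_iff[OF t(2)] by blast
  qed
  then obtain x y where xy: "x \<in> profinite_carrier" "\<forall>\<theta>\<in>finite_congruences. R \<theta> (x \<theta>) (y \<theta>)"
    by blast
  then have x: "x \<in> profinite_carrier"
    "\<And>\<theta>. \<theta> \<in> finite_congruences \<Longrightarrow> \<exists>f\<in>F. x \<theta> = \<theta> `` {f} \<and> (\<forall>u\<in>F. \<exists>a b. (a @ u @ b, f) \<in> \<theta>)"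
    unfolding R_def by auto
  show ?thesis
  proof (rule that[of x])
    show "x \<in> profinite_closure F" unfolding profinite_closure_iff using x by blast
    fix y assume y: "y \<in> profinite_closure F"
    show "x \<in> principal_ideal pmon y"
    proof (rule profinite_factorI)
      show "y \<in> profinite_carrier" using y unfolding profinite_closure_iff by blast
      fix \<theta> :: "'a list rel" assume t: "\<theta> \<in> finite_congruences"
      obtain u where u: "u \<in> F" "y \<theta> = \<theta> `` {u}" using y t unfolding profinite_closure_iff by blast
      obtain f where f: "x \<theta> = \<theta> `` {f}" "\<forall>u\<in>F. \<exists>a b. (a @ u @ b, f) \<in> \<theta>" using x(2)[OF t] by blast
      obtain a b where "(a @ u @ b, f) \<in> \<theta>" using f u by blast
      then have "x \<theta> = \<theta> `` {a @ u @ b}" using f(1) class_eq_iff[OF t] by metis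
      then show "\<exists>u w v. y \<theta> = \<theta> `` {w} \<and> x \<theta> = \<theta> `` {u @ w @ v}" using u by blast
    qed (rule x)
  qed
qed

lemma closure_recurrent:
  assumes F: "recurrent_set F" and x: "x \<in> profinite_closure F"
  obtains w where "w \<in> profinite_carrier" "x \<otimes>\<^bsub>pmon\<^esub> w \<otimes>\<^bsub>pmon\<^esub> x \<in> profinite_closure F"
proof -
  have xc: "x \<in> profinite_carrier" using x unfolding profinite_closure_iff by blast
  define R where "R \<theta> c (d :: 'a list set) \<longleftrightarrow>
    (\<exists>u v. c = \<theta> `` {v} \<and> x \<theta> = \<theta> `` {u} \<and> u @ v @ u \<in> F)" for \<theta> c d
  have "\<exists>x\<in>profinite_carrier. \<exists>y\<in>profinite_carrier. \<forall>\<theta>\<in>finite_congruences. R \<theta> (x \<theta>) (y \<theta>)"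
  proof (rule profinite_thread)
    fix \<theta> :: "'a list rel" assume t: "\<theta> \<in> finite_congruences"
    obtain u where u: "u \<in> F" "x \<theta> = \<theta> `` {u}" using x t unfolding profinite_closure_iff by blast
    obtain v where "u @ v @ u \<in> F" using F u(1) unfolding recurrent_set_def by blast
    then show "\<exists>u v. R \<theta> (\<theta> `` {u}) (\<theta> `` {v})" unfolding R_def using u(2) by blast
  next
    fix \<theta> \<theta>' :: "'a list rel" and u v
    assume t: "\<theta> \<in> finite_congruences" "\<theta>' \<in> finite_congruences" "\<theta> \<subseteq> \<theta>'"
      and "R \<theta> (\<theta> `` {u}) (\<theta> `` {v})"
    then obtain p q where "(u, q) \<in> \<theta>" "x \<theta> = \<theta> `` {p}" "p @ q @ p \<in> F"
      unfolding R_def class_eq_iff[OF t(1)] by blast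
    then show "R \<theta>' (\<theta>' `` {u}) (\<theta>' `` {v})"
      unfolding R_def class_eq_iff[OF t(2)] using t(3) profinite_coarsen[of x \<theta> \<theta>'] xc t by blast
  qed
  then obtain w y where wy: "w \<in> profinite_carrier" "\<forall>\<theta>\<in>finite_congruences. R \<theta> (w \<theta>) (y \<theta>)"
    by blast
  then have w: "w \<in> profinite_carrier"
    "\<And>\<theta>. \<theta> \<in> finite_congruences \<Longrightarrow> \<exists>u v. w \<theta> = \<theta> `` {v} \<and> x \<theta> = \<theta> `` {u} \<and> u @ v @ u \<in> F"
    unfolding R_def by auto
  have "x \<otimes>\<^bsub>pmon\<^esub> w \<otimes>\<^bsub>pmon\<^esub> x \<in> profinite_closure F"
    unfolding profinite_closure_iff
  proof (intro conjI ballI free_profinite_mult_closed xc w(1))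
    fix \<theta> :: "'a list rel" assume t: "\<theta> \<in> finite_congruences"
    obtain u v where uv: "w \<theta> = \<theta> `` {v}" "x \<theta> = \<theta> `` {u}" "u @ v @ u \<in> F" using w(2)[OF t] by blast
    then have "(x \<otimes>\<^bsub>pmon\<^esub> w \<otimes>\<^bsub>pmon\<^esub> x) \<theta> = \<theta> `` {u @ v @ u}"
      using profinite_mult3[of \<theta> x u w v x u] t by blast
    then show "\<exists>y\<in>F. (x \<otimes>\<^bsub>pmon\<^esub> w \<otimes>\<^bsub>pmon\<^esub> x) \<theta> = \<theta> `` {y}" using uv(3) by blast
  qed
  then show ?thesis using that w(1) by blast
qed

text \<open>The powers of \<open>x\<close> have some period \<open>d\<close> from some index
  \<open>i\<close> on, both at most the order of the monoid; the exponent \<open>n!\<close> is a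
  multiple of \<open>d\<close> and at least \<open>i\<close>.\<close>

lemma (in monoid) pow_fact_stable:
  assumes fin: "finite (carrier G)" and x: "x \<in> carrier G" and n: "card (carrier G) \<le> n"
  shows "x [^] (fact n :: nat) = x [^] (fact (card (carrier G)) :: nat)"
    and "x [^] (fact n :: nat) \<otimes> x [^] (fact n :: nat) = x [^] (fact n :: nat)"
proof -
  let ?m = "card (carrier G)"
  have "\<not> inj_on (\<lambda>i::nat. x [^] i) {..?m}"
  proof
    assume "inj_on (\<lambda>i::nat. x [^] i) {..?m}"
    then have "card {..?m} \<le> ?m" using x fin by (intro card_inj_on_le) auto
    then show False by simp
  qed
  then obtain i j where ij: "i < j" "j \<le> ?m" "x [^] i = x [^] j"
    unfolding inj_on_def by (metis atMost_iff linorder_neqE_nat)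
  define d where "d = j - i"
  have d: "0 < d" "d \<le> ?m" using ij by (auto simp: d_def)
  have step: "x [^] (k + d) = x [^] k" if "i \<le> k" for k
  proof -
    have "k = i + (k - i)" "k + d = j + (k - i)" using that ij by (simp_all add: d_def)
    then have "x [^] k = x [^] i \<otimes> x [^] (k - i)" "x [^] (k + d) = x [^] j \<otimes> x [^] (k - i)"
      using nat_pow_mult[OF x] by metis+
    then show ?thesis using ij(3) by simp
  qed
  have steps: "x [^] (k + c * d) = x [^] k" if "i \<le> k" for k c
  proof (induction c)
    case (Suc c)
    have "k + Suc c * d = (k + c * d) + d" by simp
    then have "x [^] (k + Suc c * d) = x [^] (k + c * d)"
      using step[of "k + c * d"] that by (metis trans_le_add1)
    then show ?case using Suc by simp
  qed simp
  have dvd: "d dvd fact l" if "?m \<le> l" for l :: nat using d that by (intro dvd_fact) auto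
  have le: "i \<le> fact l" if "?m \<le> l" for l :: nat using fact_ge_self[of l] ij that by linarith
  have "(fact ?m :: nat) \<le> fact n" using n by (rule fact_mono)
  moreover have "d dvd fact n - (fact ?m :: nat)" using dvd[of n] dvd[of ?m] n by (intro dvd_diff_nat) auto
  ultimately obtain c where "fact n = (fact ?m :: nat) + c * d"
    by (metis dvd_def le_add_diff_inverse mult.commute)
  then show "x [^] (fact n :: nat) = x [^] (fact ?m :: nat)" using steps[OF le] by simp
  obtain c where "(fact n :: nat) = c * d" using dvd[OF n] by (metis dvd_def mult.commute)
  then show "x [^] (fact n :: nat) \<otimes> x [^] (fact n :: nat) = x [^] (fact n :: nat)"
    using nat_pow_mult[OF x, of "fact n" "fact n"] steps[OF le[OF n], of c] by simp
qed

lemma quotient_carrier [simp]: "carrier (quotient_monoid \<theta>) = UNIV // \<theta>"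
  by (simp add: quotient_monoid_def)

lemma profinite_mult_apply:
  "\<theta> \<in> finite_congruences \<Longrightarrow> (x \<otimes>\<^bsub>pmon\<^esub> y) \<theta> = x \<theta> \<otimes>\<^bsub>quotient_monoid \<theta>\<^esub> y \<theta>"
  by (simp add: free_profinite_monoid_def)

lemma profinite_pow_apply:
  "\<theta> \<in> finite_congruences \<Longrightarrow> (x [^]\<^bsub>pmon\<^esub> (n::nat)) \<theta> = x \<theta> [^]\<^bsub>quotient_monoid \<theta>\<^esub> n"
  by (induction n) (simp_all add: profinite_mult_apply, simp add: free_profinite_monoid_def)

text \<open>The idempotent is \<open>t\<^sup>\<omega>\<close>, the limit of \<open>t\<^bsup>n!\<^esup>\<close>.\<close>

lemma profinite_omega:
  assumes t: "t \<in> profinite_carrier"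
  obtains e where "e \<in> idempotents pmon"
    "\<And>\<theta>. \<theta> \<in> finite_congruences \<Longrightarrow> e \<theta> = (t [^]\<^bsub>pmon\<^esub> (fact (card (UNIV // \<theta>)) :: nat)) \<theta>"
proof -
  define e where "e = (\<lambda>\<theta>\<in>finite_congruences. (t [^]\<^bsub>pmon\<^esub> (fact (card (UNIV // \<theta>)) :: nat)) \<theta>)"
  interpret P: monoid pmon by (rule free_profinite_monoid_monoid)
  have pow: "t [^]\<^bsub>pmon\<^esub> (n::nat) \<in> profinite_carrier" for n using P.nat_pow_closed[of t n] t by simp
  have stable: "(t [^]\<^bsub>pmon\<^esub> (fact n :: nat)) \<theta> = e \<theta>"
    "(t [^]\<^bsub>pmon\<^esub> (fact n :: nat) \<otimes>\<^bsub>pmon\<^esub> t [^]\<^bsub>pmon\<^esub> (fact n :: nat)) \<theta> = e \<theta>"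
    if c: "\<theta> \<in> finite_congruences" and n: "card (UNIV // \<theta>) \<le> n" for \<theta> n
  proof -
    interpret Q: monoid "quotient_monoid \<theta>"
      by (rule quotient_monoid_monoid[OF finite_congruences_congruence[OF c]])
    have "finite (carrier (quotient_monoid \<theta>))" using c by (simp add: finite_congruences_def)
    moreover have "t \<theta> \<in> carrier (quotient_monoid \<theta>)" using profinite_class[OF t c] by simp
    ultimately show "(t [^]\<^bsub>pmon\<^esub> (fact n :: nat)) \<theta> = e \<theta>"
      "(t [^]\<^bsub>pmon\<^esub> (fact n :: nat) \<otimes>\<^bsub>pmon\<^esub> t [^]\<^bsub>pmon\<^esub> (fact n :: nat)) \<theta> = e \<theta>"
      using Q.pow_fact_stable[of "t \<theta>" n] n c
      by (simp_all add: e_def profinite_pow_apply profinite_mult_apply)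
  qed
  have ec: "e \<in> profinite_carrier"
    unfolding profinite_carrier_def
  proof (intro CollectI conjI ballI impI)
    show "e \<in> (\<Pi>\<^sub>E \<theta>\<in>finite_congruences. UNIV // \<theta>)"
      using profinite_class[OF pow] by (auto simp: e_def)
    fix \<theta> \<theta>' :: "'a list rel"
    assume c: "\<theta> \<in> finite_congruences" "\<theta>' \<in> finite_congruences" "\<theta> \<subseteq> \<theta>'"
    \<comment> \<open>One exponent that is large enough for both quotients.\<close>
    let ?n = "max (card (UNIV // \<theta>)) (card (UNIV // \<theta>'))"
    have "e \<theta> = (t [^]\<^bsub>pmon\<^esub> (fact ?n :: nat)) \<theta>" "e \<theta>' = (t [^]\<^bsub>pmon\<^esub> (fact ?n :: nat)) \<theta>'"
      using stable(1)[of _ ?n] c by auto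
    then show "e \<theta> \<subseteq> e \<theta>'" using pow[of "fact ?n"] c by (auto simp: profinite_carrier_def)
  qed
  have "(e \<otimes>\<^bsub>pmon\<^esub> e) \<theta> = e \<theta>" if c: "\<theta> \<in> finite_congruences" for \<theta>
    using stable[OF c order_refl] c by (simp add: profinite_mult_apply)
  then have "e \<otimes>\<^bsub>pmon\<^esub> e = e" using ec free_profinite_mult_closed by (intro profinite_eqI) auto
  then have "e \<in> idempotents pmon" using ec by (simp add: idempotents_def)
  then show ?thesis using that[of e] stable(1) by auto
qed

text \<open>If every element of the closure of \<open>F\<close> is a factor of \<open>x\<close>, then so is \<open>x w x\<close>, giving
  \<open>x = a x w x b\<close>; iterating, \<open>x\<close> is \<open>\<J>\<close>-equivalent to \<open>(w x b)\<^sup>\<omega>\<close>.\<close>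

lemma J_of_set_exists:
  assumes F: "recurrent_set F"
  shows "\<exists>J. regular_J_class pmon J \<and> J \<subseteq> profinite_closure F \<and> profinite_closure F = factors pmon J"
proof -
  interpret P: monoid pmon by (rule free_profinite_monoid_monoid)
  have Ff: "factorial_set F" using F by (simp add: recurrent_set_def)
  obtain x where x: "x \<in> profinite_closure F" "\<And>y. y \<in> profinite_closure F \<Longrightarrow> x \<in> principal_ideal pmon y"
    using closure_universal[OF F] by metis
  have xc: "x \<in> profinite_carrier" using x(1) unfolding profinite_closure_iff by blast
  obtain w where w: "w \<in> profinite_carrier" "x \<otimes>\<^bsub>pmon\<^esub> w \<otimes>\<^bsub>pmon\<^esub> x \<in> profinite_closure F"
    using closure_recurrent[OF F x(1)] .
  obtain a b where ab: "a \<in> profinite_carrier" "b \<in> profinite_carrier"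
    "x = a \<otimes>\<^bsub>pmon\<^esub> (x \<otimes>\<^bsub>pmon\<^esub> w \<otimes>\<^bsub>pmon\<^esub> x) \<otimes>\<^bsub>pmon\<^esub> b"
    using x(2)[OF w(2)] unfolding principal_ideal_def by auto
  define t where "t = w \<otimes>\<^bsub>pmon\<^esub> x \<otimes>\<^bsub>pmon\<^esub> b"
  have tc: "t \<in> profinite_carrier" unfolding t_def
    by (intro free_profinite_mult_closed w(1) xc ab(2))
  have axt: "x = a \<otimes>\<^bsub>pmon\<^esub> x \<otimes>\<^bsub>pmon\<^esub> t"
  proof -
    have "a \<otimes>\<^bsub>pmon\<^esub> x \<otimes>\<^bsub>pmon\<^esub> t = a \<otimes>\<^bsub>pmon\<^esub> (x \<otimes>\<^bsub>pmon\<^esub> w \<otimes>\<^bsub>pmon\<^esub> x) \<otimes>\<^bsub>pmon\<^esub> b"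
      unfolding t_def using ab(1,2) xc w(1) by (simp add: pmon_assoc)
    then show ?thesis using ab(3) by simp
  qed
  obtain e where e: "e \<in> idempotents pmon"
    "\<And>\<theta>. \<theta> \<in> finite_congruences \<Longrightarrow> e \<theta> = (t [^]\<^bsub>pmon\<^esub> (fact (card (UNIV // \<theta>)) :: nat)) \<theta>"
    using profinite_omega[OF tc] by metis
  have ec: "e \<in> profinite_carrier" "e \<otimes>\<^bsub>pmon\<^esub> e = e" using e by (auto simp: idempotents_def)
  \<comment> \<open>Iterating \<open>x = a x t\<close> moves arbitrarily high powers of
    \<open>t\<close> to the right of \<open>x\<close>.\<close>
  have pow: "\<exists>y\<in>profinite_carrier. x = y \<otimes>\<^bsub>pmon\<^esub> x \<otimes>\<^bsub>pmon\<^esub> t [^]\<^bsub>pmon\<^esub> n" for n :: nat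
  proof (induction n)
    case 0
    show ?case using xc P.one_closed by (intro bexI[of _ "\<one>\<^bsub>pmon\<^esub>"]) auto
  next
    case (Suc n)
    then obtain y where y: "y \<in> profinite_carrier" "x = y \<otimes>\<^bsub>pmon\<^esub> x \<otimes>\<^bsub>pmon\<^esub> t [^]\<^bsub>pmon\<^esub> n" by blast
    have tn: "t [^]\<^bsub>pmon\<^esub> n \<in> carrier pmon" using tc by simp
    have "(a \<otimes>\<^bsub>pmon\<^esub> y) \<otimes>\<^bsub>pmon\<^esub> x \<otimes>\<^bsub>pmon\<^esub> t [^]\<^bsub>pmon\<^esub> Suc n
        = a \<otimes>\<^bsub>pmon\<^esub> (y \<otimes>\<^bsub>pmon\<^esub> x \<otimes>\<^bsub>pmon\<^esub> t [^]\<^bsub>pmon\<^esub> n) \<otimes>\<^bsub>pmon\<^esub> t"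
      using ab(1) y(1) xc tc tn by (simp add: pmon_assoc)
    also have "\<dots> = x" using y(2) axt by simp
    finally show ?case using ab(1) y(1) free_profinite_mult_closed by metis
  qed
  \<comment> \<open>At each congruence \<open>e\<close> agrees with a power \<open>s\<close> of
    \<open>t\<close> for which \<open>x = y x s\<close>; replacing \<open>s\<close> by the
    idempotent \<open>e\<close> shows that \<open>x\<close> absorbs \<open>e\<close> on the
    right.\<close>
  have xe: "x = x \<otimes>\<^bsub>pmon\<^esub> e"
  proof (rule profinite_eqI)
    show "x \<in> profinite_carrier" "x \<otimes>\<^bsub>pmon\<^esub> e \<in> profinite_carrier"
      using xc ec free_profinite_mult_closed by auto
    fix \<theta> :: "'a list rel" assume c: "\<theta> \<in> finite_congruences"
    let ?s = "t [^]\<^bsub>pmon\<^esub> (fact (card (UNIV // \<theta>)) :: nat)"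
    obtain y where y: "y \<in> profinite_carrier" "x = y \<otimes>\<^bsub>pmon\<^esub> x \<otimes>\<^bsub>pmon\<^esub> ?s" using pow by blast
    have sc: "?s \<in> carrier pmon" using tc P.nat_pow_closed by simp
    have "(y \<otimes>\<^bsub>pmon\<^esub> x \<otimes>\<^bsub>pmon\<^esub> e) \<otimes>\<^bsub>pmon\<^esub> e = y \<otimes>\<^bsub>pmon\<^esub> x \<otimes>\<^bsub>pmon\<^esub> e"
      using y(1) xc ec by (simp add: pmon_assoc)
    then have "(y \<otimes>\<^bsub>pmon\<^esub> x \<otimes>\<^bsub>pmon\<^esub> ?s \<otimes>\<^bsub>pmon\<^esub> e) \<theta> = (y \<otimes>\<^bsub>pmon\<^esub> x \<otimes>\<^bsub>pmon\<^esub> ?s) \<theta>"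
      using e(2)[OF c] profinite_mult_apply[OF c] by metis
    then show "x \<theta> = (x \<otimes>\<^bsub>pmon\<^esub> e) \<theta>" using y(2) by metis
  qed
  have x_e: "x \<in> principal_ideal pmon e"
    unfolding principal_ideal_def using xe xc ec P.one_closed
    by (intro CollectI exI[of _ x] exI[of _ "\<one>\<^bsub>pmon\<^esub>"]) auto
  have e_x: "e \<in> principal_ideal pmon x"
  proof (rule profinite_factorI[OF xc ec(1)])
    fix \<theta> :: "'a list rel" assume c: "\<theta> \<in> finite_congruences"
    \<comment> \<open>The exponent is positive, so the power contains a factor \<open>t\<close> and
      with it \<open>x\<close>.\<close>
    obtain n where n: "(fact (card (UNIV // \<theta>)) :: nat) = Suc n" by (metis fact_nonzero not0_implies_Suc)
    define s where "s = t [^]\<^bsub>pmon\<^esub> n"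
    have sc: "s \<in> profinite_carrier" using tc P.nat_pow_closed[of t n] by (simp add: s_def)
    have "e \<theta> = (s \<otimes>\<^bsub>pmon\<^esub> t) \<theta>" using e(2)[OF c] n by (simp add: s_def)
    moreover have "s \<otimes>\<^bsub>pmon\<^esub> t = (s \<otimes>\<^bsub>pmon\<^esub> w) \<otimes>\<^bsub>pmon\<^esub> x \<otimes>\<^bsub>pmon\<^esub> b"
      unfolding t_def using sc w(1) xc ab(2) by (simp add: pmon_assoc)
    then have "s \<otimes>\<^bsub>pmon\<^esub> t \<in> principal_ideal pmon x"
      unfolding principal_ideal_def using sc w(1) ab(2) free_profinite_mult_closed by auto
    ultimately show "\<exists>u w v. x \<theta> = \<theta> `` {w} \<and> e \<theta> = \<theta> `` {u @ w @ v}"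
      using profinite_factorD[OF xc _ c] by metis
  qed
  define J where "J = J_class pmon e"
  have Jx: "J = J_class pmon x"
    unfolding J_def using P.J_class_eq[of x e] P.J_class_iff[of e x] x_e e_x ec xc by simp
  have Jiff: "y \<in> J \<longleftrightarrow> y \<in> principal_ideal pmon x \<and> x \<in> principal_ideal pmon y \<and> y \<in> profinite_carrier" for y
    unfolding Jx using P.J_class_iff[of x y] xc by simp
  have sub: "J \<subseteq> profinite_closure F"
    using closure_factorial[OF Ff x(1)] Jiff by blast
  moreover have "regular_J_class pmon J"
    unfolding regular_J_class_def using ec e(1) P.J_class_iff[of e e] P.in_principal_ideal[of e]
    by (auto simp: J_def intro!: bexI[of _ e])
  moreover have "profinite_closure F = factors pmon J"
  proof (intro equalityI subsetI)
    fix y assume y: "y \<in> profinite_closure F"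
    then have "y \<in> profinite_carrier" unfolding profinite_closure_iff by blast
    moreover have "x \<in> J" unfolding Jx using P.J_class_iff[of x x] P.in_principal_ideal[of x] xc by simp
    ultimately show "y \<in> factors pmon J" unfolding factors_def using x(2)[OF y] by auto
  next
    fix y assume "y \<in> factors pmon J"
    then show "y \<in> profinite_closure F"
      unfolding factors_def using closure_factorial[OF Ff] sub by auto
  qed
  ultimately show ?thesis by blast
qed

text \<open>For uniqueness, each of two such classes lies in the closure and so consists of factors
  of elements of the other; hence their elements divide one another.\<close>

lemma J_of_set:
  assumes F: "recurrent_set F"
  shows "regular_J_class pmon (J_of_set F)" "J_of_set F \<subseteq> profinite_closure F"
    "profinite_closure F = factors pmon (J_of_set F)"
proof -
  interpret P: monoid pmon by (rule free_profinite_monoid_monoid)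
  let ?Q = "\<lambda>J. regular_J_class pmon J \<and> J \<subseteq> profinite_closure F \<and> profinite_closure F = factors pmon J"
  have le: "\<exists>y\<in>J'. y \<in> principal_ideal pmon x" if "?Q J" "?Q J'" "x \<in> J" for x J J'
    using that unfolding factors_def by blast
  have "J = J'" if J: "?Q J" and J': "?Q J'" for J J'
  proof -
    obtain x0 x0' where x0: "x0 \<in> profinite_carrier" "J = J_class pmon x0"
      "x0' \<in> profinite_carrier" "J' = J_class pmon x0'"
      using J J' unfolding regular_J_class_def by auto
    have "x0 \<in> J" "x0' \<in> J'" using x0 by (auto simp: J_class_def)
    obtain y where y: "y \<in> J'" "y \<in> principal_ideal pmon x0" using le[OF J J' \<open>x0 \<in> J\<close>] by blast
    obtain z where z: "z \<in> J" "z \<in> principal_ideal pmon x0'" using le[OF J' J \<open>x0' \<in> J'\<close>] by blast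
    have 1: "principal_ideal pmon x0' = principal_ideal pmon y" "principal_ideal pmon x0 = principal_ideal pmon z"
      using y z x0 by (auto simp: J_class_def)
    have "principal_ideal pmon y \<subseteq> principal_ideal pmon x0" "principal_ideal pmon z \<subseteq> principal_ideal pmon x0'"
      using P.principal_ideal_subset y z x0 by auto
    then have "principal_ideal pmon x0 = principal_ideal pmon x0'" using 1 by blast
    then show ?thesis using x0 by (simp add: J_class_def)
  qed
  moreover obtain J where "?Q J" using J_of_set_exists[OF F] by blast
  ultimately have "?Q (J_of_set F)" unfolding J_of_set_def by (intro theI[of ?Q J])
  then show "regular_J_class pmon (J_of_set F)" "J_of_set F \<subseteq> profinite_closure F"
    "profinite_closure F = factors pmon (J_of_set F)" by blast+
qed

text \<open>The word \<open>w0\<close> is a factor of some element of J(F), hence of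
  \<open>e\<close>. This passes to words of F close to \<open>e\<close>, since containing
  \<open>w0\<close> is a rational property.\<close>

lemma J_of_set_approx:
  fixes F :: "'a::finite list set"
  assumes F: "recurrent_set F" and e: "e \<in> J_of_set F" and w0: "w0 \<in> F" and t: "\<theta> \<in> finite_congruences"
  shows "\<exists>a b. a @ w0 @ b \<in> F \<and> e \<theta> = \<theta> `` {a @ w0 @ b}"
proof -
  interpret P: monoid pmon by (rule free_profinite_monoid_monoid)
  note J = J_of_set[OF F]
  have eF: "e \<in> profinite_closure F" and ec: "e \<in> profinite_carrier"
    using subsetD[OF J(2) e] profinite_closure_iff by blast+
  have "word_embedding w0 \<in> profinite_closure F"
    unfolding profinite_closure_iff using w0 word_embedding_in word_embedding_apply by blast
  then obtain x where x: "x \<in> J_of_set F" "x \<in> principal_ideal pmon (word_embedding w0)"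
    unfolding J(3) factors_def by blast
  obtain x0 where "x0 \<in> profinite_carrier" "J_of_set F = J_class pmon x0"
    using J(1) unfolding regular_J_class_def by auto
  then have "principal_ideal pmon e = principal_ideal pmon x" using e x(1) by (auto simp: J_class_def)
  then have "e \<in> principal_ideal pmon x" using P.in_principal_ideal[of e] ec by simp
  then have ew: "e \<in> principal_ideal pmon (word_embedding w0)"
    using P.principal_ideal_subset[of "word_embedding w0" x] x(2) word_embedding_in by auto
  define L where "L = UNIV @@ {w0} @@ UNIV"
  have L: "syntactic_congruence L \<in> finite_congruences"
    unfolding L_def by (intro concat_finite UNIV_finite singleton_finite)
  \<comment> \<open>The singleton component forces the word representing \<open>w0\<close> to be
    \<open>w0\<close> itself; the component of \<open>L\<close> forces the word of F to contain
    it.\<close>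
  define \<theta>0 where "\<theta>0 = \<theta> \<inter> syntactic_congruence L \<inter> syntactic_congruence {w0}"
  have t0: "\<theta>0 \<in> finite_congruences" unfolding \<theta>0_def
    by (intro finite_congruences_Int t L singleton_finite)
  obtain u w v where uwv: "word_embedding w0 \<theta>0 = \<theta>0 `` {w}" "e \<theta>0 = \<theta>0 `` {u @ w @ v}"
    using profinite_factorD[OF word_embedding_in ew t0] by blast
  have "(w0, w) \<in> \<theta>0" using uwv(1) word_embedding_apply[OF t0] class_eq_iff[OF t0] by metis
  then have "w = w0" using syntactic_congruenceD[of w0 w "{w0}"] by (simp add: \<theta>0_def)
  obtain f where f: "f \<in> F" "e \<theta>0 = \<theta>0 `` {f}" using eF t0 unfolding profinite_closure_iff by blast
  have "(u @ w @ v, f) \<in> syntactic_congruence L"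
    using uwv(2) f(2) class_eq_iff[OF t0, of "u @ w @ v" f] by (simp add: \<theta>0_def)
  moreover have "u @ w @ v \<in> L" unfolding L_def lang_conc_def \<open>w = w0\<close> by blast
  ultimately have "f \<in> L" using syntactic_congruenceD by blast
  then obtain a b where "f = a @ w0 @ b" by (auto simp: L_def lang_conc_def)
  moreover have "e \<theta> = \<theta> `` {f}" using profinite_coarsen[of e \<theta>0 \<theta> f] ec t0 t f(2) by (auto simp: \<theta>0_def)
  ultimately show ?thesis using f(1) by blast
qed

text \<open>Having a prefix in a given class of \<theta> is a rational property, and there are
  finitely many classes; refining by all of them lets one word \<open>f\<close> serve every left
  divisor of \<open>e\<close>.\<close>

lemma closure_prefixes:
  assumes e: "e \<in> profinite_closure F" and t: "\<theta> \<in> finite_congruences"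
  shows "\<exists>f\<in>F. \<forall>k\<in>profinite_carrier. \<forall>m\<in>profinite_carrier. k \<otimes>\<^bsub>pmon\<^esub> m = e \<longrightarrow>
    (\<exists>p. prefix p f \<and> k \<theta> = \<theta> `` {p})"
proof -
  define \<theta>0 where "\<theta>0 = \<theta> \<inter> \<Inter>((\<lambda>K. syntactic_congruence (K @@ UNIV)) ` (UNIV // \<theta>))"
  have "syntactic_congruence (K @@ UNIV) \<in> finite_congruences" if K: "K \<in> UNIV // \<theta>" for K
  proof (rule concat_finite[OF saturated_finite[OF t] UNIV_finite])
    fix u v assume "(u, v) \<in> \<theta>" "u \<in> K"
    moreover obtain w where "K = \<theta> `` {w}" using K by (auto elim: quotientE)
    ultimately show "v \<in> K" using class_eq_iff[OF t] by auto
  qed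
  then have t0: "\<theta>0 \<in> finite_congruences"
    unfolding \<theta>0_def using t
    by (intro finite_congruences_Int finite_congruences_Inter) (auto simp: finite_congruences_def)
  obtain f where f: "f \<in> F" "e \<theta>0 = \<theta>0 `` {f}" using e t0 unfolding profinite_closure_iff by blast
  have "\<exists>p. prefix p f \<and> k \<theta> = \<theta> `` {p}"
    if k: "k \<in> profinite_carrier" "m \<in> profinite_carrier" "k \<otimes>\<^bsub>pmon\<^esub> m = e" for k m
  proof -
    obtain u v where uv: "k \<theta>0 = \<theta>0 `` {u}" "m \<theta>0 = \<theta>0 `` {v}" using profinite_rep t0 k(1,2) by metis
    have ku: "k \<theta> = \<theta> `` {u}" using profinite_coarsen[of k \<theta>0 \<theta> u] k(1) t0 t uv(1) by (auto simp: \<theta>0_def)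
    have "(u @ v, f) \<in> \<theta>0" 
      using profinite_mult[of \<theta>0 k u m v] t0 uv k(3) f(2) class_eq_iff[OF t0, of "u @ v" f] by simp
    then have "(u @ v, f) \<in> syntactic_congruence ((\<theta> `` {u}) @@ UNIV)"
      unfolding \<theta>0_def by (auto intro: quotientI)
    moreover have "u @ v \<in> (\<theta> `` {u}) @@ UNIV"
      using finite_congruence_refl[OF t, of u] unfolding lang_conc_def by blast
    ultimately have "f \<in> (\<theta> `` {u}) @@ UNIV" using syntactic_congruenceD by blast
    then obtain p q where "f = p @ q" "(u, p) \<in> \<theta>" by (auto simp: lang_conc_def)
    then show ?thesis using ku class_eq_iff[OF t] by (intro exI[of _ p]) auto
  qed
  then show ?thesis using f(1) by blast
qed

section \<open>Comparison of the groups of X and Z\<close>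

abbreviation star_monoid :: "'a list set \<Rightarrow> 'a list set monoid" where
  "star_monoid Y \<equiv> syntactic_monoid (lang_star Y)"

abbreviation star_class :: "'a list set \<Rightarrow> 'a list \<Rightarrow> 'a list set" where
  "star_class Y u \<equiv> syntactic_congruence (lang_star Y) `` {u}"

abbreviation star_hat :: "'a list set \<Rightarrow> ('a list rel \<Rightarrow> 'a list set) \<Rightarrow> 'a list set" where
  "star_hat Y \<equiv> syntactic_hat (lang_star Y)"

abbreviation star_recognizable :: "'a list set \<Rightarrow> bool" where
  "star_recognizable Y \<equiv> syntactic_congruence (lang_star Y) \<in> finite_congruences"

lemma rational_star: "rational Y \<Longrightarrow> [] \<notin> Y \<Longrightarrow> star_recognizable Y"
  by (intro star_finite syntactic_congruence_finite)

lemma star_monoid_monoid: "monoid (star_monoid Y)"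
  unfolding syntactic_monoid_def by (rule quotient_monoid_monoid[OF syntactic_congruence_congruence])

lemma star_monoid_finite: "star_recognizable Y \<Longrightarrow> finite (carrier (star_monoid Y))"
  by (simp add: syntactic_monoid_def finite_congruences_def)

lemma star_class_mult: "star_class Y u \<otimes>\<^bsub>star_monoid Y\<^esub> star_class Y v = star_class Y (u @ v)"
  by (simp add: syntactic_monoid_def quotient_monoid_def class_mult[OF syntactic_congruence_congruence])

lemma star_class_carrier: "star_class Y u \<in> carrier (star_monoid Y)"
  by (simp add: syntactic_monoid_def quotientI)

lemma star_class_cases:
  assumes "C \<in> carrier (star_monoid Y)"
  obtains u where "C = star_class Y u"
  using assms by (auto simp: syntactic_monoid_def elim: quotientE)

lemma star_class_eq: "star_class Y u = star_class Y v \<longleftrightarrow> star_cong Y u v"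
  using eq_equiv_class_iff[of UNIV "syntactic_congruence (lang_star Y)" u v]
    syntactic_congruence_congruence[of "lang_star Y"] by (auto simp: word_congruence_def)

lemma star_class_idem: "star_class Y w \<in> idempotents (star_monoid Y) \<longleftrightarrow> star_cong Y (w @ w) w"
  by (simp add: idempotents_def star_class_mult star_class_carrier star_class_eq)

lemma star_H_class:
  assumes "star_cong Y (w @ w) w"
  shows "star_class Y y \<in> H_class (star_monoid Y) (star_class Y w) \<longleftrightarrow>
    star_cong Y (w @ y) y \<and> star_cong Y (y @ w) y \<and>
    (\<exists>z. star_cong Y (y @ z) w \<and> star_cong Y (z @ y) w)"
proof -
  have "(\<exists>k\<in>carrier (star_monoid Y). P k) \<longleftrightarrow> (\<exists>z. P (star_class Y z))" for P
    using star_class_carrier star_class_cases by metis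
  then show ?thesis
    using monoid.H_class_idem_iff[OF star_monoid_monoid, of "star_class Y w" Y "star_class Y y"]
      star_class_idem[of Y w] assms
    by (simp add: star_class_carrier star_class_mult star_class_eq)
qed

lemma star_hat_hom: "star_recognizable Y \<Longrightarrow> star_hat Y \<in> hom pmon (star_monoid Y)"
  using profinite_class by (auto simp: hom_def syntactic_hat_def syntactic_monoid_def profinite_mult_apply)

text \<open>A maximal subgroup contains only one idempotent, and the image contains
  \<open>h e\<close>.\<close>

lemma hom_image_maximal_subgroup:
  assumes "monoid P" "monoid M" "h \<in> hom P M" "e \<in> idempotents P"
  shows "h ` H_class P e \<in> maximal_subgroups_in M D \<longleftrightarrow>
    h ` H_class P e = H_class M (h e) \<and> H_class M (h e) \<subseteq> D"
proof
  note he = hom_H_class[OF assms]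
  assume "h ` H_class P e \<in> maximal_subgroups_in M D"
  then obtain f where f: "f \<in> idempotents M" "h ` H_class P e = H_class M f" "H_class M f \<subseteq> D"
    unfolding maximal_subgroups_in_def by blast
  have "h e \<in> H_class M f" using f(2) monoid.idem_in_H_class[OF assms(1,4)] by blast
  then have "h e = f" using monoid.H_class_idem_unique[OF assms(2) f(1) he(1)] by blast
  then show "h ` H_class P e = H_class M (h e) \<and> H_class M (h e) \<subseteq> D" using f by simp
next
  assume "h ` H_class P e = H_class M (h e) \<and> H_class M (h e) \<subseteq> D"
  then show "h ` H_class P e \<in> maximal_subgroups_in M D"
    using hom_H_class(1)[OF assms] unfolding maximal_subgroups_in_def by blast
qed

section \<open>The charged conditions at the idempotents of J(F)\<close>

definition J_idempotents :: "'a list set \<Rightarrow> ('a list rel \<Rightarrow> 'a list set) set" where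
  "J_idempotents F = idempotents pmon \<inter> J_of_set F"

lemma J_of_set_class:
  assumes "recurrent_set F" "e \<in> J_of_set F"
  shows "J_of_set F = J_class pmon e" "e \<in> profinite_carrier"
proof -
  obtain x where x: "x \<in> carrier pmon" "J_of_set F = J_class pmon x"
    using J_of_set(1)[OF assms(1)] unfolding regular_J_class_def by blast
  then show "J_of_set F = J_class pmon e"
    using monoid.J_class_eq[OF free_profinite_monoid_monoid] assms(2) by blast
  show "e \<in> profinite_carrier" using x(2) assms(2) by (auto simp: J_class_def)
qed

lemma J_idempotents_nonempty: "recurrent_set F \<Longrightarrow> J_idempotents F \<noteq> {}"
  using J_of_set(1) unfolding regular_J_class_def J_idempotents_def by blast

lemma maximal_subgroups_J_of_set:
  assumes "recurrent_set F"
  shows "maximal_subgroups_in pmon (J_of_set F) = H_class pmon ` J_idempotents F"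
proof -
  obtain x where x: "x \<in> carrier pmon" "J_of_set F = J_class pmon x"
    using J_of_set(1)[OF assms] unfolding regular_J_class_def by blast
  show ?thesis
    unfolding J_idempotents_def x(2)
      monoid.maximal_subgroups_in_J_class[OF free_profinite_monoid_monoid x(1)] by blast
qed

lemma J_in_eq:
  assumes F: "recurrent_set F" and X: "star_recognizable X" and e: "e \<in> J_idempotents F"
  shows "J_in F X = J_class (star_monoid X) (star_hat X e)"
  unfolding J_in_def
proof (rule the_equality)
  have eJ: "e \<in> J_of_set F" "e \<in> idempotents pmon" using e by (auto simp: J_idempotents_def)
  note E = J_of_set_class[OF F eJ(1)]
  have i: "star_hat X e \<in> idempotents (star_monoid X)"
    using hom_H_class(1)[OF free_profinite_monoid_monoid star_monoid_monoid star_hat_hom[OF X] eJ(2)] .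
  then have c: "star_hat X e \<in> carrier (star_monoid X)" by (simp add: idempotents_def)
  show "regular_J_class (star_monoid X) (J_class (star_monoid X) (star_hat X e)) \<and>
      star_hat X ` J_of_set F \<subseteq> J_class (star_monoid X) (star_hat X e)"
  proof
    show "regular_J_class (star_monoid X) (J_class (star_monoid X) (star_hat X e))"
      unfolding regular_J_class_def using c i by (auto simp: J_class_def)
    show "star_hat X ` J_of_set F \<subseteq> J_class (star_monoid X) (star_hat X e)"
      unfolding E(1)
      using hom_J_class[OF free_profinite_monoid_monoid star_monoid_monoid star_hat_hom[OF X]] E(2) by simp
  qed
  fix J assume J: "regular_J_class (star_monoid X) J \<and> star_hat X ` J_of_set F \<subseteq> J"
  then obtain y where "J = J_class (star_monoid X) y" unfolding regular_J_class_def by blast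
  moreover have "star_hat X e \<in> J" using J eJ(1) by blast
  ultimately show "J = J_class (star_monoid X) (star_hat X e)"
    using monoid.J_class_eq[OF star_monoid_monoid] by metis
qed

lemma charged_iff:
  assumes F: "recurrent_set F" and Z: "star_recognizable Z"
  shows "charged F Z \<longleftrightarrow> (\<forall>e\<in>J_idempotents F.
    star_hat Z ` H_class pmon e = H_class (star_monoid Z) (star_hat Z e) \<and>
    H_class (star_monoid Z) (star_hat Z e) \<subseteq> J_of_code Z)"
  unfolding charged_def maximal_subgroups_J_of_set[OF F]
  using hom_image_maximal_subgroup[OF free_profinite_monoid_monoid star_monoid_monoid star_hat_hom[OF Z]]
  by (auto simp: J_idempotents_def)

text \<open>Inclusion in \<open>J_in F X\<close> is automatic, that class being the J-class of the
  image of \<open>e\<close>.\<close>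

lemma weakly_charged_iff:
  assumes F: "recurrent_set F" and X: "star_recognizable X"
  shows "weakly_charged F X \<longleftrightarrow> (\<forall>e\<in>J_idempotents F.
    star_hat X ` H_class pmon e = H_class (star_monoid X) (star_hat X e))"
proof -
  have "star_hat X ` H_class pmon e \<in> maximal_subgroups_in (star_monoid X) (J_in F X) \<longleftrightarrow>
      star_hat X ` H_class pmon e = H_class (star_monoid X) (star_hat X e)" if e: "e \<in> J_idempotents F" for e
  proof -
    have i: "e \<in> idempotents pmon" using e by (simp add: J_idempotents_def)
    note hom = free_profinite_monoid_monoid star_monoid_monoid star_hat_hom[OF X] i
    show ?thesis
      unfolding hom_image_maximal_subgroup[OF hom] J_in_eq[OF F X e]
      using monoid.H_class_subset_J_class[OF star_monoid_monoid hom_H_class(1)[OF hom]] by blast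
  qed
  then show ?thesis unfolding weakly_charged_def maximal_subgroups_J_of_set[OF F] by simp
qed

section \<open>Degrees and full words\<close>

lemma degree_attained:
  assumes "S \<noteq> {}" "\<And>u. u \<in> S \<Longrightarrow> num_parses Y u \<le> N"
  shows "\<exists>w\<in>S. (\<forall>u\<in>S. num_parses Y u \<le> num_parses Y w) \<and> degree_in S Y = enat (num_parses Y w)"
proof -
  obtain u0 where "u0 \<in> S" using assms(1) by blast
  then obtain w where w: "w \<in> S" "\<forall>u. u \<in> S \<longrightarrow> num_parses Y u \<le> num_parses Y w"
    using ex_has_greatest_nat[of "\<lambda>u. u \<in> S" u0 "num_parses Y" "Suc N"] assms(2) by (meson le_imp_less_Suc less_imp_le)
  have "degree_in S Y = enat (num_parses Y w)"
    unfolding degree_in_def by (intro antisym SUP_least SUP_upper2[OF w(1)]) (use w in auto)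
  then show ?thesis using w by blast
qed

lemma code_degree_full:
  assumes "bifix_free Z" "code_degree Z < \<infinity>"
  obtains w where "full Z w" "code_degree Z = enat (card (starts Z w))"
proof -
  obtain N where N: "code_degree Z = enat N" using assms(2) by auto
  have "enat (num_parses Z u) \<le> enat N" for u
    unfolding N[symmetric] degree_in_def by (rule SUP_upper) simp
  then show ?thesis
    using degree_attained[of UNIV Z N] that unfolding full_def num_parses_eq[OF assms(1)] by auto
qed

text \<open>On words of F the parses for the restricted code are those for Z, so the F-degree is the
  largest number of Z-parses of a word of F. Finiteness of the degree of Z makes both maxima
  attained.\<close>

lemma degree_in_full_iff:
  assumes Z: "bifix_free Z" "code_degree Z < \<infinity>" and F: "recurrent_set F"
  shows "degree_in F (Z \<inter> F) = code_degree Z \<longleftrightarrow> (\<exists>w\<in>F. full Z w)"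
proof -
  have Ff: "factorial_set F" and ne: "F \<noteq> {}" using F by (auto simp: recurrent_set_def)
  have X: "bifix_free (Z \<inter> F)" using bifix_free_subset[OF Z(1)] by blast
  have np: "num_parses (Z \<inter> F) u = card (starts Z u)" if "u \<in> F" for u
    using num_parses_eq[OF X] factorial_starts[OF Ff that] by metis
  obtain w0 where w0: "full Z w0" "code_degree Z = enat (card (starts Z w0))"
    using code_degree_full[OF Z] .
  have bd: "num_parses (Z \<inter> F) u \<le> card (starts Z w0)" if "u \<in> F" for u
    using np[OF that] w0(1) by (simp add: full_def)
  obtain w where w: "w \<in> F" "\<forall>u\<in>F. num_parses (Z \<inter> F) u \<le> num_parses (Z \<inter> F) w"
      "degree_in F (Z \<inter> F) = enat (num_parses (Z \<inter> F) w)"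
    using degree_attained[OF ne bd] by blast
  show ?thesis
  proof
    assume "degree_in F (Z \<inter> F) = code_degree Z"
    then have "card (starts Z w) = card (starts Z w0)" using w(3) w0(2) np[OF w(1)] by simp
    then have "full Z w" using w0(1) by (simp add: full_def)
    then show "\<exists>w\<in>F. full Z w" using w(1) by blast
  next
    assume "\<exists>w\<in>F. full Z w"
    then obtain f where f: "f \<in> F" "full Z f" by blast
    have "card (starts Z w0) \<le> card (starts Z f)" using f(2) by (simp add: full_def)
    also have "\<dots> \<le> card (starts Z w)" using w(2) f(1) np[OF f(1)] np[OF w(1)] by metis
    finally have "card (starts Z w) = card (starts Z w0)" using w0(1) by (simp add: full_def antisym)
    then show "degree_in F (Z \<inter> F) = code_degree Z" using w(3) w0(2) np[OF w(1)] by simp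
  qed
qed

lemma full_group_H:
  assumes bifix: "bifix_free Z" and full: "full Z w" and idemZ: "star_cong Z (w @ w) w"
  shows "star_class Z (w @ y @ w) \<in> H_class (star_monoid Z) (star_class Z w)"
proof -
  obtain z where z: "star_cong Z (w @ y @ w @ z @ w) w" "star_cong Z (w @ z @ w @ y @ w) w"
    using full_group[OF bifix full idemZ] by blast
  have "star_cong Z (w @ w @ y @ w) (w @ y @ w)" "star_cong Z (w @ y @ w @ w) (w @ y @ w)"
    using star_cong_append[OF idemZ star_cong_refl[where Y = Z and u = "y @ w"]]
      star_cong_append[OF star_cong_refl[where Y = Z and u = "w @ y"] idemZ] by simp_all
  moreover have "star_cong Z ((w @ z @ w) @ (w @ y @ w)) w"
  proof -
    have "star_cong Z ((w @ z) @ (w @ w) @ (y @ w)) ((w @ z) @ w @ (y @ w))"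
      by (intro star_cong_append star_cong_refl idemZ)
    then show ?thesis using star_cong_trans[OF _ z(2)] by simp
  qed
  moreover have "star_cong Z ((w @ y @ w) @ (w @ z @ w)) w"
  proof -
    have "star_cong Z ((w @ y) @ (w @ w) @ (z @ w)) ((w @ y) @ w @ (z @ w))"
      by (intro star_cong_append star_cong_refl idemZ)
    then show ?thesis using star_cong_trans[OF _ z(1)] by simp
  qed
  ultimately show ?thesis unfolding star_H_class[OF idemZ] by auto
qed

section \<open>The map between the maximal subgroups for X and Z\<close>

context full_idempotent_word
begin

abbreviation "HX \<equiv> H_class (star_monoid X) (star_class X w)"
abbreviation "HZ \<equiv> H_class (star_monoid Z) (star_class Z w)"

lemma HZ_all: "star_class Z (w @ y @ w) \<in> HZ"
  by (rule full_group_H[OF bifix full idemZ])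

text \<open>Fullness of \<open>w\<close> makes its whole local monoid a group, which places it in
  the minimum ideal.\<close>

lemma HZ_minimum: "star_recognizable Z \<Longrightarrow> HZ \<subseteq> J_of_code Z"
  unfolding J_of_code_def
proof (rule monoid.local_group_minimum[OF star_monoid_monoid star_monoid_finite])
  show "star_class Z w \<in> idempotents (star_monoid Z)" using idemZ by (simp add: star_class_idem)
  fix C assume "C \<in> carrier (star_monoid Z)"
  then obtain y where "C = star_class Z y" by (rule star_class_cases)
  then show "star_class Z w \<otimes>\<^bsub>star_monoid Z\<^esub> C \<otimes>\<^bsub>star_monoid Z\<^esub> star_class Z w \<in> HZ"
    using HZ_all[of y] by (simp add: star_class_mult)
qed

text \<open>Independent of the representative on \<open>HX\<close>, by \<open>HX_cong\<close>;
  elsewhere the value may depend on the choice. The outer factors \<open>w\<close> bring the class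
  into \<open>HZ\<close>.\<close>

definition transfer :: "'a list set \<Rightarrow> 'a list set" where
  "transfer C = star_class Z (w @ (SOME y. y \<in> C) @ w)"

lemma HX_cong:
  assumes "star_class X y \<in> HX" "star_class X y' \<in> HX"
  shows "star_cong X y y' \<longleftrightarrow> star_cong Z (w @ y @ w) (w @ y' @ w)"
  using assms unfolding star_H_class[OF idemX] using unit_transfer by blast

lemma transfer_class:
  assumes "star_class X y \<in> HX"
  shows "transfer (star_class X y) = star_class Z (w @ y @ w)"
proof -
  define y' where "y' = (SOME u. u \<in> star_class X y)"
  have "y' \<in> star_class X y"
    unfolding y'_def by (rule someI[of _ y]) (simp add: star_cong_refl)
  then have c: "star_cong X y y'" by simp
  then have "star_class X y' \<in> HX" using assms star_class_eq by metis
  then show ?thesis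
    using HX_cong[OF assms] c unfolding transfer_def y'_def[symmetric] star_class_eq
    using star_cong_sym by blast
qed

lemma HX_cases:
  assumes "C \<in> HX"
  obtains y where "C = star_class X y" "star_class X y \<in> HX"
proof -
  have "C \<in> carrier (star_monoid X)" using assms by (auto simp: H_class_def R_class_def)
  then show ?thesis using that assms star_class_cases by metis
qed

lemma transfer_mem:
  assumes "C \<in> HX"
  shows "transfer C \<in> HZ"
proof -
  obtain y where y: "C = star_class X y" "star_class X y \<in> HX" using HX_cases[OF assms] .
  show ?thesis unfolding y(1) transfer_class[OF y(2)] by (rule HZ_all)
qed

lemma transfer_inj: "inj_on transfer HX"
proof (rule inj_onI)
  fix C D assume CD: "C \<in> HX" "D \<in> HX" "transfer C = transfer D"
  obtain y where y: "C = star_class X y" "star_class X y \<in> HX" using HX_cases[OF CD(1)] .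
  obtain z where z: "D = star_class X z" "star_class X z \<in> HX" using HX_cases[OF CD(2)] .
  show "C = D"
    using CD(3) HX_cong[OF y(2) z(2)] unfolding y(1) z(1) transfer_class[OF y(2)] transfer_class[OF z(2)]
      star_class_eq by blast
qed

text \<open>Modulo X, \<open>y z\<close> may be replaced by \<open>y w z\<close> because
  \<open>y w\<close> is congruent to \<open>y\<close>; modulo Z, \<open>w y w z w\<close> is the
  product of the two images because \<open>w\<close> is idempotent.\<close>

lemma transfer_mult:
  assumes "C \<in> HX" "D \<in> HX"
  shows "transfer (C \<otimes>\<^bsub>star_monoid X\<^esub> D) = transfer C \<otimes>\<^bsub>star_monoid Z\<^esub> transfer D"
proof -
  obtain y where y: "C = star_class X y" "star_class X y \<in> HX" using HX_cases[OF assms(1)] .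
  obtain z where z: "D = star_class X z" "star_class X z \<in> HX" using HX_cases[OF assms(2)] .
  have yz: "star_class X (y @ z) \<in> HX"
    using monoid.H_class_mult[OF star_monoid_monoid _ y(2) z(2)] idemX
    by (simp add: star_class_idem star_class_mult)
  have "star_cong X (y @ w) y" using y(2) unfolding star_H_class[OF idemX] by blast
  then have "star_cong X ((y @ w) @ z) (y @ z)" by (intro star_cong_append star_cong_refl)
  then have yz': "star_cong X (y @ z) (y @ w @ z)" using star_cong_sym by simp
  then have "star_class X (y @ w @ z) \<in> HX" using yz star_class_eq by metis
  then have "star_cong Z (w @ (y @ z) @ w) (w @ (y @ w @ z) @ w)" using HX_cong[OF yz] yz' by blast
  moreover have "star_cong Z ((w @ y) @ (w @ w) @ (z @ w)) ((w @ y) @ w @ (z @ w))"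
    by (intro star_cong_append star_cong_refl idemZ)
  then have "star_cong Z (w @ (y @ w @ z) @ w) ((w @ y @ w) @ (w @ z @ w))"
    using star_cong_sym by simp
  ultimately have "star_cong Z (w @ (y @ z) @ w) ((w @ y @ w) @ (w @ z @ w))"
    by (rule star_cong_trans)
  then show ?thesis
    unfolding y(1) z(1) star_class_mult transfer_class[OF y(2)] transfer_class[OF z(2)]
      transfer_class[OF yz] star_class_eq .
qed

text \<open>One word \<open>y\<close> represents \<open>h\<close> for both codes. Since
  \<open>h = e h e\<close>, its class for Z is also that of \<open>w y w\<close>, the transfer of
  its class for X.\<close>

lemma transfer_hat:
  assumes X: "star_recognizable X" and Z: "star_recognizable Z"
    and e: "e \<in> idempotents pmon" "star_hat X e = star_class X w" "star_hat Z e = star_class Z w"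
    and h: "h \<in> H_class pmon e"
  shows "transfer (star_hat X h) = star_hat Z h"
proof -
  interpret P: monoid pmon by (rule free_profinite_monoid_monoid)
  have hc: "h \<in> profinite_carrier" "e \<otimes>\<^bsub>pmon\<^esub> h = h" "h \<otimes>\<^bsub>pmon\<^esub> e = h"
    using h P.H_class_idem_iff[OF e(1)] by auto
  have ec: "e \<in> profinite_carrier" using e(1) by (simp add: idempotents_def)
  let ?\<theta> = "syntactic_congruence (lang_star X) \<inter> syntactic_congruence (lang_star Z)"
  have t: "?\<theta> \<in> finite_congruences" using finite_congruences_Int[OF X Z] .
  obtain y where y: "h ?\<theta> = ?\<theta> `` {y}" using profinite_rep[OF hc(1) t] .
  have yX: "star_hat X h = star_class X y" and yZ: "star_hat Z h = star_class Z y"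
    unfolding syntactic_hat_def using profinite_coarsen[OF hc(1) t _ _ y] X Z by blast+
  have "star_hat X h \<in> HX"
    using hom_H_class(2)[OF free_profinite_monoid_monoid star_monoid_monoid star_hat_hom[OF X] e(1)] h
    unfolding e(2) by blast
  then have yH: "star_class X y \<in> HX" unfolding yX .
  have hm: "star_hat Z (a \<otimes>\<^bsub>pmon\<^esub> b) = star_hat Z a \<otimes>\<^bsub>star_monoid Z\<^esub> star_hat Z b"
    if "a \<in> profinite_carrier" "b \<in> profinite_carrier" for a b
    using hom_mult[OF star_hat_hom[OF Z]] that by simp
  have "star_hat Z e \<otimes>\<^bsub>star_monoid Z\<^esub> star_hat Z h \<otimes>\<^bsub>star_monoid Z\<^esub> star_hat Z e = star_hat Z h"
    unfolding hm[OF ec hc(1), symmetric] hc(2) hm[OF hc(1) ec, symmetric] hc(3) ..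
  then show ?thesis
    unfolding yX transfer_class[OF yH] e(3) yZ star_class_mult by simp
qed

end

locale recurrent_bifix =
  fixes F Z X :: "'a::finite list set"
  assumes F: "recurrent_set F" and Z: "bifix_free Z" and X: "X = Z \<inter> F"
    and recX: "star_recognizable X" and recZ: "star_recognizable Z"
begin

text \<open>A word of F containing \<open>w0\<close> and representing \<open>e\<close> modulo both
  congruences at once: full as an extension of \<open>w0\<close>, idempotent because
  \<open>e\<close> is.\<close>

lemma approximating_word:
  assumes e: "e \<in> J_idempotents F" and w0: "w0 \<in> F" "full Z w0"
  obtains w v where "full_idempotent_word Z F X w v"
    "star_hat X e = star_class X w" "star_hat Z e = star_class Z w"
proof -
  let ?\<theta> = "syntactic_congruence (lang_star X) \<inter> syntactic_congruence (lang_star Z)"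
  have t: "?\<theta> \<in> finite_congruences" using finite_congruences_Int[OF recX recZ] .
  have eJ: "e \<in> J_of_set F" "e \<otimes>\<^bsub>pmon\<^esub> e = e" using e by (auto simp: J_idempotents_def idempotents_def)
  have ec: "e \<in> profinite_carrier" using J_of_set_class(2)[OF F eJ(1)] .
  obtain a b where ab: "a @ w0 @ b \<in> F" "e ?\<theta> = ?\<theta> `` {a @ w0 @ b}"
    using J_of_set_approx[OF F eJ(1) w0(1) t] by blast
  define w where "w = a @ w0 @ b"
  have full: "full Z w" unfolding w_def by (rule full_factor[OF Z w0(2)])
  have hat: "star_hat X e = star_class X w" "star_hat Z e = star_class Z w"
    unfolding syntactic_hat_def w_def using profinite_coarsen[OF ec t _ _ ab(2)] recX recZ by blast+
  have idem: "star_cong Y (w @ w) w" if "star_hat Y e = star_class Y w" "star_recognizable Y" for Y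
    using profinite_mult[OF that(2), of e w e w] that(1) eJ(2)
    unfolding syntactic_hat_def star_class_eq[symmetric] by simp
  obtain v where "w @ v @ w \<in> F" using F ab(1) unfolding recurrent_set_def w_def by blast
  then have "full_idempotent_word Z F X w v"
    using Z F X full idem[OF hat(1) recX] idem[OF hat(2) recZ]
    by unfold_locales (auto simp: recurrent_set_def)
  then show ?thesis using that hat by blast
qed

text \<open>Each element of a maximal subgroup is a prefix of its idempotent, so a word \<open>f \<in> F\<close> close to
  that idempotent has prefixes acting as every element of the group; transitivity of the group on
  the parses of \<open>w\<close> then produces as many parses of \<open>f\<close>.\<close>

lemma charged_full:
  assumes deg: "code_degree Z < \<infinity>" and ch: "charged F Z"
  shows "\<exists>f\<in>F. full Z f"
proof -
  interpret P: monoid pmon by (rule free_profinite_monoid_monoid)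
  interpret M: monoid "star_monoid Z" by (rule star_monoid_monoid)
  obtain e where e: "e \<in> J_idempotents F" using J_idempotents_nonempty[OF F] by blast
  then have eJ: "e \<in> J_of_set F" "e \<in> idempotents pmon" by (auto simp: J_idempotents_def)
  have eF: "e \<in> profinite_closure F" using J_of_set(2)[OF F] eJ(1) by blast
  have img: "star_hat Z ` H_class pmon e = H_class (star_monoid Z) (star_hat Z e)"
    and sub: "H_class (star_monoid Z) (star_hat Z e) \<subseteq> J_of_code Z"
    using ch e unfolding charged_iff[OF F recZ] by blast+
  have ei: "star_hat Z e \<in> idempotents (star_monoid Z)"
    using hom_H_class(1)[OF free_profinite_monoid_monoid star_monoid_monoid star_hat_hom[OF recZ] eJ(2)] .
  obtain w0 where w0: "full Z w0" using code_degree_full[OF Z deg] by blast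
  have "star_hat Z e \<in> minimum_ideal (star_monoid Z)"
    using sub M.idem_in_H_class[OF ei] unfolding J_of_code_def by blast
  then have "star_hat Z e \<in> principal_ideal (star_monoid Z) (star_class Z w0)"
    by (rule M.minimum_ideal_J[OF star_monoid_finite[OF recZ] _ star_class_carrier])
  then obtain C D where CD: "C \<in> carrier (star_monoid Z)" "D \<in> carrier (star_monoid Z)"
    "star_hat Z e = C \<otimes>\<^bsub>star_monoid Z\<^esub> star_class Z w0 \<otimes>\<^bsub>star_monoid Z\<^esub> D"
    unfolding principal_ideal_def by blast
  obtain a where a: "C = star_class Z a" using star_class_cases[OF CD(1)] .
  obtain b where b: "D = star_class Z b" using star_class_cases[OF CD(2)] .
  \<comment> \<open>The image of \<open>e\<close> lies in the minimum ideal and is therefore a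
    multiple of the class of the full word \<open>w0\<close>. The resulting \<open>w\<close> is full
    and represents \<open>e\<close> modulo Z, but need not belong to F.\<close>
  define w where "w = a @ w0 @ b"
  have ew: "star_hat Z e = star_class Z w" using CD(3) unfolding a b w_def star_class_mult by simp
  have full: "full Z w" unfolding w_def by (rule full_factor[OF Z w0])
  have idem: "star_cong Z (w @ w) w" using ei unfolding ew star_class_idem .
  obtain f where f: "f \<in> F" "\<forall>k\<in>profinite_carrier. \<forall>m\<in>profinite_carrier. k \<otimes>\<^bsub>pmon\<^esub> m = e \<longrightarrow>
    (\<exists>p. prefix p f \<and> k (syntactic_congruence (lang_star Z)) = star_class Z p)"
    using closure_prefixes[OF eF recZ] by blast
  have pre: "\<exists>p. prefix p f \<and> star_class Z y = star_class Z p"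
    if y: "star_class Z y \<in> H_class (star_monoid Z) (star_class Z w)" for y
  proof -
    obtain h where h: "h \<in> H_class pmon e" "star_hat Z h = star_class Z y"
      using y img unfolding ew by (metis imageE)
    obtain k where "k \<in> carrier pmon" "h \<otimes>\<^bsub>pmon\<^esub> k = e" "h \<in> carrier pmon"
      using h(1) P.H_class_idem_iff[OF eJ(2)] by blast
    then show ?thesis using f(2) h(2) unfolding syntactic_hat_def by (metis carrier_pmon)
  qed
  have step: "\<exists>g. g \<in> starts Z f \<and> rest w r @ g \<in> lang_star Z" if r: "r \<in> starts Z w" for r
  proof -
    have grp: "star_class Z (w @ r @ w) \<in> H_class (star_monoid Z) (star_class Z w)"
      using full_group_H[OF Z full idem] .
    \<comment> \<open>The prefix \<open>p\<close> acts as \<open>w r w\<close>, which joins the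
      start \<open>r\<close> to the trivial one. Stripping code words from the end of
      \<open>p\<close> gives a start \<open>g\<close> of \<open>f\<close> that determines
      \<open>r\<close>, by \<open>rest_unique\<close>.\<close>
    obtain p where p: "prefix p f" "star_class Z (w @ r @ w) = star_class Z p" using pre[OF grp] by blast
    have "rest w r @ w @ r @ w \<in> lang_star Z" by (rule full_transitive[OF Z full idem r])
    then have rp: "rest w r @ p \<in> lang_star Z"
      using star_congD[where Y = Z and u = "w @ r @ w" and v = p and x = "rest w r" and y = "[]"] p(2) unfolding star_class_eq by simp
    obtain g x where g: "p = g @ x" "x \<in> lang_star Z" "g \<notin> UNIV @@ Z"
      using start_decomp[of Z p] Z unfolding bifix_free_def by blast
    have "rest w r @ g \<in> lang_star Z" using left_unitary[OF Z g(2), of "rest w r @ g"] rp g(1) by simp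
    moreover have "g \<in> starts Z f" using p(1) g(1,3) by (auto simp: starts_def prefix_def)
    ultimately show ?thesis by blast
  qed
  then obtain g where g: "\<And>r. r \<in> starts Z w \<Longrightarrow> g r \<in> starts Z f \<and> rest w r @ g r \<in> lang_star Z"
    by metis
  have "inj_on g (starts Z w)"
    using rest_unique[OF Z] g by (intro inj_onI) metis
  then have "card (starts Z w) \<le> card (starts Z f)"
    using g by (intro card_inj_on_le starts_finite) auto
  then have "full Z f" using full le_trans unfolding full_def by blast
  then show ?thesis using f(1) by blast
qed

text \<open>Hides the approximating word: the map is stated in terms of the images of
  \<open>e\<close> alone.\<close>

lemma transfer_exists:
  assumes e: "e \<in> J_idempotents F" and f: "f \<in> F" "full Z f"
  defines "HX \<equiv> H_class (star_monoid X) (star_hat X e)"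
    and "HZ \<equiv> H_class (star_monoid Z) (star_hat Z e)"
  obtains T where "inj_on T HX" "T ` HX \<subseteq> HZ" "HZ \<subseteq> J_of_code Z"
    "\<And>C D. C \<in> HX \<Longrightarrow> D \<in> HX \<Longrightarrow> T (C \<otimes>\<^bsub>star_monoid X\<^esub> D) = T C \<otimes>\<^bsub>star_monoid Z\<^esub> T D"
    "\<And>h. h \<in> H_class pmon e \<Longrightarrow> T (star_hat X h) = star_hat Z h"
    "star_hat X ` H_class pmon e \<subseteq> HX"
proof -
  have ei: "e \<in> idempotents pmon" using e by (simp add: J_idempotents_def)
  obtain w v where w: "full_idempotent_word Z F X w v"
    "star_hat X e = star_class X w" "star_hat Z e = star_class Z w"
    using approximating_word[OF e f] .
  interpret full_idempotent_word Z F X w v by (rule w(1))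
  show ?thesis
  proof (rule that[of transfer])
    show "star_hat X ` H_class pmon e \<subseteq> HX" unfolding HX_def
      by (rule hom_H_class(2)[OF free_profinite_monoid_monoid star_monoid_monoid star_hat_hom[OF recX] ei])
  qed (use transfer_inj transfer_mem HZ_minimum[OF recZ] transfer_mult
      transfer_hat[OF recX recZ ei w(2,3)] in \<open>auto simp: HX_def HZ_def w(2,3)\<close>)
qed

text \<open>\<open>T\<close> after the map for X is the map for Z, which is onto; so
  \<open>T\<close> is onto, and its injectivity makes the map for X onto as well.\<close>

lemma charged_bij:
  assumes e: "e \<in> J_idempotents F" and f: "f \<in> F" "full Z f" and ch: "charged F Z"
  shows "star_hat X ` H_class pmon e = H_class (star_monoid X) (star_hat X e)"
    and "(star_monoid X)\<lparr>carrier := H_class (star_monoid X) (star_hat X e), one := star_hat X e\<rparr> \<cong>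
      (star_monoid Z)\<lparr>carrier := H_class (star_monoid Z) (star_hat Z e), one := star_hat Z e\<rparr>"
proof -
  let ?HX = "H_class (star_monoid X) (star_hat X e)" and ?HZ = "H_class (star_monoid Z) (star_hat Z e)"
  obtain T where T: "inj_on T ?HX" "T ` ?HX \<subseteq> ?HZ" "?HZ \<subseteq> J_of_code Z"
    "\<And>C D. C \<in> ?HX \<Longrightarrow> D \<in> ?HX \<Longrightarrow> T (C \<otimes>\<^bsub>star_monoid X\<^esub> D) = T C \<otimes>\<^bsub>star_monoid Z\<^esub> T D"
    "\<And>h. h \<in> H_class pmon e \<Longrightarrow> T (star_hat X h) = star_hat Z h"
    "star_hat X ` H_class pmon e \<subseteq> ?HX"
    by (rule transfer_exists[OF e f]) blast
  have img: "star_hat Z ` H_class pmon e = ?HZ" using ch e unfolding charged_iff[OF F recZ] by blast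
  have pre: "\<exists>h\<in>H_class pmon e. D = T (star_hat X h)" if "D \<in> ?HZ" for D
    using that T(5) unfolding img[symmetric] by force
  have "C \<in> star_hat X ` H_class pmon e" if C: "C \<in> ?HX" for C
  proof -
    obtain h where h: "h \<in> H_class pmon e" "T C = T (star_hat X h)" using pre T(2) C by blast
    then have "C = star_hat X h" using inj_onD[OF T(1) h(2) C] T(6) by blast
    then show ?thesis using h(1) by blast
  qed
  then show "star_hat X ` H_class pmon e = ?HX" using T(6) by blast
  have "?HZ \<subseteq> T ` ?HX" using pre T(6) by blast
  then have "bij_betw T ?HX ?HZ" using T(1,2) by (auto simp: bij_betw_def)
  then have "T \<in> iso ((star_monoid X)\<lparr>carrier := ?HX, one := star_hat X e\<rparr>)
      ((star_monoid Z)\<lparr>carrier := ?HZ, one := star_hat Z e\<rparr>)"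
    using T(2,4) by (auto simp: iso_def hom_def)
  then show "(star_monoid X)\<lparr>carrier := ?HX, one := star_hat X e\<rparr> \<cong>
      (star_monoid Z)\<lparr>carrier := ?HZ, one := star_hat Z e\<rparr>" unfolding is_iso_def by blast
qed

lemma G_in_iso:
  assumes e: "e \<in> J_idempotents F"
  shows "G_in F X \<cong> (star_monoid X)\<lparr>carrier := H_class (star_monoid X) (star_hat X e), one := star_hat X e\<rparr>"
    and "order (G_in F X) = card (H_class (star_monoid X) (star_hat X e))"
proof -
  interpret M: monoid "star_monoid X" by (rule star_monoid_monoid)
  have ei: "e \<in> idempotents pmon" using e by (simp add: J_idempotents_def)
  have i: "star_hat X e \<in> idempotents (star_monoid X)"
    by (rule hom_H_class(1)[OF free_profinite_monoid_monoid star_monoid_monoid star_hat_hom[OF recX] ei])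
  have J: "J_in F X = J_class (star_monoid X) (star_hat X e)" by (rule J_in_eq[OF F recX e])
  have m: "star_hat X e \<in> J_in F X"
    unfolding J using M.H_class_subset_J_class[OF i] M.idem_in_H_class[OF i] by blast
  have D: "f \<in> principal_ideal (star_monoid X) g" if "f \<in> J_in F X" "g \<in> J_in F X" for f g
    using that M.in_principal_ideal[of f] unfolding J J_class_def by auto
  note S = schuetzenberger_group_iso[OF star_monoid_monoid star_monoid_finite[OF recX] i m D]
  show "G_in F X \<cong> (star_monoid X)\<lparr>carrier := H_class (star_monoid X) (star_hat X e), one := star_hat X e\<rparr>"
    and "order (G_in F X) = card (H_class (star_monoid X) (star_hat X e))"
    unfolding G_in_def by (rule S(2) S(3); assumption)+
qed

lemma G_of_code_iso:
  assumes e: "e \<in> J_idempotents F" and sub: "H_class (star_monoid Z) (star_hat Z e) \<subseteq> J_of_code Z"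
  shows "(star_monoid Z)\<lparr>carrier := H_class (star_monoid Z) (star_hat Z e), one := star_hat Z e\<rparr> \<cong> G_of_code Z"
    and "order (G_of_code Z) = card (H_class (star_monoid Z) (star_hat Z e))"
proof -
  interpret M: monoid "star_monoid Z" by (rule star_monoid_monoid)
  note fin = star_monoid_finite[OF recZ]
  have ei: "e \<in> idempotents pmon" using e by (simp add: J_idempotents_def)
  have i: "star_hat Z e \<in> idempotents (star_monoid Z)"
    by (rule hom_H_class(1)[OF free_profinite_monoid_monoid star_monoid_monoid star_hat_hom[OF recZ] ei])
  have m: "star_hat Z e \<in> J_of_code Z" using sub M.idem_in_H_class[OF i] by blast
  have D: "f \<in> principal_ideal (star_monoid Z) g" if "f \<in> J_of_code Z" "g \<in> J_of_code Z" for f g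
    using that M.minimum_ideal_J[OF fin, of f g] M.minimum_ideal_least(1)[OF fin]
    unfolding J_of_code_def monoid_ideal_def by blast
  note S = schuetzenberger_group_iso[OF star_monoid_monoid fin i m D]
  show "(star_monoid Z)\<lparr>carrier := H_class (star_monoid Z) (star_hat Z e), one := star_hat Z e\<rparr> \<cong> G_of_code Z"
    and "order (G_of_code Z) = card (H_class (star_monoid Z) (star_hat Z e))"
    unfolding G_of_code_def by (rule S(1) S(3); assumption)+
qed

lemma charged_imp_iso:
  assumes f: "f \<in> F" "full Z f" and ch: "charged F Z"
  shows "weakly_charged F X" and "G_in F X \<cong> G_of_code Z"
proof -
  show "weakly_charged F X"
    unfolding weakly_charged_iff[OF F recX] using charged_bij(1)[OF _ f ch] by blast
  obtain e where e: "e \<in> J_idempotents F" using J_idempotents_nonempty[OF F] by blast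
  have sub: "H_class (star_monoid Z) (star_hat Z e) \<subseteq> J_of_code Z"
    using ch e unfolding charged_iff[OF F recZ] by blast
  show "G_in F X \<cong> G_of_code Z"
    by (rule iso_trans[OF G_in_iso(1)[OF e] iso_trans[OF charged_bij(2)[OF e f ch] G_of_code_iso(1)[OF e sub]]])
qed

lemma order_imp_charged:
  assumes f: "f \<in> F" "full Z f" and ord: "order (G_in F X) = order (G_of_code Z)"
    and wc: "weakly_charged F X"
  shows "charged F Z"
  unfolding charged_iff[OF F recZ]
proof
  fix e assume e: "e \<in> J_idempotents F"
  let ?HX = "H_class (star_monoid X) (star_hat X e)" and ?HZ = "H_class (star_monoid Z) (star_hat Z e)"
  obtain T where T: "inj_on T ?HX" "T ` ?HX \<subseteq> ?HZ" "?HZ \<subseteq> J_of_code Z"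
    "\<And>h. h \<in> H_class pmon e \<Longrightarrow> T (star_hat X h) = star_hat Z h"
    using transfer_exists[OF e f] by metis
  have "finite ?HZ"
    using star_monoid_finite[OF recZ] by (rule rev_finite_subset) (auto simp: H_class_def R_class_def)
  moreover have "card ?HZ \<le> card (T ` ?HX)"
    using ord G_in_iso(2)[OF e] G_of_code_iso(2)[OF e T(3)] card_image[OF T(1)] by simp
  ultimately have onto: "T ` ?HX = ?HZ" using card_seteq[OF _ T(2)] by blast
  have "star_hat X ` H_class pmon e = ?HX" using wc e unfolding weakly_charged_iff[OF F recX] by blast
  then have "?HZ = T ` star_hat X ` H_class pmon e" using onto by simp
  also have "\<dots> = star_hat Z ` H_class pmon e" using T(4) by (simp add: image_image)
  finally show "star_hat Z ` H_class pmon e = ?HZ \<and> ?HZ \<subseteq> J_of_code Z" using T(3) by simp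
qed

end

theorem theorem4p8:
  fixes F Z X :: "'a::finite list set"
  assumes "recurrent_set F"
    and "Z \<subseteq> nonempty_words"
    and "rational Z"
    and "bifix_code Z"
    and "code_degree Z < \<infinity>"
    and "X = Z \<inter> F"
    and "rational X"
  shows "(charged F Z \<longleftrightarrow>
            degree_in F X = code_degree Z \<and> G_in F X \<cong> G_of_code Z \<and> weakly_charged F X) \<and>
         (charged F Z \<longleftrightarrow>
            degree_in F X = code_degree Z \<and> order (G_in F X) = order (G_of_code Z) \<and>
            weakly_charged F X)"
proof -
  have Z: "bifix_free Z" by (rule bifix_code_free[OF assms(4)])
  interpret recurrent_bifix F Z X
    using assms Z by unfold_locales (auto intro!: rational_star)
  have deg: "degree_in F X = code_degree Z \<longleftrightarrow> (\<exists>f\<in>F. full Z f)"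
    unfolding assms(6) by (rule degree_in_full_iff[OF Z assms(5,1)])
  have 1: "(\<exists>f\<in>F. full Z f) \<and> G_in F X \<cong> G_of_code Z \<and> weakly_charged F X" if "charged F Z"
    using charged_full[OF assms(5) that] charged_imp_iso[OF _ _ that] by blast
  have 2: "charged F Z"
    if "\<exists>f\<in>F. full Z f" "order (G_in F X) = order (G_of_code Z)" "weakly_charged F X"
    using order_imp_charged that by blast
  \<comment> \<open>Isomorphic groups have the same order, so the second condition implies the
    third, and only the third has to give back the first.\<close>
  show ?thesis unfolding deg using 1 2 iso_same_card unfolding order_def by metis
qed

end
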